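(* A transverse, signature-type changing manifold $(M,\tilde g)$ with a transverse radical that is both pseudo-time orientable and pseudo-space orientable is not necessarily orientable. That is, there exists a transverse, signature-type changing manifold $(M,\tilde g)$ with a transverse radical such that $(M,\tilde g)$ is pseudo-time orientable and pseudo-space orientable, but the smooth manifold $M$ is not orientable.
   Context: A transverse, signature-type changing manifold $(M,\tilde g)$ is a smooth manifold $M$ (possibly with boundary) of dimension $n\ge 2$ with a smooth symmetric $(0,2)$-tensor field $\tilde g$ such that, with $\mathcal{H}:=\{q\in M:\tilde g|_q\text{ is degenerate}\}$: (a) $\mathcal{H}\neq\varnothing$, and $d(\det(\tilde g_{\mu\nu}))_q\neq 0$ for every $q\in\mathcal{H}$ and every local coordinate system around $q$ (so that $\mathcal{H}$ is a smoothly embedded hypersurface); (b) the bilinear type of $\tilde g$ changes when crossing $\mathcal{H}$; one connected component $M_R$ of $M\setminus\mathcal{H}$ is Riemannian (that is, $\tilde g$ is positive definite there), and all other connected components of $M\setminus\mathcal{H}$ are Lorentzian (signature $(-,+,\dots,+)$). The union of the Lorentzian components is denoted $M_L$. At each $q\in\mathcal{H}$ the radical $\mathrm{Rad}_q:=\{w\in T_qM:\tilde g_q(w,v)=0\text{ for all }v\in T_qM\}$ is one-dimensional. The radical is transverse if $\mathrm{Rad}_q\oplus T_q\mathcal{H}=T_qM$ for all $q\in\mathcal{H}$. $(M,\tilde g)$ is pseudo-time orientable if the Lorentzian region $(M_L,\tilde g|_{M_L})$ is time orientable. $(M,\tilde g)$ is pseudo-space orientable if there is a continuous non-vanishing spacelike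 $(n-1)$-frame field on $M_L$, i.e. a set of $n-1$ continuous vector fields on $M_L$ that are pointwise orthonormal and spacelike. $M$ is orientable if it admits a smooth nowhere vanishing $n$-form. *)

theory Defs
  imports "HOL-Analysis.Analysis" "Jordan_Normal_Form.Determinant"
begin

section \<open>Smooth functions on subsets of Euclidean space\<close>

text \<open>Points of \<open>n\<close>-space are the elements of \<^const>\<open>Euclidean_space\<close>\<open> n\<close>: functions
  \<open>nat \<Rightarrow> real\<close> that vanish at all indices \<open>\<ge> n\<close>; coordinates are numbered from 0.\<close>

text \<open>The derivative is taken within \<open>S\<close>. At an interior point of \<open>S\<close> it is the usual partial
  derivative; at a boundary point of a relatively open subset of the half-space it is one-sided
  in the normal direction.\<close>

definition partial_within :: "(nat \<Rightarrow> real) set \<Rightarrow> nat \<Rightarrow> ((nat \<Rightarrow> real) \<Rightarrow> real) \<Rightarrow> (nat \<Rightarrow> real) \<Rightarrow> real"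
  where "partial_within S i f x =
    vector_derivative (\<lambda>t. f (x(i := t))) (at (x i) within {t. x(i := t) \<in> S})"

primrec Ck_open :: "nat \<Rightarrow> (nat \<Rightarrow> real) set \<Rightarrow> nat \<Rightarrow> ((nat \<Rightarrow> real) \<Rightarrow> real) \<Rightarrow> bool"
  where
    "Ck_open n S 0 f \<longleftrightarrow> continuous_map (subtopology (Euclidean_space n) S) euclideanreal f"
  | "Ck_open n S (Suc k) f \<longleftrightarrow>
       continuous_map (subtopology (Euclidean_space n) S) euclideanreal f \<and>
       (\<forall>i<n. (\<forall>x\<in>S. (\<lambda>t. f (x(i := t))) differentiable (at (x i) within {t. x(i := t) \<in> S})) \<and>
               Ck_open n S k (partial_within S i f))"

definition smooth_open :: "nat \<Rightarrow> (nat \<Rightarrow> real) set \<Rightarrow> ((nat \<Rightarrow> real) \<Rightarrow> real) \<Rightarrow> bool"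
  where "smooth_open n S f \<longleftrightarrow> openin (Euclidean_space n) S \<and> (\<forall>k. Ck_open n S k f)"

text \<open>Smoothness on an arbitrary subset: local extendability to a smooth function on an open set.\<close>

definition smooth_on :: "nat \<Rightarrow> (nat \<Rightarrow> real) set \<Rightarrow> ((nat \<Rightarrow> real) \<Rightarrow> real) \<Rightarrow> bool"
  where "smooth_on n S f \<longleftrightarrow> S \<subseteq> topspace (Euclidean_space n) \<and>
    (\<forall>x\<in>S. \<exists>U F. x \<in> U \<and> smooth_open n U F \<and> (\<forall>y\<in>S \<inter> U. F y = f y))"


section \<open>Smooth manifolds, possibly with boundary\<close>

type_synonym 'a chart = "'a set \<times> ('a \<Rightarrow> nat \<Rightarrow> real)"

record 'a manifold =
  dim_of :: nat
  top_of :: "'a topology"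
  atlas_of :: "'a chart set"

abbreviation points :: "'a manifold \<Rightarrow> 'a set"
  where "points M \<equiv> topspace (top_of M)"

definition chart_image :: "'a chart \<Rightarrow> (nat \<Rightarrow> real) set"
  where "chart_image c = snd c ` fst c"

definition chart_inv :: "'a chart \<Rightarrow> (nat \<Rightarrow> real) \<Rightarrow> 'a"
  where "chart_inv c = inv_into (fst c) (snd c)"

definition half_space :: "nat \<Rightarrow> (nat \<Rightarrow> real) set"
  where "half_space n = {x \<in> topspace (Euclidean_space n). x 0 \<ge> 0}"

text \<open>The image of a chart is open in \<open>n\<close>-space or relatively open in the half-space.\<close>

definition is_chart :: "nat \<Rightarrow> 'a topology \<Rightarrow> 'a chart \<Rightarrow> bool"
  where "is_chart n X c \<longleftrightarrow> openin X (fst c) \<and>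
    (openin (Euclidean_space n) (chart_image c) \<or>
     openin (subtopology (Euclidean_space n) (half_space n)) (chart_image c)) \<and>
    homeomorphic_map (subtopology X (fst c)) (subtopology (Euclidean_space n) (chart_image c)) (snd c)"

definition transition :: "'a chart \<Rightarrow> 'a chart \<Rightarrow> nat \<Rightarrow> (nat \<Rightarrow> real) \<Rightarrow> real"
  where "transition c d i x = snd d (chart_inv c x) i"

definition overlap :: "'a chart \<Rightarrow> 'a chart \<Rightarrow> (nat \<Rightarrow> real) set"
  where "overlap c d = snd c ` (fst c \<inter> fst d)"

definition compatible :: "nat \<Rightarrow> 'a chart \<Rightarrow> 'a chart \<Rightarrow> bool"
  where "compatible n c d \<longleftrightarrow>
    (\<forall>i<n. smooth_on n (overlap c d) (transition c d i)) \<and>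
    (\<forall>i<n. smooth_on n (overlap d c) (transition d c i))"

text \<open>The atlas is maximal, so its elements are all the local coordinate systems.\<close>

definition smooth_manifold :: "'a manifold \<Rightarrow> bool"
  where "smooth_manifold M \<longleftrightarrow>
    Hausdorff_space (top_of M) \<and> second_countable (top_of M) \<and>
    (\<forall>c\<in>atlas_of M. is_chart (dim_of M) (top_of M) c) \<and>
    (\<Union>c\<in>atlas_of M. fst c) = points M \<and>
    (\<forall>c\<in>atlas_of M. \<forall>d\<in>atlas_of M. compatible (dim_of M) c d) \<and>
    (\<forall>c. is_chart (dim_of M) (top_of M) c \<and> (\<forall>d\<in>atlas_of M. compatible (dim_of M) c d)
          \<longrightarrow> c \<in> atlas_of M)"

definition charts_at :: "'a manifold \<Rightarrow> 'a \<Rightarrow> 'a chart set"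
  where "charts_at M p = {c \<in> atlas_of M. p \<in> fst c}"


section \<open>Tangent vectors\<close>

text \<open>A tangent vector at \<open>p\<close> assigns to every chart around \<open>p\<close> its \<open>n\<close> components in that chart,
  subject to the transformation law under change of coordinates. The values that carry no
  information (other charts, indices \<open>\<ge> n\<close>) are set to 0, so that equality of tangent vectors is
  equality in HOL.\<close>

type_synonym 'a tvec = "'a chart \<Rightarrow> nat \<Rightarrow> real"

definition jacobian :: "'a chart \<Rightarrow> 'a chart \<Rightarrow> 'a \<Rightarrow> nat \<Rightarrow> nat \<Rightarrow> real"
  where "jacobian c d p i j = partial_within (overlap c d) j (transition c d i) (snd c p)"

definition tangent_space :: "'a manifold \<Rightarrow> 'a \<Rightarrow> 'a tvec set"
  where "tangent_space M p = {v.
    (\<forall>c i. c \<notin> charts_at M p \<or> i \<ge> dim_of M \<longrightarrow> v c i = 0) \<and>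
    (\<forall>c\<in>charts_at M p. \<forall>d\<in>charts_at M p. \<forall>i<dim_of M.
       v d i = (\<Sum>j<dim_of M. jacobian c d p i j * v c j))}"

definition tzero :: "'a tvec"
  where "tzero = (\<lambda>c i. 0)"

definition tadd :: "'a tvec \<Rightarrow> 'a tvec \<Rightarrow> 'a tvec"
  where "tadd v w = (\<lambda>c i. v c i + w c i)"

definition tscale :: "real \<Rightarrow> 'a tvec \<Rightarrow> 'a tvec"
  where "tscale a v = (\<lambda>c i. a * v c i)"

text \<open>The coordinate vector \<open>\<partial>/\<partial>x\<^sup>j\<close> at \<open>p\<close> of the chart \<open>c\<close>: its components in a chart \<open>d\<close> form
  the \<open>j\<close>-th column of the Jacobian matrix.\<close>

definition coord_vec :: "'a manifold \<Rightarrow> 'a chart \<Rightarrow> 'a \<Rightarrow> nat \<Rightarrow> 'a tvec"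
  where "coord_vec M c p j =
    (\<lambda>d i. if d \<in> charts_at M p \<and> i < dim_of M then jacobian c d p i j else 0)"

definition continuous_vector_field_on :: "'a manifold \<Rightarrow> 'a set \<Rightarrow> ('a \<Rightarrow> 'a tvec) \<Rightarrow> bool"
  where "continuous_vector_field_on M S V \<longleftrightarrow>
    (\<forall>p\<in>S. V p \<in> tangent_space M p) \<and>
    (\<forall>c\<in>atlas_of M. \<forall>i<dim_of M.
       continuous_map (subtopology (top_of M) (S \<inter> fst c)) euclideanreal (\<lambda>p. V p c i))"

text \<open>Smooth curves have a nondegenerate interval \<open>I\<close> containing 0 as parameter domain; 0 may be an
  endpoint, so that curves may start or end on the boundary of \<open>M\<close>.\<close>

definition smooth_curve :: "'a manifold \<Rightarrow> real set \<Rightarrow> (real \<Rightarrow> 'a) \<Rightarrow> bool"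
  where "smooth_curve M I \<gamma> \<longleftrightarrow>
    is_interval I \<and> 0 \<in> I \<and> I \<noteq> {0} \<and>
    continuous_map (top_of_set I) (top_of M) \<gamma> \<and>
    (\<forall>c\<in>atlas_of M. \<forall>i<dim_of M.
       smooth_on 1 {x \<in> topspace (Euclidean_space 1). x 0 \<in> I \<and> \<gamma> (x 0) \<in> fst c}
         (\<lambda>x. snd c (\<gamma> (x 0)) i))"

definition velocity :: "'a manifold \<Rightarrow> real set \<Rightarrow> (real \<Rightarrow> 'a) \<Rightarrow> 'a tvec"
  where "velocity M I \<gamma> = (\<lambda>c i.
    if c \<in> charts_at M (\<gamma> 0) \<and> i < dim_of M
    then vector_derivative (\<lambda>t. snd c (\<gamma> t) i) (at 0 within {t \<in> I. \<gamma> t \<in> fst c})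
    else 0)"

text \<open>The tangent space at \<open>q\<close> of an embedded submanifold \<open>N\<close>, as a subset of the tangent space
  of \<open>M\<close>: the velocities at \<open>q\<close> of the smooth curves that lie in \<open>N\<close>.\<close>

definition tangent_to :: "'a manifold \<Rightarrow> 'a set \<Rightarrow> 'a \<Rightarrow> 'a tvec set"
  where "tangent_to M N q =
    {velocity M I \<gamma> |I \<gamma>. smooth_curve M I \<gamma> \<and> \<gamma> ` I \<subseteq> N \<and> \<gamma> 0 = q}"


section \<open>Signature-type changing manifolds\<close>

type_synonym 'a metric = "'a \<Rightarrow> 'a tvec \<Rightarrow> 'a tvec \<Rightarrow> real"

definition metric_comp :: "'a manifold \<Rightarrow> 'a metric \<Rightarrow> 'a chart \<Rightarrow> nat \<Rightarrow> nat \<Rightarrow> (nat \<Rightarrow> real) \<Rightarrow> real"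
  where "metric_comp M g c i j x =
    (let p = chart_inv c x in g p (coord_vec M c p i) (coord_vec M c p j))"

definition smooth_symmetric_02_tensor :: "'a manifold \<Rightarrow> 'a metric \<Rightarrow> bool"
  where "smooth_symmetric_02_tensor M g \<longleftrightarrow>
    (\<forall>p\<in>points M. \<forall>u\<in>tangent_space M p. \<forall>v\<in>tangent_space M p.
       g p u v = g p v u \<and>
       (\<forall>w\<in>tangent_space M p. \<forall>a b.
          g p (tadd (tscale a u) (tscale b v)) w = a * g p u w + b * g p v w)) \<and>
    (\<forall>c\<in>atlas_of M. \<forall>i<dim_of M. \<forall>j<dim_of M.
       smooth_on (dim_of M) (chart_image c) (metric_comp M g c i j))"

definition Rad :: "'a manifold \<Rightarrow> 'a metric \<Rightarrow> 'a \<Rightarrow> 'a tvec set"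
  where "Rad M g q = {w \<in> tangent_space M q. \<forall>v\<in>tangent_space M q. g q w v = 0}"

definition degenerate_at :: "'a manifold \<Rightarrow> 'a metric \<Rightarrow> 'a \<Rightarrow> bool"
  where "degenerate_at M g q \<longleftrightarrow> Rad M g q \<noteq> {tzero}"

definition degeneracy_set :: "'a manifold \<Rightarrow> 'a metric \<Rightarrow> 'a set"
  where "degeneracy_set M g = {q \<in> points M. degenerate_at M g q}"

definition metric_det :: "'a manifold \<Rightarrow> 'a metric \<Rightarrow> 'a chart \<Rightarrow> (nat \<Rightarrow> real) \<Rightarrow> real"
  where "metric_det M g c x =
    Determinant.det (Matrix.mat (dim_of M) (dim_of M) (\<lambda>(i, j). metric_comp M g c i j x))"

definition riemannian_at :: "'a manifold \<Rightarrow> 'a metric \<Rightarrow> 'a \<Rightarrow> bool"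
  where "riemannian_at M g p \<longleftrightarrow> (\<forall>v\<in>tangent_space M p. v \<noteq> tzero \<longrightarrow> g p v v > 0)"

definition lorentzian_at :: "'a manifold \<Rightarrow> 'a metric \<Rightarrow> 'a \<Rightarrow> bool"
  where "lorentzian_at M g p \<longleftrightarrow>
    (\<exists>e. (\<forall>i<dim_of M. e i \<in> tangent_space M p) \<and>
         (\<forall>i<dim_of M. \<forall>j<dim_of M.
            g p (e i) (e j) = (if i = j then (if i = 0 then - 1 else 1) else 0)))"

definition regular_components :: "'a manifold \<Rightarrow> 'a metric \<Rightarrow> 'a set set"
  where "regular_components M g =
    connected_components_of (subtopology (top_of M) (points M - degeneracy_set M g))"

text \<open>The bilinear type changes across the degeneracy set: each of its points is a limit both of
  points of the Riemannian component and of points of Lorentzian components.\<close>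

definition transverse_signature_changing :: "'a manifold \<Rightarrow> 'a metric \<Rightarrow> bool"
  where "transverse_signature_changing M g \<longleftrightarrow>
    smooth_manifold M \<and> dim_of M \<ge> 2 \<and> smooth_symmetric_02_tensor M g \<and>
    degeneracy_set M g \<noteq> {} \<and>
    (\<forall>q\<in>degeneracy_set M g. \<forall>c\<in>charts_at M q. \<exists>i<dim_of M.
       partial_within (chart_image c) i (metric_det M g c) (snd c q) \<noteq> 0) \<and>
    (\<exists>R\<in>regular_components M g.
       (\<forall>p\<in>R. riemannian_at M g p) \<and>
       (\<forall>C\<in>regular_components M g - {R}. \<forall>p\<in>C. lorentzian_at M g p) \<and>
       (\<forall>q\<in>degeneracy_set M g.
          q \<in> top_of M closure_of R \<and>
          q \<in> top_of M closure_of (\<Union>(regular_components M g - {R}))))"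

definition transverse_radical :: "'a manifold \<Rightarrow> 'a metric \<Rightarrow> bool"
  where "transverse_radical M g \<longleftrightarrow>
    (\<forall>q\<in>degeneracy_set M g.
       Rad M g q \<inter> tangent_to M (degeneracy_set M g) q = {tzero} \<and>
       {tadd r h |r h. r \<in> Rad M g q \<and> h \<in> tangent_to M (degeneracy_set M g) q} = tangent_space M q)"

definition lorentzian_region :: "'a manifold \<Rightarrow> 'a metric \<Rightarrow> 'a set"
  where "lorentzian_region M g = \<Union>{C \<in> regular_components M g. \<forall>p\<in>C. lorentzian_at M g p}"

text \<open>Time orientability of the Lorentzian region: existence of a continuous timelike vector
  field.\<close>

definition pseudo_time_orientable :: "'a manifold \<Rightarrow> 'a metric \<Rightarrow> bool"
  where "pseudo_time_orientable M g \<longleftrightarrow>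
    (\<exists>V. continuous_vector_field_on M (lorentzian_region M g) V \<and>
         (\<forall>p\<in>lorentzian_region M g. g p (V p) (V p) < 0))"

text \<open>Spacelike and orthonormal together mean that the Gram matrix is the identity.\<close>

definition pseudo_space_orientable :: "'a manifold \<Rightarrow> 'a metric \<Rightarrow> bool"
  where "pseudo_space_orientable M g \<longleftrightarrow>
    (\<exists>E. (\<forall>i<dim_of M - 1. continuous_vector_field_on M (lorentzian_region M g) (E i)) \<and>
         (\<forall>p\<in>lorentzian_region M g. \<forall>i<dim_of M - 1. \<forall>j<dim_of M - 1.
            g p (E i p) (E j p) = (if i = j then 1 else 0)))"


section \<open>Orientability\<close>

text \<open>An \<open>n\<close>-form takes lists of \<open>n\<close> tangent vectors as arguments.\<close>

definition smooth_top_form :: "'a manifold \<Rightarrow> ('a \<Rightarrow> 'a tvec list \<Rightarrow> real) \<Rightarrow> bool"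
  where "smooth_top_form M \<omega> \<longleftrightarrow>
    (\<forall>p\<in>points M. \<forall>vs. length vs = dim_of M \<and> set vs \<subseteq> tangent_space M p \<longrightarrow>
       (\<forall>i<dim_of M. \<forall>u\<in>tangent_space M p. \<forall>w\<in>tangent_space M p. \<forall>a b.
          \<omega> p (vs[i := tadd (tscale a u) (tscale b w)]) =
            a * \<omega> p (vs[i := u]) + b * \<omega> p (vs[i := w])) \<and>
       (\<forall>i<dim_of M. \<forall>j<dim_of M. i \<noteq> j \<and> vs ! i = vs ! j \<longrightarrow> \<omega> p vs = 0)) \<and>
    (\<forall>c\<in>atlas_of M. smooth_on (dim_of M) (chart_image c)
       (\<lambda>x. let p = chart_inv c x in \<omega> p (map (coord_vec M c p) [0..<dim_of M])))"

definition orientable :: "'a manifold \<Rightarrow> bool"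
  where "orientable M \<longleftrightarrow>
    (\<exists>\<omega>. smooth_top_form M \<omega> \<and>
         (\<forall>p\<in>points M. \<exists>vs. length vs = dim_of M \<and> set vs \<subseteq> tangent_space M p \<and> \<omega> p vs \<noteq> 0))"

end

theory Submission
  imports Defs "HOL-Homology.Invariance_of_Domain"
begin

text \<open>The example is the open Moebius band, the quotient of the plane by
  \<open>(x, y) \<mapsto> (x + 2 \<pi>, - y)\<close>, with \<open>g = dx\<^sup>2 + (1 - y\<^sup>2) dy\<^sup>2\<close>. The determinant \<open>1 - y\<^sup>2\<close> has
  nonzero differential on \<open>\<H> = {y\<^sup>2 = 1}\<close>, and the radical there is spanned by \<open>\<partial>/\<partial>y\<close>, which is
  transverse to \<open>\<H>\<close>. The Riemannian part \<open>y\<^sup>2 < 1\<close> carries the one-sidedness, whereas the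
  Lorentzian part \<open>y\<^sup>2 > 1\<close> is a cylinder; the fields \<open>y \<partial>/\<partial>y\<close> and \<open>\<partial>/\<partial>x\<close> are invariant under the
  identification and orient it in time and in space.

  The band is realised inside four-space, which makes it Hausdorff and second countable for free,
  and its atlas consists of all charts compatible with the charts \<open>(x, y)\<close>. By invariance of domain
  no such chart has boundary points, so that all smoothness questions concern open sets.\<close>

section \<open>Calculus on open subsets of Euclidean space\<close>

text \<open>The coefficient of \<open>dy^2\<close> must be even in \<open>y\<close> to descend to
  the quotient, positive on the core circle \<open>y = 0\<close>, and must change its sign with
  nonzero slope; \<open>1 - y^2\<close> is the simplest such function. Evenness also lets
  \<open>y^2\<close> be written as a polynomial in the ambient coordinates, although
  \<open>y\<close> itself is only defined up to sign. The obstacle is that the definitions quantify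
  over the whole maximal atlas, so smoothness of the tensor, the differential of its determinant and
  smoothness of curves must be treated in charts about which nothing explicit is known. Every such
  question is pulled back along a transition map to one of the explicit charts. Since smoothness
  means existence and continuity of all iterated coordinate derivatives, this rests on a composition
  theorem for that notion, which occupies the first section. Between explicit charts a transition is
  locally a translation in \<open>x\<close> and a sign in \<open>y\<close>, so independence of the
  chart always comes down to the cancellation of a sign.\<close>

lemma subtopology_Euclidean_space:
  "S \<subseteq> topspace (Euclidean_space n) \<Longrightarrow> subtopology (Euclidean_space n) S = top_of_set S"
  by (simp add: Euclidean_space_def topspace_Euclidean_space euclidean_product_topology
      subtopology_subtopology Int_absorb1)

lemma Euclidean_space_eq_top_of_set: "Euclidean_space n = top_of_set (topspace (Euclidean_space n))"
  by (metis subtopology_Euclidean_space subtopology_topspace order_refl)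

lemma continuous_map_Euclidean_real:
  "S \<subseteq> topspace (Euclidean_space n) \<Longrightarrow>
    continuous_map (subtopology (Euclidean_space n) S) euclideanreal f \<longleftrightarrow> continuous_on S f"
  by (simp add: subtopology_Euclidean_space)

lemma continuous_on_line: "continuous_on A (\<lambda>t::real. x(i := t))"
proof (rule continuous_on_coordinatewise_then_product)
  show "continuous_on A (\<lambda>t. (x(i := t)) j)" for j
    by (cases "j = i") auto
qed

lemma line_in_Euclidean_space:
  "x \<in> topspace (Euclidean_space n) \<Longrightarrow> i < n \<Longrightarrow> x(i := t) \<in> topspace (Euclidean_space n)"
  by (auto simp: topspace_Euclidean_space)

lemma openin_Euclidean_preimage:
  assumes "openin (Euclidean_space n) S" "continuous_on A f" "f ` A \<subseteq> topspace (Euclidean_space n)"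
  shows "openin (top_of_set A) {t \<in> A. f t \<in> S}"
proof -
  have "continuous_map (top_of_set A) (Euclidean_space n) f"
    using assms(2,3) by (subst Euclidean_space_eq_top_of_set) auto
  then show ?thesis
    using assms(1) by (auto simp: continuous_map_def)
qed

lemma open_line:
  assumes "openin (Euclidean_space n) S" "x \<in> S" "i < n"
  shows "open {t. x(i := t) \<in> S}"
proof -
  have "x \<in> topspace (Euclidean_space n)"
    using assms openin_subset by blast
  then show ?thesis
    using openin_Euclidean_preimage[OF assms(1) continuous_on_line[where A=UNIV and x=x and i=i]] assms(3)
      line_in_Euclidean_space by auto

qed

lemma at_within_line:
  assumes "openin (Euclidean_space n) S" "x \<in> S" "i < n"
  shows "at (x i) within {t. x(i := t) \<in> S} = at (x i)"
  using open_line[OF assms] assms(2) by (intro at_within_open) auto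

text \<open>For \<open>S = UNIV\<close> the filter in \<open>partial_within\<close> is the full
  \<open>at (x i)\<close>. This derivative therefore refers to no open set and is the common value
  through which derivatives on different open sets are compared.\<close>

abbreviation partial :: "nat \<Rightarrow> ((nat \<Rightarrow> real) \<Rightarrow> real) \<Rightarrow> (nat \<Rightarrow> real) \<Rightarrow> real"
  where "partial \<equiv> partial_within UNIV"

abbreviation has_partial ::
    "((nat \<Rightarrow> real) \<Rightarrow> real) \<Rightarrow> nat \<Rightarrow> real \<Rightarrow> (nat \<Rightarrow> real) \<Rightarrow> bool"
  where "has_partial f i D x \<equiv> ((\<lambda>t. f (x(i := t))) has_real_derivative D) (at (x i))"

lemma partial_within_eq_partial:
  assumes "openin (Euclidean_space n) S" "x \<in> S" "i < n"
  shows "partial_within S i f x = partial i f x"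
  unfolding partial_within_def at_within_line[OF assms] by simp

lemma partialI: "has_partial f i D x \<Longrightarrow> partial i f x = D"
  unfolding partial_within_def
  by (auto simp: has_real_derivative_iff_has_vector_derivative intro: vector_derivative_at)

lemma has_partial_cong:
  assumes "openin (Euclidean_space n) S" "x \<in> S" "i < n" "\<And>y. y \<in> S \<Longrightarrow> f y = g y"
  shows "has_partial f i D x \<longleftrightarrow> has_partial g i D x"
proof (rule DERIV_cong_ev)
  show "\<forall>\<^sub>F t in nhds (x i). f (x(i := t)) = g (x(i := t))"
    using open_line[OF assms(1-3)] assms(2,4)
    by (auto simp: eventually_nhds intro!: exI[of _ "{t. x(i := t) \<in> S}"])
qed auto

lemma partial_cong:
  assumes "openin (Euclidean_space n) S" "x \<in> S" "i < n" "\<And>y. y \<in> S \<Longrightarrow> f y = g y"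
  shows "partial i f x = partial i g x"
proof -
  have "has_partial f i D x \<longleftrightarrow> has_partial g i D x" for D
    by (rule has_partial_cong[OF assms])
  then show ?thesis
    unfolding partial_within_def vector_derivative_def
    by (simp add: has_real_derivative_iff_has_vector_derivative)
qed

lemma differentiable_iff_has_partial:
  "(\<lambda>t. f (x(i := t))) differentiable (at (x i)) \<longleftrightarrow> has_partial f i (partial i f x) x"
  unfolding partial_within_def
  by (simp add: vector_derivative_works has_real_derivative_iff_has_vector_derivative)

section \<open>Restriction and locality of finite differentiability\<close>

lemma Ck_open_imp_continuous: "Ck_open n S k f \<Longrightarrow> S \<subseteq> topspace (Euclidean_space n) \<Longrightarrow> continuous_on S f"
  by (cases k) (auto simp: continuous_map_Euclidean_real)

lemma Ck_open_cong:
  assumes "openin (Euclidean_space n) S" "\<And>y. y \<in> S \<Longrightarrow> f y = g y"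
  shows "Ck_open n S k f \<longleftrightarrow> Ck_open n S k g"
  using assms(2)
proof (induction k arbitrary: f g)
  case 0
  then show ?case
    using openin_subset[OF assms(1)] by (simp add: continuous_map_Euclidean_real cong: continuous_on_cong)
next
  case (Suc k)
  have "continuous_on S f \<longleftrightarrow> continuous_on S g"
    using Suc.prems by (rule continuous_on_cong[OF refl])
  moreover have "(\<lambda>t. f (x(i := t))) differentiable (at (x i)) \<longleftrightarrow>
      (\<lambda>t. g (x(i := t))) differentiable (at (x i))" if "x \<in> S" "i < n" for x i
    using has_partial_cong[OF assms(1) that Suc.prems] partial_cong[OF assms(1) that Suc.prems]
    by (simp add: differentiable_iff_has_partial)
  moreover have "Ck_open n S k (partial_within S i f) \<longleftrightarrow> Ck_open n S k (partial_within S i g)"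
    if "i < n" for i
    using that partial_cong[OF assms(1) _ that Suc.prems]
    by (intro Suc.IH) (simp add: partial_within_eq_partial[OF assms(1)])
  ultimately show ?case
    using openin_subset[OF assms(1)]
    by (simp add: continuous_map_Euclidean_real at_within_line[OF assms(1)])
qed

text \<open>The working form of the recursion equation: since \<open>partial\<close> does not
  mention \<open>S\<close>, inductions over \<open>k\<close> can pass to smaller sets and
  glue.\<close>

lemma Ck_open_Suc_iff:
  assumes "openin (Euclidean_space n) S"
  shows "Ck_open n S (Suc k) f \<longleftrightarrow> continuous_on S f \<and>
    (\<forall>i<n. (\<forall>x\<in>S. has_partial f i (partial i f x) x) \<and> Ck_open n S k (partial i f))"
proof -
  have "Ck_open n S k (partial_within S i f) \<longleftrightarrow> Ck_open n S k (partial i f)" if "i < n" for i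
    using that partial_within_eq_partial[OF assms] by (intro Ck_open_cong[OF assms]) auto
  then show ?thesis
    using openin_subset[OF assms]
    by (simp add: continuous_map_Euclidean_real at_within_line[OF assms] differentiable_iff_has_partial)
qed

declare Ck_open.simps(2) [simp del]

text \<open>Any explicit family \<open>D\<close> of pointwise derivatives may stand in for
  \<open>partial\<close>, so the closure rules only have to exhibit the usual derivative
  formula.\<close>

lemma Ck_open_SucI:
  assumes "openin (Euclidean_space n) S" "continuous_on S f"
    and "\<And>i x. i < n \<Longrightarrow> x \<in> S \<Longrightarrow> has_partial f i (D i x) x"
    and "\<And>i. i < n \<Longrightarrow> Ck_open n S k (D i)"
  shows "Ck_open n S (Suc k) f"
proof -
  have D: "partial i f x = D i x" if "i < n" "x \<in> S" for i x
    by (rule partialI[OF assms(3)[OF that]])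
  then have "Ck_open n S k (partial i f)" if "i < n" for i
    using assms(4)[OF that] Ck_open_cong[OF assms(1), of "partial i f" "D i"] that by blast
  then show ?thesis
    using assms(2,3) D by (simp add: Ck_open_Suc_iff[OF assms(1)])
qed

lemma Ck_open_SucD: "openin (Euclidean_space n) S \<Longrightarrow> Ck_open n S (Suc k) f \<Longrightarrow> Ck_open n S k f"
proof (induction k arbitrary: f)
  case 0
  then show ?case
    by (auto simp: continuous_map_Euclidean_real openin_subset Ck_open_Suc_iff)
next
  case (Suc k)
  then show ?case
    by (simp add: Ck_open_Suc_iff)
qed

lemma Ck_open_subset:
  assumes "openin (Euclidean_space n) S" "openin (Euclidean_space n) T" "T \<subseteq> S" "Ck_open n S k f"
  shows "Ck_open n T k f"
  using assms(4)
proof (induction k arbitrary: f)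
  case 0
  then show ?case
    using assms by (auto simp: continuous_map_Euclidean_real openin_subset intro: continuous_on_subset)
next
  case (Suc k)
  then show ?case
    using assms(3) continuous_on_subset[OF _ assms(3)] Suc.IH
    by (auto simp: Ck_open_Suc_iff[OF assms(1)] Ck_open_Suc_iff[OF assms(2)])
qed

lemma continuous_on_openin_local:
  fixes f :: "'a::t2_space \<Rightarrow> 'b::topological_space"
  assumes "\<And>x. x \<in> S \<Longrightarrow> \<exists>U. openin (top_of_set S) U \<and> x \<in> U \<and> continuous_on U f"
  shows "continuous_on S f"
proof -
  show ?thesis
    unfolding continuous_on_eq_continuous_within
  proof
    fix x assume "x \<in> S"
    then obtain U where U: "openin (top_of_set S) U" "x \<in> U" "continuous_on U f"
      using assms by blast
    then obtain T where T: "open T" "U = S \<inter> T"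
      by (auto simp: openin_open)
    have "continuous (at x within (S \<inter> T)) f"
      using U T continuous_on_eq_continuous_within by blast
    moreover have "at x within (S \<inter> T) = at x within S"
      using T U by (intro at_within_nhd[of _ T]) auto
    ultimately show "continuous (at x within S) f"
      by simp
  qed
qed

lemma continuous_on_Ck_local:
  assumes "openin (Euclidean_space n) S"
    and "\<And>x. x \<in> S \<Longrightarrow> \<exists>U. x \<in> U \<and> U \<subseteq> S \<and> openin (Euclidean_space n) U \<and> Ck_open n U k f"
  shows "continuous_on S f"
proof (rule continuous_on_openin_local)
  fix x assume "x \<in> S"
  then obtain U where U: "x \<in> U" "U \<subseteq> S" "openin (Euclidean_space n) U" "Ck_open n U k f"
    using assms(2) by blast
  then have "openin (subtopology (Euclidean_space n) S) U"
    by (intro subset_openin_subtopology)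
  then have "openin (top_of_set S) U"
    using openin_subset[OF assms(1)] by (simp add: subtopology_Euclidean_space)
  moreover have "continuous_on U f"
    by (rule Ck_open_imp_continuous[OF U(4) openin_subset[OF U(3)]])
  ultimately show "\<exists>U. openin (top_of_set S) U \<and> x \<in> U \<and> continuous_on U f"
    using U(1) by blast
qed

text \<open>The induction goes through because \<open>partial i f\<close> is the same function on
  every neighbourhood, so the local hypotheses for \<open>f\<close> pass to its derivatives.\<close>

lemma Ck_open_local:
  assumes "openin (Euclidean_space n) S"
    and "\<And>x. x \<in> S \<Longrightarrow> \<exists>U. x \<in> U \<and> U \<subseteq> S \<and> openin (Euclidean_space n) U \<and> Ck_open n U k f"
  shows "Ck_open n S k f"
  using assms(2)
proof (induction k arbitrary: f)
  case 0
  have "continuous_on S f"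
    by (rule continuous_on_Ck_local[OF assms(1) 0])
  then show ?case
    using assms by (simp add: continuous_map_Euclidean_real openin_subset)
next
  case (Suc k)
  have c: "continuous_on S f"
    by (rule continuous_on_Ck_local[OF assms(1) Suc.prems])
  have "has_partial f i (partial i f x) x" if "x \<in> S" "i < n" for x i
  proof -
    obtain U where "x \<in> U" "U \<subseteq> S" "openin (Euclidean_space n) U" "Ck_open n U (Suc k) f"
      using Suc.prems[OF \<open>x \<in> S\<close>] by auto
    then show ?thesis
      using that by (simp add: Ck_open_Suc_iff)
  qed
  moreover have "Ck_open n S k (partial i f)" if "i < n" for i
  proof (rule Suc.IH)
    fix x assume "x \<in> S"
    obtain U where "x \<in> U" "U \<subseteq> S" "openin (Euclidean_space n) U" "Ck_open n U (Suc k) f"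
      using Suc.prems[OF \<open>x \<in> S\<close>] by auto
    then show "\<exists>U. x \<in> U \<and> U \<subseteq> S \<and> openin (Euclidean_space n) U \<and> Ck_open n U k (partial i f)"
      using that by (intro exI[of _ U]) (simp add: Ck_open_Suc_iff)
  qed
  ultimately show ?case
    using c by (simp add: Ck_open_Suc_iff[OF assms(1)])
qed

section \<open>Closure of finite differentiability under arithmetic\<close>

lemma Ck_open_const:
  assumes "openin (Euclidean_space n) S"
  shows "Ck_open n S k (\<lambda>_. c)"
proof (induction k arbitrary: c)
  case 0
  show ?case
    by simp
next
  case (Suc k)
  show ?case
    by (rule Ck_open_SucI[OF assms, where D = "\<lambda>_ _. 0"]) (simp_all add: Suc.IH)
qed

lemma has_partial_coord: "has_partial (\<lambda>x. x j) i (if i = j then 1 else 0) x"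
  by (cases "i = j") auto

lemma continuous_on_coord: "continuous_on A (\<lambda>x. x j :: real)"
  by (rule continuous_on_subset[OF continuous_on_product_coordinates]) simp

lemma Ck_open_coord:
  assumes "openin (Euclidean_space n) S"
  shows "Ck_open n S k (\<lambda>x. x j)"
proof (cases k)
  case 0
  then show ?thesis
    using openin_subset[OF assms] by (simp add: continuous_map_Euclidean_real continuous_on_coord)
next
  case (Suc m)
  show ?thesis
    unfolding Suc
    by (rule Ck_open_SucI[OF assms, where D = "\<lambda>i _. if i = j then 1 else 0"])
      (simp_all only: continuous_on_coord has_partial_coord Ck_open_const[OF assms])
qed

lemma Ck_open_le:
  assumes "l \<le> k" "openin (Euclidean_space n) S" "Ck_open n S k f"
  shows "Ck_open n S l f"
  using assms by (induction rule: inc_induct) (auto intro: Ck_open_SucD)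

lemma Ck_open_add:
  assumes S: "openin (Euclidean_space n) S" and "Ck_open n S k f" "Ck_open n S k g"
  shows "Ck_open n S k (\<lambda>x. f x + g x)"
  using assms(2,3)
proof (induction k arbitrary: f g)
  case 0
  then show ?case
    using openin_subset[OF S] by (auto simp: continuous_map_Euclidean_real intro: continuous_intros)
next
  case (Suc k)
  show ?case
  proof (rule Ck_open_SucI[OF S, where D = "\<lambda>i x. partial i f x + partial i g x"])
    show "continuous_on S (\<lambda>x. f x + g x)"
      using Suc.prems by (auto simp: Ck_open_Suc_iff[OF S] intro: continuous_intros)
    show "has_partial (\<lambda>x. f x + g x) i (partial i f x + partial i g x) x" if "i < n" "x \<in> S" for i x
      using Suc.prems that by (intro DERIV_add) (auto simp: Ck_open_Suc_iff[OF S])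
    show "Ck_open n S k (\<lambda>x. partial i f x + partial i g x)" if "i < n" for i
      using Suc.prems that by (intro Suc.IH) (auto simp: Ck_open_Suc_iff[OF S])
  qed
qed

text \<open>The product rule leaves one factor undifferentiated; \<open>Ck_open_SucD\<close> lowers
  its order to \<open>k\<close>, so that the induction hypothesis, which holds for all pairs of
  functions, applies to both summands.\<close>

lemma Ck_open_mult:
  assumes S: "openin (Euclidean_space n) S" and "Ck_open n S k f" "Ck_open n S k g"
  shows "Ck_open n S k (\<lambda>x. f x * g x)"
  using assms(2,3)
proof (induction k arbitrary: f g)
  case 0
  then show ?case
    using openin_subset[OF S] by (auto simp: continuous_map_Euclidean_real intro: continuous_intros)
next
  case (Suc k)
  show ?case
  proof (rule Ck_open_SucI[OF S, where D = "\<lambda>i x. partial i f x * g x + f x * partial i g x"])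
    show "continuous_on S (\<lambda>x. f x * g x)"
      using Suc.prems by (auto simp: Ck_open_Suc_iff[OF S] intro: continuous_intros)
    show "has_partial (\<lambda>x. f x * g x) i (partial i f x * g x + f x * partial i g x) x"
      if "i < n" "x \<in> S" for i x
    proof -
      have "has_partial f i (partial i f x) x" "has_partial g i (partial i g x) x"
        using Suc.prems that by (auto simp: Ck_open_Suc_iff[OF S])
      from DERIV_mult[OF this] show ?thesis
        by (simp add: mult.commute)
    qed
    show "Ck_open n S k (\<lambda>x. partial i f x * g x + f x * partial i g x)" if "i < n" for i
    proof (rule Ck_open_add[OF S])
      show "Ck_open n S k (\<lambda>x. partial i f x * g x)"
        using Suc.prems that by (intro Suc.IH) (auto simp: Ck_open_Suc_iff[OF S] intro: Ck_open_SucD[OF S])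
      show "Ck_open n S k (\<lambda>x. f x * partial i g x)"
        using Suc.prems that by (intro Suc.IH) (auto simp: Ck_open_Suc_iff[OF S] intro: Ck_open_SucD[OF S])
    qed
  qed
qed

lemma Ck_open_sum:
  assumes S: "openin (Euclidean_space n) S" and "\<And>i. i \<in> I \<Longrightarrow> Ck_open n S k (f i)"
  shows "Ck_open n S k (\<lambda>x. \<Sum>i\<in>I. f i x)"
  using assms(2)
proof (induction I rule: infinite_finite_induct)
  case (insert i I)
  then show ?case
    by (simp add: Ck_open_add[OF S])
qed (simp_all add: Ck_open_const[OF S])

section \<open>Linear approximation, chain rule and composition\<close>

lemma openin_Euclidean_box:
  assumes "openin (Euclidean_space n) S" "x \<in> S"
  shows "\<exists>\<delta>>0. \<forall>y\<in>topspace (Euclidean_space n). (\<forall>i<n. \<bar>y i - x i\<bar> < \<delta>) \<longrightarrow> y \<in> S"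
proof -
  obtain T where T: "openin (powertop_real UNIV) T" "S = T \<inter> {x. \<forall>i\<ge>n. x i = 0}"
    using assms(1) by (auto simp: Euclidean_space_def openin_subtopology)
  obtain X where X: "x \<in> (\<Pi>\<^sub>E i\<in>UNIV. X i)" "\<And>i. open (X i)" "(\<Pi>\<^sub>E i\<in>UNIV. X i) \<subseteq> T"
    using product_topology_open_contains_basis[OF T(1), of x] assms(2) T(2) by auto
  have "\<exists>d>0. \<forall>t. \<bar>t - x i\<bar> < d \<longrightarrow> t \<in> X i" for i
    using X(1,2) open_dist[of "X i"] by (auto simp: dist_real_def PiE_iff)
  then obtain d where d: "\<And>i. d i > 0" "\<And>i t. \<bar>t - x i\<bar> < d i \<Longrightarrow> t \<in> X i"
    by metis
  \<comment> \<open>Inserting 1 keeps the set nonempty for \<open>n = 0\<close>. The first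
    \<open>n\<close> radii suffice because \<open>x\<close> and \<open>y\<close> both vanish in all
    further coordinates.\<close>
  define \<delta> where "\<delta> = Min (insert 1 (d ` {..<n}))"
  have "\<delta> > 0"
    using d(1) by (simp add: \<delta>_def)
  moreover have "y \<in> S" if y: "y \<in> topspace (Euclidean_space n)" "\<And>i. i < n \<Longrightarrow> \<bar>y i - x i\<bar> < \<delta>" for y
  proof -
    have "y i \<in> X i" for i
    proof (cases "i < n")
      case True
      then have "\<delta> \<le> d i"
        by (simp add: \<delta>_def)
      then show ?thesis
        using y(2)[OF True] d(2) by simp
    next
      case False
      then have "y i = x i"
        using y(1) assms(2) T(2) by (simp add: topspace_Euclidean_space)
      then show ?thesis
        using X(1) by (simp add: PiE_iff)
    qed
    then have "y \<in> T"
      using X(3) by (auto simp: PiE_iff)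
    then show ?thesis
      using y(1) T(2) by (simp add: topspace_Euclidean_space)
  qed
  ultimately show ?thesis
    by blast
qed

lemma openin_Euclidean_level:
  assumes "openin (Euclidean_space n) S" "continuous_on S (f :: _ \<Rightarrow> real)" "open B"
  shows "openin (Euclidean_space n) {x \<in> S. f x \<in> B}"
proof -
  have "continuous_map (subtopology (Euclidean_space n) S) euclideanreal f"
    using assms(2) by (simp add: continuous_map_Euclidean_real openin_subset[OF assms(1)])
  then have "openin (subtopology (Euclidean_space n) S) {x \<in> topspace (subtopology (Euclidean_space n) S). f x \<in> B}"
    using assms(3) by (intro openin_continuous_map_preimage) auto
  then show ?thesis
    using openin_trans_full[OF _ assms(1)] by (simp add: Int_absorb1[OF openin_subset[OF assms(1)]])
qed

text \<open>The estimate is proved by moving from \<open>x\<close> to \<open>y\<close> along one coordinate direction at a time,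
  so that only one-dimensional mean value estimates are used.\<close>

lemma linear_approximation:
  assumes S: "openin (Euclidean_space n) S" and f: "Ck_open n S 1 f" and x: "x \<in> S" and e: "e > 0"
  obtains \<delta> where "\<delta> > 0"
    "\<And>y. y \<in> topspace (Euclidean_space n) \<Longrightarrow> (\<And>i. i < n \<Longrightarrow> \<bar>y i - x i\<bar> < \<delta>) \<Longrightarrow>
      \<bar>f y - f x - (\<Sum>j<n. partial j f x * (y j - x j))\<bar> \<le> e * (\<Sum>j<n. \<bar>y j - x j\<bar>)"
proof -
  have part: "has_partial f i (partial i f y) y" "continuous_on S (partial i f)" if "i < n" "y \<in> S" for i y
    using f that openin_subset[OF S]
    by (auto simp: Ck_open_Suc_iff[OF S, of 0, simplified] continuous_map_Euclidean_real)
  have lev: "openin (Euclidean_space n) {y \<in> S. partial i f y \<in> {partial i f x - e <..< partial i f x + e}}"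
    if "i < n" for i
    by (rule openin_Euclidean_level[OF S part(2)[OF that x]]) simp
  \<comment> \<open>On \<open>V\<close> every partial derivative of \<open>f\<close> differs from
    its value at \<open>x\<close> by less than \<open>e\<close>; a box inside \<open>V\<close>
    supplies \<open>\<delta>\<close>.\<close>
  define V where "V = S \<inter> (\<Inter>i<n. {y \<in> S. partial i f y \<in> {partial i f x - e <..< partial i f x + e}})"
  have "openin (Euclidean_space n) V"
    unfolding V_def
    using S lev by (cases "n = 0") (auto intro!: openin_Int openin_INT2 simp del: greaterThanLessThan_iff)
  moreover have "x \<in> V"
    using x e by (auto simp: V_def)
  ultimately obtain \<delta> where \<delta>: "\<delta> > 0" and box: "\<forall>y\<in>topspace (Euclidean_space n). (\<forall>i<n. \<bar>y i - x i\<bar> < \<delta>) \<longrightarrow> y \<in> V"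
    using openin_Euclidean_box by metis
  have boxS: "y \<in> S" and boxp: "i < n \<Longrightarrow> \<bar>partial i f y - partial i f x\<bar> \<le> e"
    if "y \<in> topspace (Euclidean_space n)" "\<And>i. i < n \<Longrightarrow> \<bar>y i - x i\<bar> < \<delta>" for y i
    using box that by (force simp: V_def)+
  have xE: "x \<in> topspace (Euclidean_space n)"
    using x openin_subset[OF S] by blast
  have main: "\<bar>f y - f x - (\<Sum>j<k. partial j f x * (y j - x j))\<bar> \<le> e * (\<Sum>j<k. \<bar>y j - x j\<bar>)"
    if "k \<le> n" "y \<in> topspace (Euclidean_space n)" "\<And>i. i < n \<Longrightarrow> \<bar>y i - x i\<bar> < \<delta>"
      "\<And>i. k \<le> i \<Longrightarrow> y i = x i" for k y
    using that
  proof (induction k arbitrary: y)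
    case 0
    then have "y = x"
      by auto
    then show ?case
      by simp
  next
    case (Suc k)
    define y' where "y' = y(k := x k)"
    have k: "k < n"
      using Suc.prems by simp
    have y'E: "y' \<in> topspace (Euclidean_space n)"
      unfolding y'_def by (rule line_in_Euclidean_space[OF Suc.prems(2) k])
    have y'\<delta>: "\<bar>y' i - x i\<bar> < \<delta>" if "i < n" for i
      using Suc.prems(3)[OF that] \<delta> by (simp add: y'_def)
    have IH: "\<bar>f y' - f x - (\<Sum>j<k. partial j f x * (y' j - x j))\<bar> \<le> e * (\<Sum>j<k. \<bar>y' j - x j\<bar>)"
      using Suc.prems k by (intro Suc.IH y'E y'\<delta>) (auto simp: y'_def)
    define I where "I = {x k - \<delta> <..< x k + \<delta>}"
    \<comment> \<open>Subtracting the linear term turns the derivative into the deviation of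
      \<open>partial k f\<close> from its value at \<open>x\<close>, which is at most
      \<open>e\<close> on the box.\<close>
    define h where "h t = f (y(k := t)) - partial k f x * t" for t
    have yt: "y(k := t) \<in> topspace (Euclidean_space n)" "\<And>i. i < n \<Longrightarrow> \<bar>(y(k := t)) i - x i\<bar> < \<delta>"
      if "t \<in> I" for t
      using line_in_Euclidean_space[OF Suc.prems(2) k] Suc.prems(3) that by (auto simp: I_def)
    have "norm (h (y k) - h (x k)) \<le> e * norm (y k - x k)"
    proof (rule field_differentiable_bound[of I h "\<lambda>t. partial k f (y(k := t)) - partial k f x"])
      show "convex I"
        by (simp add: I_def)
      show "(h has_real_derivative partial k f (y(k := t)) - partial k f x) (at t within I)" if "t \<in> I" for t
      proof -
        have "has_partial f k (partial k f (y(k := t))) (y(k := t))"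
          by (rule part(1)[OF k boxS[OF yt[OF that]]])
        then have "((\<lambda>s. f (y(k := s))) has_real_derivative partial k f (y(k := t))) (at t)"
          by simp
        then have "(h has_real_derivative partial k f (y(k := t)) - partial k f x) (at t)"
          unfolding h_def by (auto intro!: derivative_eq_intros)
        then show ?thesis
          by (rule has_field_derivative_at_within)
      qed
      show "norm (partial k f (y(k := t)) - partial k f x) \<le> e" if "t \<in> I" for t
        unfolding real_norm_def by (rule boxp[OF yt[OF that] k])
      show "y k \<in> I" "x k \<in> I"
        using Suc.prems(3)[OF k] \<delta> by (auto simp: I_def abs_less_iff)
    qed
    then have "\<bar>f y - f y' - partial k f x * (y k - x k)\<bar> \<le> e * \<bar>y k - x k\<bar>"
      by (simp add: h_def y'_def algebra_simps)
    moreover have "(\<Sum>j<k. partial j f x * (y' j - x j)) = (\<Sum>j<k. partial j f x * (y j - x j))"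
      "(\<Sum>j<k. \<bar>y' j - x j\<bar>) = (\<Sum>j<k. \<bar>y j - x j\<bar>)"
      by (auto simp: y'_def intro!: sum.cong)
    ultimately show ?case
      using IH by (simp add: distrib_left abs_le_iff)
  qed
  show ?thesis
  proof (rule that[OF \<delta>])
    fix y assume y: "y \<in> topspace (Euclidean_space n)" "\<And>i. i < n \<Longrightarrow> \<bar>y i - x i\<bar> < \<delta>"
    show "\<bar>f y - f x - (\<Sum>j<n. partial j f x * (y j - x j))\<bar> \<le> e * (\<Sum>j<n. \<bar>y j - x j\<bar>)"
      using y xE by (intro main) (auto simp: topspace_Euclidean_space)
  qed
qed

text \<open>The error of the linear approximation is at most \<open>e / C\<close> times the sum of
  the coordinate increments of the curve, and these increments divided by \<open>t - t0\<close> stay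
  bounded. Working within \<open>A\<close> covers curves for which \<open>t0\<close> is an
  endpoint.\<close>

lemma chain_rule_curve:
  assumes S: "openin (Euclidean_space n) S" and f: "Ck_open n S 1 f"
    and \<gamma>: "\<And>t. t \<in> A \<Longrightarrow> \<gamma> t \<in> topspace (Euclidean_space n)" "\<gamma> t0 \<in> S" "t0 \<in> A"
    and d: "\<And>j. j < n \<Longrightarrow> ((\<lambda>t. \<gamma> t j) has_real_derivative d j) (at t0 within A)"
  shows "((\<lambda>t. f (\<gamma> t)) has_real_derivative (\<Sum>j<n. partial j f (\<gamma> t0) * d j)) (at t0 within A)"
proof -
  define L where "L t = (\<Sum>j<n. partial j f (\<gamma> t0) * (\<gamma> t j - \<gamma> t0 j))" for t
  define R where "R t = f (\<gamma> t) - f (\<gamma> t0) - L t" for t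
  define q where "q t = (\<Sum>j<n. \<bar>(\<gamma> t j - \<gamma> t0 j) / (t - t0)\<bar>)" for t
  have dq: "((\<lambda>t. (\<gamma> t j - \<gamma> t0 j) / (t - t0)) \<longlongrightarrow> d j) (at t0 within A)" if "j < n" for j
    using d[OF that] by (simp add: has_field_derivative_iff)
  have "(q \<longlongrightarrow> (\<Sum>j<n. \<bar>d j\<bar>)) (at t0 within A)"
    unfolding q_def using dq by (intro tendsto_intros) auto
  then have qb: "\<forall>\<^sub>F t in at t0 within A. q t < (\<Sum>j<n. \<bar>d j\<bar>) + 1"
    by (rule order_tendstoD) simp
  \<comment> \<open>The summand 1 keeps \<open>C\<close> positive when all \<open>d j\<close> vanish
    and puts the limit of \<open>q\<close> strictly below \<open>C\<close>.\<close>
  define C where "C = (\<Sum>j<n. \<bar>d j\<bar>) + 1"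
  have C: "C > 0"
    unfolding C_def by (intro add_nonneg_pos sum_nonneg) auto
  have cont: "((\<lambda>t. \<gamma> t j) \<longlongrightarrow> \<gamma> t0 j) (at t0 within A)" if "j < n" for j
    using DERIV_continuous[OF d[OF that]] by (simp add: continuous_within)
  have "((\<lambda>t. R t / (t - t0)) \<longlongrightarrow> 0) (at t0 within A)"
    unfolding tendsto_iff
  proof (intro allI impI)
    fix e :: real assume e: "e > 0"
    obtain \<delta> where \<delta>: "\<delta> > 0" "\<And>y. y \<in> topspace (Euclidean_space n) \<Longrightarrow>
        (\<And>i. i < n \<Longrightarrow> \<bar>y i - \<gamma> t0 i\<bar> < \<delta>) \<Longrightarrow>
        \<bar>f y - f (\<gamma> t0) - (\<Sum>j<n. partial j f (\<gamma> t0) * (y j - \<gamma> t0 j))\<bar>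
          \<le> e / C * (\<Sum>j<n. \<bar>y j - \<gamma> t0 j\<bar>)"
      using linear_approximation[OF S f \<gamma>(2), of "e / C"] e C by (auto simp: divide_pos_pos)
    have "\<forall>\<^sub>F t in at t0 within A. \<forall>j\<in>{..<n}. \<bar>\<gamma> t j - \<gamma> t0 j\<bar> < \<delta>"
      using cont \<delta>(1) by (intro eventually_ball_finite) (auto simp: tendsto_iff dist_real_def)
    moreover have "\<forall>\<^sub>F t in at t0 within A. t \<in> A \<and> t \<noteq> t0"
      by (simp add: eventually_at_filter)
    ultimately show "\<forall>\<^sub>F t in at t0 within A. dist (R t / (t - t0)) 0 < e"
      using qb
    proof eventually_elim
      case (elim t)
      have "\<bar>R t\<bar> \<le> e / C * (\<Sum>j<n. \<bar>\<gamma> t j - \<gamma> t0 j\<bar>)"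
        unfolding R_def L_def using elim \<gamma>(1) by (intro \<delta>(2)) auto
      also have "(\<Sum>j<n. \<bar>\<gamma> t j - \<gamma> t0 j\<bar>) = q t * \<bar>t - t0\<bar>"
        unfolding q_def sum_distrib_right using elim by (intro sum.cong) (auto simp: abs_divide)
      finally have "\<bar>R t\<bar> / \<bar>t - t0\<bar> \<le> e / C * q t"
        using elim by (simp add: field_simps)
      also have "\<dots> < e / C * C"
        using elim e C unfolding C_def[symmetric] by (intro mult_strict_left_mono) auto
      finally show ?case
        using C by (simp add: abs_divide)
    qed
  qed
  moreover have "((\<lambda>t. L t / (t - t0)) \<longlongrightarrow> (\<Sum>j<n. partial j f (\<gamma> t0) * d j)) (at t0 within A)"
    unfolding L_def sum_divide_distrib times_divide_eq_right[symmetric]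
    using dq by (intro tendsto_intros) auto
  ultimately have "((\<lambda>t. R t / (t - t0) + L t / (t - t0)) \<longlongrightarrow> 0 + (\<Sum>j<n. partial j f (\<gamma> t0) * d j))
      (at t0 within A)"
    by (rule tendsto_add)
  then show ?thesis
    by (simp add: has_field_derivative_iff R_def add_divide_distrib[symmetric])
qed

text \<open>By the chain rule a derivative of the composite is a sum of products. In each product
  one factor is again a composite, with \<open>partial j f\<close> in place of \<open>f\<close> and
  the order lowered by one; hence the induction over \<open>k\<close> for all \<open>f\<close> at
  once.\<close>

lemma Ck_open_compose:
  assumes S: "openin (Euclidean_space n) S" and T: "openin (Euclidean_space m) T"
    and h: "\<And>j. j < m \<Longrightarrow> Ck_open n S k (\<lambda>x. h x j)" "\<And>x. x \<in> S \<Longrightarrow> h x \<in> T"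
    and f: "Ck_open m T k f"
  shows "Ck_open n S k (\<lambda>x. f (h x))"
proof -
  have hE: "h x \<in> topspace (Euclidean_space m)" if "x \<in> S" for x
    using h(2)[OF that] openin_subset[OF T] by blast
  have c: "continuous_on S (\<lambda>x. g (h x))"
    if "\<And>j. j < m \<Longrightarrow> Ck_open n S l (\<lambda>x. h x j)" "continuous_on T g" for g :: "_ \<Rightarrow> real" and l
  proof -
    have "continuous_on S (\<lambda>x. h x j)" for j
    proof (cases "j < m")
      case True
      then show ?thesis
        using that(1) Ck_open_imp_continuous openin_subset[OF S] by blast
    next
      case False
      \<comment> \<open>Coordinates from \<open>m\<close> on vanish on \<open>S\<close>, because
        \<open>h\<close> takes its values in \<open>m\<close>-space there.\<close>
      then have "continuous_on S (\<lambda>x. h x j) \<longleftrightarrow> continuous_on S (\<lambda>x. 0::real)"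
        using hE by (intro continuous_on_cong) (auto simp: topspace_Euclidean_space)
      then show ?thesis
        by simp
    qed
    then have "continuous_on S h"
      by (rule continuous_on_coordinatewise_then_product)
    then show ?thesis
      using h(2) that(2) by (intro continuous_on_compose2[of T g S h]) auto
  qed
  show ?thesis
    using h(1) f
  proof (induction k arbitrary: f)
    case 0
    then show ?case
      using c[of 0 f] openin_subset[OF S] openin_subset[OF T] by (simp add: continuous_map_Euclidean_real)
  next
    case (Suc k)
    have f1: "Ck_open m T 1 f"
      using Suc.prems(2) by (intro Ck_open_le[OF _ T, of 1 "Suc k"]) simp_all
    show ?case
    proof (rule Ck_open_SucI[OF S, where D = "\<lambda>i x. \<Sum>j<m. partial j f (h x) * partial i (\<lambda>x. h x j) x"])
      show "continuous_on S (\<lambda>x. f (h x))"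
        using Suc.prems by (intro c) (auto simp: Ck_open_Suc_iff[OF T])
      show "has_partial (\<lambda>x. f (h x)) i (\<Sum>j<m. partial j f (h x) * partial i (\<lambda>x. h x j) x) x"
        if "i < n" "x \<in> S" for i x
      proof -
        \<comment> \<open>The parameters are restricted because \<open>h\<close> is only known to
          land in \<open>m\<close>-space on \<open>S\<close>; as \<open>S\<close> is open, the
          restriction does not change the filter.\<close>
        have "((\<lambda>t. f (h (x(i := t)))) has_real_derivative
            (\<Sum>j<m. partial j f (h (x(i := x i))) * partial i (\<lambda>x. h x j) x)) (at (x i) within {t. x(i := t) \<in> S})"
        proof (rule chain_rule_curve[OF T f1, where \<gamma> = "\<lambda>t. h (x(i := t))"])
          show "((\<lambda>t. h (x(i := t)) j) has_real_derivative partial i (\<lambda>x. h x j) x)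
              (at (x i) within {t. x(i := t) \<in> S})" if "j < m" for j
            using Suc.prems(1)[OF that] \<open>i < n\<close> \<open>x \<in> S\<close>
            by (auto simp: Ck_open_Suc_iff[OF S] intro: has_field_derivative_at_within)
        qed (use that h(2) hE in auto)
        then show ?thesis
          using at_within_line[OF S that(2,1)] by simp
      qed
      show "Ck_open n S k (\<lambda>x. \<Sum>j<m. partial j f (h x) * partial i (\<lambda>x. h x j) x)" if "i < n" for i
      proof (intro Ck_open_sum[OF S] Ck_open_mult[OF S])
        fix j assume "j \<in> {..<m}"
        have "Ck_open m T k (partial j f)"
          using Suc.prems(2) \<open>j \<in> {..<m}\<close> by (simp add: Ck_open_Suc_iff[OF T])
        then show "Ck_open n S k (\<lambda>x. partial j f (h x))"
          using Ck_open_SucD[OF S Suc.prems(1)] by (rule Suc.IH[rotated])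
        show "Ck_open n S k (partial i (\<lambda>x. h x j))"
          using Suc.prems(1)[of j] \<open>j \<in> {..<m}\<close> that by (simp add: Ck_open_Suc_iff[OF S])
      qed
    qed
  qed
qed


section \<open>Smooth functions on open sets\<close>

lemma smooth_openI: "openin (Euclidean_space n) S \<Longrightarrow> (\<And>k. Ck_open n S k f) \<Longrightarrow> smooth_open n S f"
  by (simp add: smooth_open_def)

lemma smooth_open_openin: "smooth_open n S f \<Longrightarrow> openin (Euclidean_space n) S"
  by (simp add: smooth_open_def)

lemma smooth_open_Ck: "smooth_open n S f \<Longrightarrow> Ck_open n S k f"
  by (simp add: smooth_open_def)

lemma smooth_open_continuous_on: "smooth_open n S f \<Longrightarrow> continuous_on S f"
  by (rule Ck_open_imp_continuous[OF smooth_open_Ck openin_subset[OF smooth_open_openin]])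

lemma smooth_open_has_partial:
  "smooth_open n S f \<Longrightarrow> x \<in> S \<Longrightarrow> i < n \<Longrightarrow> has_partial f i (partial i f x) x"
  using smooth_open_Ck[of n S f "Suc 0"] smooth_open_openin[of n S f] by (simp add: Ck_open_Suc_iff)

lemma smooth_open_partial:
  assumes "smooth_open n S f" "i < n"
  shows "smooth_open n S (partial i f)"
proof (rule smooth_openI[OF smooth_open_openin[OF assms(1)]])
  show "Ck_open n S k (partial i f)" for k
    using smooth_open_Ck[OF assms(1), of "Suc k"] assms(2)
    by (simp add: Ck_open_Suc_iff[OF smooth_open_openin[OF assms(1)]])
qed

lemma smooth_open_cong:
  assumes "smooth_open n S f" "\<And>x. x \<in> S \<Longrightarrow> f x = g x"
  shows "smooth_open n S g"
  using Ck_open_cong[OF smooth_open_openin[OF assms(1)], of f g] assms by (simp add: smooth_open_def)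

lemma smooth_open_subset:
  assumes "smooth_open n S f" "openin (Euclidean_space n) T" "T \<subseteq> S"
  shows "smooth_open n T f"
  using Ck_open_subset[OF smooth_open_openin[OF assms(1)] assms(2,3)] assms by (simp add: smooth_open_def)

lemma smooth_open_local:
  assumes "openin (Euclidean_space n) S" "\<And>x. x \<in> S \<Longrightarrow> \<exists>U. x \<in> U \<and> U \<subseteq> S \<and> smooth_open n U f"
  shows "smooth_open n S f"
proof (rule smooth_openI[OF assms(1)])
  fix k
  show "Ck_open n S k f"
  proof (rule Ck_open_local[OF assms(1)])
    fix x assume "x \<in> S"
    then obtain U where "x \<in> U" "U \<subseteq> S" "smooth_open n U f"
      using assms(2) by auto
    then show "\<exists>U. x \<in> U \<and> U \<subseteq> S \<and> openin (Euclidean_space n) U \<and> Ck_open n U k f"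
      by (auto simp: smooth_open_def)
  qed
qed

lemma smooth_open_const: "openin (Euclidean_space n) S \<Longrightarrow> smooth_open n S (\<lambda>_. c)"
  by (simp add: smooth_open_def Ck_open_const)

lemma smooth_open_coord: "openin (Euclidean_space n) S \<Longrightarrow> smooth_open n S (\<lambda>x. x j)"
  by (simp add: smooth_open_def Ck_open_coord)

lemma smooth_open_add: "smooth_open n S f \<Longrightarrow> smooth_open n S g \<Longrightarrow> smooth_open n S (\<lambda>x. f x + g x)"
  by (simp add: smooth_open_def Ck_open_add)

lemma smooth_open_mult: "smooth_open n S f \<Longrightarrow> smooth_open n S g \<Longrightarrow> smooth_open n S (\<lambda>x. f x * g x)"
  by (simp add: smooth_open_def Ck_open_mult)

lemma smooth_open_diff:
  assumes "smooth_open n S f" "smooth_open n S g"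
  shows "smooth_open n S (\<lambda>x. f x - g x)"
  using smooth_open_add[OF assms(1) smooth_open_mult[OF smooth_open_const[OF smooth_open_openin[OF assms(1)], of "- 1"] assms(2)]]
  by simp

lemma smooth_open_compose:
  assumes "openin (Euclidean_space n) S" "\<And>j. j < m \<Longrightarrow> smooth_open n S (\<lambda>x. h x j)"
    "\<And>x. x \<in> S \<Longrightarrow> h x \<in> T" "smooth_open m T f"
  shows "smooth_open n S (\<lambda>x. f (h x))"
  using assms(1)
  by (rule smooth_openI)
    (rule Ck_open_compose[OF assms(1) smooth_open_openin[OF assms(4)] smooth_open_Ck[OF assms(2)] assms(3)
        smooth_open_Ck[OF assms(4)]])

text \<open>A local extension \<open>F\<close> equals \<open>f\<close> on the open piece
  \<open>S \<inter> U\<close>, so \<open>f\<close> itself is smooth there and locality glues the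
  pieces. This replaces extendability by derivatives of the function itself.\<close>

lemma smooth_on_open_iff:
  assumes "openin (Euclidean_space n) S"
  shows "smooth_on n S f \<longleftrightarrow> smooth_open n S f"
proof
  assume f: "smooth_on n S f"
  show "smooth_open n S f"
  proof (rule smooth_open_local[OF assms])
    fix x assume "x \<in> S"
    then obtain U F where U: "x \<in> U" "smooth_open n U F" "\<forall>y\<in>S \<inter> U. F y = f y"
      using f unfolding smooth_on_def by auto
    have "smooth_open n (S \<inter> U) F"
      using assms smooth_open_openin[OF U(2)] by (intro smooth_open_subset[OF U(2)]) auto
    then have "smooth_open n (S \<inter> U) f"
      by (rule smooth_open_cong) (use U(3) in auto)
    then show "\<exists>U. x \<in> U \<and> U \<subseteq> S \<and> smooth_open n U f"
      using U(1) \<open>x \<in> S\<close> by auto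
  qed
next
  assume "smooth_open n S f"
  then show "smooth_on n S f"
    using openin_subset[OF assms] unfolding smooth_on_def by auto
qed

lemma smooth_open_chain_rule:
  assumes "smooth_open n S f" "\<And>t. t \<in> A \<Longrightarrow> \<gamma> t \<in> topspace (Euclidean_space n)" "\<gamma> t0 \<in> S" "t0 \<in> A"
    "\<And>j. j < n \<Longrightarrow> ((\<lambda>t. \<gamma> t j) has_real_derivative d j) (at t0 within A)"
  shows "((\<lambda>t. f (\<gamma> t)) has_real_derivative (\<Sum>j<n. partial j f (\<gamma> t0) * d j)) (at t0 within A)"
  by (rule chain_rule_curve[OF smooth_open_openin[OF assms(1)] smooth_open_Ck[OF assms(1)] assms(2-5)])

section \<open>Manifolds without boundary\<close>

lemma is_chart_maps:
  assumes "is_chart n X c"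
  shows "homeomorphic_maps (subtopology X (fst c)) (subtopology (Euclidean_space n) (chart_image c))
    (snd c) (chart_inv c)"
proof -
  obtain g where g: "homeomorphic_maps (subtopology X (fst c)) (subtopology (Euclidean_space n) (chart_image c)) (snd c) g"
    using assms homeomorphic_map_maps unfolding is_chart_def by metis
  have sub: "fst c \<subseteq> topspace X"
    using assms openin_subset unfolding is_chart_def by metis
  then have gid: "g (snd c p) = p" if "p \<in> fst c" for p
    using g that unfolding homeomorphic_maps_def by auto
  \<comment> \<open>The abstract inverse \<open>g\<close> shows that \<open>snd c\<close> is
    injective on the chart domain, so \<open>inv_into\<close> agrees with \<open>g\<close> on the
    image and inherits its continuity.\<close>
  have "chart_inv c x = g x" if x: "x \<in> chart_image c" for x
  proof -
    obtain p where "p \<in> fst c" "x = snd c p"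
      using x by (auto simp: chart_image_def)
    moreover have "inj_on (snd c) (fst c)"
      using gid by (metis inj_onI)
    ultimately show ?thesis
      using gid by (simp add: chart_inv_def)
  qed
  then show ?thesis
    using homeomorphic_maps_eq[OF g, of "snd c" "chart_inv c"] by simp
qed

lemma is_chart_openin: "is_chart n X c \<Longrightarrow> openin X (fst c)"
  by (simp add: is_chart_def)

lemma chart_image_subset:
  assumes "is_chart n X c"
  shows "chart_image c \<subseteq> topspace (Euclidean_space n)"
  using assms openin_subset[of "Euclidean_space n" "chart_image c"]
    openin_subset[of "subtopology (Euclidean_space n) (half_space n)" "chart_image c"]
  unfolding is_chart_def by auto

lemma chart_inv_left:
  assumes "is_chart n X c" "p \<in> fst c"
  shows "chart_inv c (snd c p) = p"
  using is_chart_maps[OF assms(1)] assms(2) openin_subset[OF is_chart_openin[OF assms(1)]]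
  unfolding homeomorphic_maps_def by auto

lemma chart_in_image: "p \<in> fst c \<Longrightarrow> snd c p \<in> chart_image c"
  by (simp add: chart_image_def)

lemma chart_inv_right: "x \<in> chart_image c \<Longrightarrow> snd c (chart_inv c x) = x"
  by (simp add: chart_image_def chart_inv_def f_inv_into_f)

lemma chart_inv_in: "x \<in> chart_image c \<Longrightarrow> chart_inv c x \<in> fst c"
  by (simp add: chart_image_def chart_inv_def inv_into_into)

lemma chart_continuous:
  "is_chart n X c \<Longrightarrow> continuous_map (subtopology X (fst c)) (Euclidean_space n) (snd c)"
  using is_chart_maps[of n X c] by (simp add: homeomorphic_maps_def continuous_map_in_subtopology)

lemma chart_inv_continuous:
  "is_chart n X c \<Longrightarrow> continuous_map (subtopology (Euclidean_space n) (chart_image c)) X (chart_inv c)"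
  using is_chart_maps[of n X c] by (simp add: homeomorphic_maps_def continuous_map_in_subtopology)

lemma overlap_iff:
  assumes "is_chart n X c"
  shows "x \<in> overlap c d \<longleftrightarrow> x \<in> chart_image c \<and> chart_inv c x \<in> fst d"
proof
  assume "x \<in> overlap c d"
  then obtain p where "p \<in> fst c" "p \<in> fst d" "x = snd c p"
    by (auto simp: overlap_def)
  then show "x \<in> chart_image c \<and> chart_inv c x \<in> fst d"
    by (simp add: chart_inv_left[OF assms] chart_in_image)
next
  assume x: "x \<in> chart_image c \<and> chart_inv c x \<in> fst d"
  then have "snd c (chart_inv c x) \<in> overlap c d"
    unfolding overlap_def by (intro imageI) (simp add: chart_inv_in)
  then show "x \<in> overlap c d"
    using x by (simp add: chart_inv_right)
qed

lemma openin_overlap: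
  assumes "is_chart n X c" "openin X (fst d)" "openin (Euclidean_space n) (chart_image c)"
  shows "openin (Euclidean_space n) (overlap c d)"
proof -
  have "openin (subtopology (Euclidean_space n) (chart_image c))
      {x \<in> topspace (subtopology (Euclidean_space n) (chart_image c)). chart_inv c x \<in> fst d}"
    by (rule openin_continuous_map_preimage[OF chart_inv_continuous[OF assms(1)] assms(2)])
  moreover have "{x \<in> topspace (subtopology (Euclidean_space n) (chart_image c)). chart_inv c x \<in> fst d} = overlap c d"
    using chart_image_subset[OF assms(1)] by (auto simp: overlap_iff[OF assms(1)])
  ultimately show ?thesis
    using openin_trans_full[OF _ assms(3)] by simp
qed

lemma overlap_inv: "x \<in> overlap c d \<Longrightarrow> is_chart n X c \<Longrightarrow> chart_inv c x \<in> fst c \<inter> fst d"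
  using overlap_iff[of n X c x d] by (simp add: chart_inv_in)

text \<open>By invariance of domain, a half-space chart cannot reach the boundary at a point that also lies
  in the domain of a chart with open image.\<close>

lemma openin_chart_image:
  assumes c: "is_chart n X c"
    and cover: "\<And>p. p \<in> fst c \<Longrightarrow> \<exists>d. is_chart n X d \<and> p \<in> fst d \<and> openin (Euclidean_space n) (chart_image d)"
  shows "openin (Euclidean_space n) (chart_image c)"
proof (subst openin_subopen, rule)
  fix x assume x: "x \<in> chart_image c"
  then obtain d where d: "is_chart n X d" "chart_inv c x \<in> fst d" "openin (Euclidean_space n) (chart_image d)"
    using cover[OF chart_inv_in[OF x]] by auto
  have V: "openin (Euclidean_space n) (overlap d c)"
    by (rule openin_overlap[OF d(1) is_chart_openin[OF c] d(3)])
  have img: "(\<lambda>y. snd c (chart_inv d y)) ` overlap d c = overlap c d"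
    using chart_inv_left[OF d(1)] by (auto simp: overlap_def image_iff)
  have "continuous_map (subtopology (Euclidean_space n) (overlap d c)) (subtopology X (fst c)) (chart_inv d)"
    using continuous_map_from_subtopology_mono[OF chart_inv_continuous[OF d(1)], of "overlap d c"]
      overlap_inv[OF _ d(1), of _ c] overlap_iff[OF d(1), of _ c]
    by (auto simp: continuous_map_in_subtopology)
  then have "continuous_map (subtopology (Euclidean_space n) (overlap d c)) (Euclidean_space n)
      (\<lambda>y. snd c (chart_inv d y))"
    using continuous_map_compose[OF _ chart_continuous[OF c]] by (simp add: o_def)
  moreover have "inj_on (\<lambda>y. snd c (chart_inv d y)) (overlap d c)"
  proof (rule inj_onI)
    fix y z assume yz: "y \<in> overlap d c" "z \<in> overlap d c" "snd c (chart_inv d y) = snd c (chart_inv d z)"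
    then have "chart_inv d y = chart_inv d z"
      using chart_inv_left[OF c] overlap_inv[OF _ d(1), of _ c] by (metis IntD2)
    then show "y = z"
      using yz chart_inv_right[of _ d] overlap_iff[OF d(1), of _ c] by metis
  qed
  ultimately have "openin (Euclidean_space n) (overlap c d)"
    using invariance_of_domain_Euclidean_space[OF V] img by metis
  moreover have "x \<in> overlap c d" "overlap c d \<subseteq> chart_image c"
    using x d(2) overlap_iff[OF c, of _ d] by auto
  ultimately show "\<exists>T. openin (Euclidean_space n) T \<and> x \<in> T \<and> T \<subseteq> chart_image c"
    by blast
qed

section \<open>The maximal atlas generated by a family of charts\<close>

definition generated_manifold :: "nat \<Rightarrow> 'a topology \<Rightarrow> 'a chart set \<Rightarrow> 'a manifold"
  where "generated_manifold n X B =
    \<lparr>dim_of = n, top_of = X, atlas_of = {c. is_chart n X c \<and> (\<forall>d\<in>B. compatible n c d)}\<rparr>"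

text \<open>Near each point of the overlap some \<open>d\<close> in \<open>B\<close> is available,
  and there the transition is the composite of those from \<open>c\<close> to \<open>d\<close> and
  from \<open>d\<close> to \<open>e\<close>. This is the transitivity of compatibility through a
  covering family.\<close>

lemma transition_smooth_via:
  assumes c: "is_chart n X c" "openin (Euclidean_space n) (chart_image c)"
    and e: "is_chart n X e"
    and B: "\<And>p. p \<in> fst c \<Longrightarrow> \<exists>d\<in>B. p \<in> fst d"
      "\<And>d. d \<in> B \<Longrightarrow> is_chart n X d \<and> openin (Euclidean_space n) (chart_image d) \<and>
        compatible n c d \<and> compatible n e d"
    and i: "i < n"
  shows "smooth_open n (overlap c e) (transition c e i)"
proof (rule smooth_open_local)
  show ce: "openin (Euclidean_space n) (overlap c e)"
    by (rule openin_overlap[OF c(1) is_chart_openin[OF e] c(2)])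
  fix x assume x: "x \<in> overlap c e"
  then obtain d where d: "d \<in> B" "chart_inv c x \<in> fst d"
    using B(1)[of "chart_inv c x"] overlap_inv[OF x c(1)] by auto
  have d': "is_chart n X d" "openin (Euclidean_space n) (chart_image d)" "compatible n c d" "compatible n e d"
    using B(2)[OF d(1)] by auto
  have cd: "openin (Euclidean_space n) (overlap c d)"
    by (rule openin_overlap[OF c(1) is_chart_openin[OF d'(1)] c(2)])
  have de: "openin (Euclidean_space n) (overlap d e)"
    by (rule openin_overlap[OF d'(1) is_chart_openin[OF e] d'(2)])
  have U: "openin (Euclidean_space n) (overlap c d \<inter> overlap c e)"
    using cd ce by (rule openin_Int)
  have s1: "smooth_open n (overlap c d) (transition c d j)" if "j < n" for j
    using d'(3) that smooth_on_open_iff[OF cd] by (simp add: compatible_def)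
  have s2: "smooth_open n (overlap d e) (transition d e i)"
    using d'(4) i smooth_on_open_iff[OF de] by (simp add: compatible_def)
  have "smooth_open n (overlap c d \<inter> overlap c e) (\<lambda>y. transition d e i (snd d (chart_inv c y)))"
  proof (rule smooth_open_compose[OF U _ _ s2])
    show "smooth_open n (overlap c d \<inter> overlap c e) (\<lambda>y. snd d (chart_inv c y) j)" if "j < n" for j
      using smooth_open_subset[OF s1[OF that] U] by (simp add: transition_def[abs_def])
    show "snd d (chart_inv c y) \<in> overlap d e" if "y \<in> overlap c d \<inter> overlap c e" for y
      using that overlap_inv[OF _ c(1)] by (auto simp: overlap_def[of d e])
  qed
  then have "smooth_open n (overlap c d \<inter> overlap c e) (transition c e i)"
    by (rule smooth_open_cong)
      (use chart_inv_left[OF d'(1)] overlap_inv[OF _ c(1)] in \<open>auto simp: transition_def\<close>)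
  then show "\<exists>U. x \<in> U \<and> U \<subseteq> overlap c e \<and> smooth_open n U (transition c e i)"
    using x d(2) overlap_iff[OF c(1), of _ d] overlap_iff[OF c(1), of _ e] by (intro exI[of _ "overlap c d \<inter> overlap c e"]) auto
qed

lemma generated_manifold_open_image:
  assumes "topspace X \<subseteq> (\<Union>d\<in>B. fst d)"
    and "\<And>d. d \<in> B \<Longrightarrow> is_chart n X d \<and> openin (Euclidean_space n) (chart_image d)"
    and "c \<in> atlas_of (generated_manifold n X B)"
  shows "openin (Euclidean_space n) (chart_image c)"
proof -
  have c: "is_chart n X c"
    using assms(3) by (simp add: generated_manifold_def)
  show ?thesis
  proof (rule openin_chart_image[OF c])
    fix p assume "p \<in> fst c"
    then have "p \<in> (\<Union>d\<in>B. fst d)"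
      using openin_subset[OF is_chart_openin[OF c]] assms(1) by auto
    then obtain d where "d \<in> B" "p \<in> fst d"
      by (rule UN_E)
    then show "\<exists>d. is_chart n X d \<and> p \<in> fst d \<and> openin (Euclidean_space n) (chart_image d)"
      using assms(2)[of d] by (intro exI[of _ d]) simp
  qed
qed

text \<open>Compatibility with \<open>B\<close> forces pairwise compatibility by
  \<open>transition_smooth_via\<close>; maximality holds because \<open>B\<close> itself belongs to
  the atlas.\<close>

lemma smooth_manifold_generated:
  assumes "Hausdorff_space X" "second_countable X" "topspace X \<subseteq> (\<Union>d\<in>B. fst d)"
    and B: "\<And>d. d \<in> B \<Longrightarrow> is_chart n X d \<and> openin (Euclidean_space n) (chart_image d)"
    and comp: "\<And>d e. d \<in> B \<Longrightarrow> e \<in> B \<Longrightarrow> compatible n d e"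
  shows "smooth_manifold (generated_manifold n X B)"
proof -
  let ?M = "generated_manifold n X B"
  have atlas: "atlas_of ?M = {c. is_chart n X c \<and> (\<forall>d\<in>B. compatible n c d)}"
    and [simp]: "dim_of ?M = n" "top_of ?M = X"
    by (simp_all add: generated_manifold_def)
  have chart: "is_chart n X c" if "c \<in> atlas_of ?M" for c
    using that by (simp add: atlas)
  have op: "openin (Euclidean_space n) (chart_image c)" if "c \<in> atlas_of ?M" for c
    by (rule generated_manifold_open_image[OF assms(3) B that])
  have BM: "B \<subseteq> atlas_of ?M"
    using B comp by (auto simp: atlas)
  have cov: "\<exists>d\<in>B. p \<in> fst d" if "c \<in> atlas_of ?M" "p \<in> fst c" for c p
    using openin_subset[OF is_chart_openin[OF chart[OF that(1)]]] that(2) assms(3) by auto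
  have "compatible n c e" if ce: "c \<in> atlas_of ?M" "e \<in> atlas_of ?M" for c e
  proof -
    have "smooth_on n (overlap c e) (transition c e i)"
      if "i < n" "c \<in> atlas_of ?M" "e \<in> atlas_of ?M" for i c e
    proof -
      have "smooth_open n (overlap c e) (transition c e i)"
        using that B cov
        by (intro transition_smooth_via[OF chart op chart, where B = B]) (auto simp: atlas)
      then show ?thesis
        by (simp add: smooth_on_open_iff[OF smooth_open_openin])
    qed
    then show ?thesis
      using ce by (simp add: compatible_def)
  qed
  moreover have "(\<Union>c\<in>atlas_of ?M. fst c) = topspace X"
  proof
    show "(\<Union>c\<in>atlas_of ?M. fst c) \<subseteq> topspace X"
      using openin_subset[OF is_chart_openin[OF chart]] by (intro UN_least)
    show "topspace X \<subseteq> (\<Union>c\<in>atlas_of ?M. fst c)"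
      using assms(3) BM by (rule order_trans[OF _ UN_mono]) auto
  qed
  moreover have "c \<in> atlas_of ?M" if "is_chart n X c" "\<forall>d\<in>atlas_of ?M. compatible n c d" for c
    using that BM by (auto simp: atlas)
  ultimately show ?thesis
    using assms(1,2) chart unfolding smooth_manifold_def by simp
qed

text \<open>Open chart images express the absence of boundary points; with them
  \<open>smooth_on\<close> becomes \<open>smooth_open\<close> on all chart images and
  overlaps.\<close>

locale manifold_without_boundary =
  fixes M :: "'a manifold"
  assumes smooth_manifold: "smooth_manifold M"
    and openin_image: "c \<in> atlas_of M \<Longrightarrow> openin (Euclidean_space (dim_of M)) (chart_image c)"
begin

lemma chart: "c \<in> atlas_of M \<Longrightarrow> is_chart (dim_of M) (top_of M) c"
  using smooth_manifold by (simp add: smooth_manifold_def)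

lemma charts_at_atlas: "c \<in> charts_at M p \<Longrightarrow> c \<in> atlas_of M"
  and charts_at_in: "c \<in> charts_at M p \<Longrightarrow> p \<in> fst c"
  by (simp_all add: charts_at_def)

lemma openin_overlap_atlas:
  "c \<in> atlas_of M \<Longrightarrow> d \<in> atlas_of M \<Longrightarrow> openin (Euclidean_space (dim_of M)) (overlap c d)"
  by (rule openin_overlap[OF chart is_chart_openin[OF chart] openin_image])

lemma transition_smooth:
  assumes "c \<in> atlas_of M" "d \<in> atlas_of M" "i < dim_of M"
  shows "smooth_open (dim_of M) (overlap c d) (transition c d i)"
proof -
  have "smooth_on (dim_of M) (overlap c d) (transition c d i)"
    using smooth_manifold assms by (simp add: smooth_manifold_def compatible_def)
  then show ?thesis
    using smooth_on_open_iff[OF openin_overlap_atlas] assms by simp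
qed

lemma snd_in_overlap: "p \<in> fst c \<Longrightarrow> p \<in> fst d \<Longrightarrow> snd c p \<in> overlap c d"
  by (simp add: overlap_def)

lemma snd_in_Euclidean: "c \<in> atlas_of M \<Longrightarrow> p \<in> fst c \<Longrightarrow> snd c p \<in> topspace (Euclidean_space (dim_of M))"
  by (rule subsetD[OF chart_image_subset[OF chart] chart_in_image])

section \<open>Jacobians and tangent vectors\<close>

lemma jacobian_eq_partial:
  assumes "c \<in> charts_at M p" "d \<in> charts_at M p" "j < dim_of M"
  shows "jacobian c d p i j = partial j (transition c d i) (snd c p)"
  unfolding jacobian_def
  using assms by (intro partial_within_eq_partial[OF openin_overlap_atlas])
    (auto simp: charts_at_def intro: snd_in_overlap)

text \<open>The chain rule applied to the transition map. Derivatives are taken within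
  \<open>A\<close> because the lemma serves both coordinate lines, in \<open>jacobian_comp\<close>,
  and curves that may start or end at the base point, in \<open>velocity_tangent\<close>.\<close>

lemma velocity_transform:
  assumes "c \<in> charts_at M (\<gamma> t0)" "d \<in> charts_at M (\<gamma> t0)"
    and A: "t0 \<in> A" "\<And>t. t \<in> A \<Longrightarrow> \<gamma> t \<in> fst c \<inter> fst d"
    and v: "\<And>j. j < dim_of M \<Longrightarrow> ((\<lambda>t. snd c (\<gamma> t) j) has_real_derivative v j) (at t0 within A)"
    and i: "i < dim_of M"
  shows "((\<lambda>t. snd d (\<gamma> t) i) has_real_derivative
    (\<Sum>j<dim_of M. jacobian c d (\<gamma> t0) i j * v j)) (at t0 within A)"
proof -
  have cd: "c \<in> atlas_of M" "d \<in> atlas_of M"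
    using assms charts_at_atlas by auto
  have "((\<lambda>t. transition c d i (snd c (\<gamma> t))) has_real_derivative
      (\<Sum>j<dim_of M. partial j (transition c d i) (snd c (\<gamma> t0)) * v j)) (at t0 within A)"
    using A cd by (intro smooth_open_chain_rule[OF transition_smooth[OF cd i]] v)
      (auto intro: snd_in_overlap snd_in_Euclidean)
  also have "(\<Sum>j<dim_of M. partial j (transition c d i) (snd c (\<gamma> t0)) * v j) =
      (\<Sum>j<dim_of M. jacobian c d (\<gamma> t0) i j * v j)"
    using assms by (intro sum.cong) (auto simp: jacobian_eq_partial)
  finally show ?thesis
  proof (rule has_field_derivative_transform_within[where d = 1])
    show "transition c d i (snd c (\<gamma> t)) = snd d (\<gamma> t) i" if "t \<in> A" for t
      using A(2)[OF that] chart_inv_left[OF chart[OF cd(1)]] by (simp add: transition_def)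
  qed (use A(1) in auto)
qed

lemma jacobian_comp:
  assumes "c \<in> charts_at M p" "d \<in> charts_at M p" "e \<in> charts_at M p" "i < dim_of M" "k < dim_of M"
  shows "jacobian c e p i k = (\<Sum>j<dim_of M. jacobian d e p i j * jacobian c d p j k)"
proof -
  have at: "c \<in> atlas_of M" "d \<in> atlas_of M" "e \<in> atlas_of M" and p: "p \<in> fst c" "p \<in> fst d" "p \<in> fst e"
    using assms by (auto simp: charts_at_def)
  define x where "x = snd c p"
  \<comment> \<open>The coordinate line of \<open>c\<close> in direction \<open>k\<close>. Its
    velocity in \<open>d\<close> is column \<open>k\<close> of the Jacobian from \<open>c\<close> to
    \<open>d\<close>, so transforming this velocity from \<open>d\<close> to \<open>e\<close> yields
    the composition rule.\<close>
  define \<gamma> where "\<gamma> t = chart_inv c (x(k := t))" for t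
  define U where "U = overlap c d \<inter> overlap c e"
  have U: "openin (Euclidean_space (dim_of M)) U" and xU: "x \<in> U"
    using openin_overlap_atlas[OF at(1,2)] openin_overlap_atlas[OF at(1,3)] p
    by (auto simp: U_def x_def intro: snd_in_overlap)
  define A where "A = {t. x(k := t) \<in> U}"
  have within: "at (x k) within A = at (x k)"
    unfolding A_def by (rule at_within_line[OF U xU assms(5)])
  have \<gamma>x: "\<gamma> (x k) = p"
    using chart_inv_left[OF chart[OF at(1)] p(1)] by (simp add: \<gamma>_def x_def)
  have "((\<lambda>t. snd e (\<gamma> t) i) has_real_derivative
      (\<Sum>j<dim_of M. jacobian d e (\<gamma> (x k)) i j * jacobian c d p j k)) (at (x k) within A)"
  proof (rule velocity_transform)
    show "d \<in> charts_at M (\<gamma> (x k))" "e \<in> charts_at M (\<gamma> (x k))"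
      using assms \<gamma>x by auto
    show "x k \<in> A"
      using xU by (simp add: A_def)
    show "\<gamma> t \<in> fst d \<inter> fst e" if "t \<in> A" for t
      using that overlap_inv[OF _ chart[OF at(1)]] by (auto simp: A_def U_def \<gamma>_def)
    show "((\<lambda>t. snd d (\<gamma> t) j) has_real_derivative jacobian c d p j k) (at (x k) within A)"
      if "j < dim_of M" for j
      using smooth_open_has_partial[OF transition_smooth[OF at(1,2) that], of x k] xU assms
      unfolding within jacobian_eq_partial[OF assms(1,2,5)]
      by (simp add: U_def x_def \<gamma>_def transition_def[abs_def])
  qed (use assms in auto)
  then have "has_partial (transition c e i) k
      (\<Sum>j<dim_of M. jacobian d e p i j * jacobian c d p j k) x"
    unfolding within \<gamma>x by (simp add: transition_def \<gamma>_def)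
  from partialI[OF this] show ?thesis
    using jacobian_eq_partial[OF assms(1,3,5)] by (simp add: x_def)
qed

lemma jacobian_self:
  assumes "c \<in> charts_at M p" "i < dim_of M" "j < dim_of M"
  shows "jacobian c c p i j = (if i = j then 1 else 0)"
proof -
  have c: "c \<in> atlas_of M" "p \<in> fst c"
    using assms by (auto simp: charts_at_def)
  have "has_partial (\<lambda>x. x i) j (if i = j then 1 else 0) (snd c p)"
    by auto
  then have "has_partial (transition c c i) j (if i = j then 1 else 0) (snd c p)"
    using has_partial_cong[OF openin_image[OF c(1)] chart_in_image[OF c(2)] assms(3), of "\<lambda>x. x i" "transition c c i"]
      chart_inv_right[of _ c] by (simp add: transition_def)
  from partialI[OF this] show ?thesis
    using jacobian_eq_partial[OF assms(1,1,3)] by simp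
qed

definition tvec_of :: "'a chart \<Rightarrow> 'a \<Rightarrow> (nat \<Rightarrow> real) \<Rightarrow> 'a tvec"
  where "tvec_of c p a = (\<lambda>d i. if d \<in> charts_at M p \<and> i < dim_of M
    then \<Sum>j<dim_of M. jacobian c d p i j * a j else 0)"

text \<open>The transformation law between two charts \<open>d\<close> and \<open>e\<close> is the
  composition rule \<open>jacobian_comp\<close> for \<open>c\<close>, \<open>d\<close>,
  \<open>e\<close>, after exchanging two finite sums.\<close>

lemma tvec_of_tangent:
  assumes "c \<in> charts_at M p"
  shows "tvec_of c p a \<in> tangent_space M p"
proof -
  have key: "(\<Sum>k<dim_of M. jacobian c e p i k * a k) =
      (\<Sum>j<dim_of M. jacobian d e p i j * (\<Sum>k<dim_of M. jacobian c d p j k * a k))"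
    if "d \<in> charts_at M p" "e \<in> charts_at M p" "i < dim_of M" for d e i
  proof -
    have "(\<Sum>k<dim_of M. jacobian c e p i k * a k) =
        (\<Sum>k<dim_of M. \<Sum>j<dim_of M. jacobian d e p i j * jacobian c d p j k * a k)"
      using jacobian_comp[OF assms that] by (simp add: sum_distrib_right)
    also have "\<dots> = (\<Sum>j<dim_of M. \<Sum>k<dim_of M. jacobian d e p i j * jacobian c d p j k * a k)"
      by (rule sum.swap)
    finally show ?thesis
      by (simp add: sum_distrib_left mult.assoc)
  qed
  show ?thesis
    unfolding tangent_space_def mem_Collect_eq
  proof (intro conjI allI ballI impI)
    show "tvec_of c p a d i = 0" if "d \<notin> charts_at M p \<or> dim_of M \<le> i" for d i
      using that by (auto simp: tvec_of_def)
    show "tvec_of c p a e i = (\<Sum>j<dim_of M. jacobian d e p i j * tvec_of c p a d j)"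
      if "d \<in> charts_at M p" "e \<in> charts_at M p" "i < dim_of M" for d e i
      using that key[OF that] by (simp add: tvec_of_def)
  qed
qed

lemma tvec_of_self:
  assumes "c \<in> charts_at M p" "i < dim_of M"
  shows "tvec_of c p a c i = a i"
proof -
  have "(\<Sum>j<dim_of M. jacobian c c p i j * a j) = (\<Sum>j<dim_of M. if i = j then a j else 0)"
    using assms by (intro sum.cong) (auto simp: jacobian_self)
  then show ?thesis
    using assms by (simp add: tvec_of_def)
qed

lemma tangent_eq_tvec_of:
  assumes "v \<in> tangent_space M p" "c \<in> charts_at M p"
  shows "tvec_of c p (v c) = v"
  using assms by (fastforce simp: tangent_space_def tvec_of_def fun_eq_iff)

lemma tangent_eqI:
  assumes "v \<in> tangent_space M p" "w \<in> tangent_space M p" "c \<in> charts_at M p"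
    "\<And>i. i < dim_of M \<Longrightarrow> v c i = w c i"
  shows "v = w"
proof -
  have "tvec_of c p (v c) = tvec_of c p (w c)"
    using assms(4) by (auto simp: tvec_of_def fun_eq_iff)
  then show ?thesis
    using tangent_eq_tvec_of assms(1-3) by metis
qed

lemma tzero_tangent: "tzero \<in> tangent_space M p"
  by (simp add: tangent_space_def tzero_def)

lemma tangent_transform:
  "v \<in> tangent_space M p \<Longrightarrow> c \<in> charts_at M p \<Longrightarrow> d \<in> charts_at M p \<Longrightarrow> i < dim_of M \<Longrightarrow>
    v d i = (\<Sum>j<dim_of M. jacobian c d p i j * v c j)"
  unfolding tangent_space_def by simp

lemma tangent_junk: "v \<in> tangent_space M p \<Longrightarrow> c \<notin> charts_at M p \<or> dim_of M \<le> i \<Longrightarrow> v c i = 0"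
  unfolding tangent_space_def mem_Collect_eq by (elim conjE allE impE)

lemma tangent_spaceI:
  assumes "\<And>c i. c \<notin> charts_at M p \<or> dim_of M \<le> i \<Longrightarrow> v c i = 0"
    "\<And>c d i. c \<in> charts_at M p \<Longrightarrow> d \<in> charts_at M p \<Longrightarrow> i < dim_of M \<Longrightarrow>
      v d i = (\<Sum>j<dim_of M. jacobian c d p i j * v c j)"
  shows "v \<in> tangent_space M p"
  unfolding tangent_space_def mem_Collect_eq using assms by (intro conjI allI ballI impI)

lemma tadd_tangent:
  assumes "v \<in> tangent_space M p" "w \<in> tangent_space M p"
  shows "tadd v w \<in> tangent_space M p"
proof (rule tangent_spaceI)
  show "tadd v w c i = 0" if "c \<notin> charts_at M p \<or> dim_of M \<le> i" for c i
    unfolding tadd_def using tangent_junk[OF assms(1) that] tangent_junk[OF assms(2) that] by simp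
  show "tadd v w d i = (\<Sum>j<dim_of M. jacobian c d p i j * tadd v w c j)"
    if "c \<in> charts_at M p" "d \<in> charts_at M p" "i < dim_of M" for c d i
    unfolding tadd_def tangent_transform[OF assms(1) that] tangent_transform[OF assms(2) that]
    by (simp add: sum.distrib distrib_left)
qed

lemma tscale_tangent:
  assumes "v \<in> tangent_space M p"
  shows "tscale a v \<in> tangent_space M p"
proof (rule tangent_spaceI)
  show "tscale a v c i = 0" if "c \<notin> charts_at M p \<or> dim_of M \<le> i" for c i
    unfolding tscale_def using tangent_junk[OF assms that] by simp
  show "tscale a v d i = (\<Sum>j<dim_of M. jacobian c d p i j * tscale a v c j)"
    if "c \<in> charts_at M p" "d \<in> charts_at M p" "i < dim_of M" for c d i
    unfolding tscale_def tangent_transform[OF assms that] by (simp add: sum_distrib_left mult.left_commute)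
qed

lemma coord_vec_component:
  "d \<in> charts_at M p \<Longrightarrow> i < dim_of M \<Longrightarrow> coord_vec M c p j d i = jacobian c d p i j"
  by (simp add: coord_vec_def)

lemma coord_vec_tangent:
  assumes "c \<in> charts_at M p" "j < dim_of M"
  shows "coord_vec M c p j \<in> tangent_space M p"
proof -
  have "coord_vec M c p j = tvec_of c p (\<lambda>k. if k = j then 1 else 0)"
    using assms(2) by (auto simp: coord_vec_def tvec_of_def fun_eq_iff if_distrib[of "(*) _"] cong: if_cong)
  then show ?thesis
    using tvec_of_tangent[OF assms(1)] by simp
qed

lemma continuous_jacobian:
  assumes "c \<in> atlas_of M" "d \<in> atlas_of M" "i < dim_of M" "j < dim_of M"
  shows "continuous_map (subtopology (top_of M) (fst c \<inter> fst d)) euclideanreal (\<lambda>p. jacobian c d p i j)"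
proof -
  have s: "smooth_open (dim_of M) (overlap c d) (partial j (transition c d i))"
    by (intro smooth_open_partial transition_smooth assms)
  have "continuous_map (subtopology (Euclidean_space (dim_of M)) (overlap c d)) euclideanreal (partial j (transition c d i))"
    using smooth_open_continuous_on[OF s] openin_subset[OF smooth_open_openin[OF s]]
    by (simp add: continuous_map_Euclidean_real)
  moreover have "continuous_map (subtopology (top_of M) (fst c \<inter> fst d))
      (subtopology (Euclidean_space (dim_of M)) (overlap c d)) (snd c)"
    using continuous_map_from_subtopology_mono[OF chart_continuous[OF chart[OF assms(1)]], of "fst c \<inter> fst d"]
    by (auto simp: continuous_map_in_subtopology snd_in_overlap)
  ultimately have "continuous_map (subtopology (top_of M) (fst c \<inter> fst d)) euclideanreal
      (partial j (transition c d i) \<circ> snd c)"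
    by (rule continuous_map_compose[rotated])
  then show ?thesis
    by (rule continuous_map_eq) (use assms in \<open>auto simp: jacobian_eq_partial charts_at_def\<close>)
qed

text \<open>In an arbitrary chart \<open>c\<close> a formula is only accessible on the overlaps with
  well understood charts \<open>d\<close>; these overlaps are open and cover the image of
  \<open>c\<close>.\<close>

lemma smooth_on_chart_imageI:
  assumes c: "c \<in> atlas_of M"
    and "\<And>p. p \<in> fst c \<Longrightarrow> \<exists>d g. d \<in> charts_at M p \<and> smooth_open (dim_of M) (overlap c d) g \<and>
      (\<forall>x\<in>overlap c d. g x = f x)"
  shows "smooth_open (dim_of M) (chart_image c) f"
proof (rule smooth_open_local[OF openin_image[OF c]])
  fix x assume x: "x \<in> chart_image c"
  then obtain d g where d: "d \<in> charts_at M (chart_inv c x)" "smooth_open (dim_of M) (overlap c d) g"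
      "\<forall>x\<in>overlap c d. g x = f x"
    using assms(2)[OF chart_inv_in[OF x]] by (elim exE conjE)
  have "smooth_open (dim_of M) (overlap c d) f"
    by (rule smooth_open_cong[OF d(2)]) (use d(3) in auto)
  moreover have "x \<in> overlap c d" "overlap c d \<subseteq> chart_image c"
    using x d(1) overlap_iff[OF chart[OF c], of _ d] by (auto simp: charts_at_def)
  ultimately show "\<exists>U. x \<in> U \<and> U \<subseteq> chart_image c \<and> smooth_open (dim_of M) U f"
    by auto
qed

end

lemma continuous_map_local:
  assumes "\<And>x. x \<in> topspace X \<Longrightarrow> \<exists>U. openin X U \<and> x \<in> U \<and> continuous_map (subtopology X U) Y f"
  shows "continuous_map X Y f"
  unfolding continuous_map_def
proof (intro conjI allI impI)
  show "f \<in> topspace X \<rightarrow> topspace Y"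
  proof
    fix x assume x: "x \<in> topspace X"
    then obtain U where "x \<in> U" "continuous_map (subtopology X U) Y f"
      using assms[OF x] by auto
    then show "f x \<in> topspace Y"
      using x by (auto simp: continuous_map_def)
  qed
  fix V assume V: "openin Y V"
  show "openin X {x \<in> topspace X. f x \<in> V}"
  proof (subst openin_subopen, rule)
    fix x assume "x \<in> {x \<in> topspace X. f x \<in> V}"
    then have x: "x \<in> topspace X" "f x \<in> V"
      by auto
    then obtain U where U: "openin X U" "x \<in> U" "continuous_map (subtopology X U) Y f"
      using assms[OF x(1)] by auto
    have "openin (subtopology X U) {y \<in> topspace (subtopology X U). f y \<in> V}"
      by (rule openin_continuous_map_preimage[OF U(3) V])
    then have "openin X {y \<in> topspace (subtopology X U). f y \<in> V}"
      by (rule openin_trans_full[OF _ U(1)])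
    then show "\<exists>T. openin X T \<and> x \<in> T \<and> T \<subseteq> {x \<in> topspace X. f x \<in> V}"
      using x U(2) by (intro exI[of _ "{y \<in> topspace (subtopology X U). f y \<in> V}"]) auto
  qed
qed

context manifold_without_boundary
begin

lemma openin_chart: "c \<in> atlas_of M \<Longrightarrow> openin (top_of M) (fst c)"
  by (rule is_chart_openin[OF chart])

text \<open>The components in any other chart arise from those in \<open>d\<close> by multiplication
  with the Jacobian, whose entries are continuous; so one good chart around each point
  suffices.\<close>

lemma continuous_vector_field_onI:
  assumes tan: "\<And>p. p \<in> S \<Longrightarrow> W p \<in> tangent_space M p"
    and S: "S \<subseteq> points M"
    and comp: "\<And>p. p \<in> S \<Longrightarrow> \<exists>d\<in>charts_at M p. \<forall>j<dim_of M.
      continuous_map (subtopology (top_of M) (S \<inter> fst d)) euclideanreal (\<lambda>p. W p d j)"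
  shows "continuous_vector_field_on M S W"
  unfolding continuous_vector_field_on_def
proof (intro conjI ballI allI impI)
  show "W p \<in> tangent_space M p" if "p \<in> S" for p
    by (rule tan[OF that])
  fix c i assume c: "c \<in> atlas_of M" and i: "i < dim_of M"
  show "continuous_map (subtopology (top_of M) (S \<inter> fst c)) euclideanreal (\<lambda>p. W p c i)"
  proof (rule continuous_map_local)
    fix p assume "p \<in> topspace (subtopology (top_of M) (S \<inter> fst c))"
    then have p: "p \<in> S" "p \<in> fst c"
      by auto
    obtain d where d: "d \<in> charts_at M p" and cont: "\<And>j. j < dim_of M \<Longrightarrow>
        continuous_map (subtopology (top_of M) (S \<inter> fst d)) euclideanreal (\<lambda>p. W p d j)"
      using bexE[OF comp[OF p(1)]] by metis
    define T where "T = S \<inter> fst c \<inter> fst d"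
    have dA: "d \<in> atlas_of M"
      by (rule charts_at_atlas[OF d])
    have "openin (subtopology (top_of M) (S \<inter> fst c)) ((S \<inter> fst c) \<inter> fst d)"
      by (rule openin_subtopology_Int2[OF openin_chart[OF dA]])
    moreover have "p \<in> S \<inter> fst c \<inter> fst d"
      using p charts_at_in[OF d] by simp
    moreover have "continuous_map (subtopology (top_of M) T) euclideanreal (\<lambda>p. W p c i)"
    proof -
      have "continuous_map (subtopology (top_of M) T) euclideanreal (\<lambda>p. \<Sum>j<dim_of M. jacobian d c p i j * W p d j)"
      proof (intro continuous_map_sum continuous_map_real_mult)
        fix j assume "j \<in> {..<dim_of M}"
        then have j: "j < dim_of M"
          by simp
        show "continuous_map (subtopology (top_of M) T) euclideanreal (\<lambda>p. jacobian d c p i j)"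
          by (rule continuous_map_from_subtopology_mono[OF continuous_jacobian[OF dA c i j]]) (auto simp: T_def)
        show "continuous_map (subtopology (top_of M) T) euclideanreal (\<lambda>p. W p d j)"
          by (rule continuous_map_from_subtopology_mono[OF cont[OF j]]) (auto simp: T_def)
      qed simp
      then show ?thesis
      proof (rule continuous_map_eq)
        fix q assume "q \<in> topspace (subtopology (top_of M) T)"
        then have q: "q \<in> S" "q \<in> fst c" "q \<in> fst d"
          by (auto simp: T_def)
        then have "c \<in> charts_at M q" "d \<in> charts_at M q"
          using c dA by (simp_all add: charts_at_def)
        then show "(\<Sum>j<dim_of M. jacobian d c q i j * W q d j) = W q c i"
          by (intro tangent_transform[OF tan[OF q(1)] _ _ i, symmetric])
      qed
    qed
    ultimately show "\<exists>U. openin (subtopology (top_of M) (S \<inter> fst c)) U \<and> p \<in> U \<and>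
        continuous_map (subtopology (subtopology (top_of M) (S \<inter> fst c)) U) euclideanreal (\<lambda>p. W p c i)"
      by (intro exI[of _ T]) (simp add: T_def subtopology_subtopology Int_assoc Int_left_commute)
  qed
qed

section \<open>Velocities of curves\<close>

lemma curve_at_within:
  assumes \<gamma>: "smooth_curve M I \<gamma>" and U: "openin (top_of M) U" "\<gamma> 0 \<in> U"
  shows "at 0 within {t \<in> I. \<gamma> t \<in> U} = at 0 within I" "0 \<in> I" "at 0 within I \<noteq> bot"
proof -
  have I: "is_interval I" "0 \<in> I" "I \<noteq> {0}" and cont: "continuous_map (top_of_set I) (top_of M) \<gamma>"
    using \<gamma> by (simp_all add: smooth_curve_def)
  \<comment> \<open>By continuity the curve stays in \<open>U\<close> for all parameters of
    \<open>I\<close> near 0, so restricting to \<open>U\<close> leaves the filter at 0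
    unchanged.\<close>
  have "openin (top_of_set I) {t \<in> topspace (top_of_set I). \<gamma> t \<in> U}"
    by (rule openin_continuous_map_preimage[OF cont U(1)])
  then obtain T where T: "open T" "{t \<in> I. \<gamma> t \<in> U} = I \<inter> T"
    by (auto simp: openin_open)
  have "0 \<in> T"
    using T(2) I(2) U(2) by auto
  then show "at 0 within {t \<in> I. \<gamma> t \<in> U} = at 0 within I"
    unfolding T(2) by (intro at_within_nhd[of _ T]) (use T(1) in auto)
  show "0 \<in> I"
    by (rule I(2))
  \<comment> \<open>A connected set with more than one point accumulates at each of its points. This
    makes derivatives at 0 within \<open>I\<close> unique.\<close>
  have "0 islimpt I"
    using I by (intro connected_imp_perfect) (auto simp: is_interval_connected)
  then show "at 0 within I \<noteq> bot"
    using trivial_limit_within[of 0 I] by (simp add: trivial_limit_def)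
qed

lemma velocity_component:
  assumes \<gamma>: "smooth_curve M I \<gamma>" and c: "c \<in> charts_at M (\<gamma> 0)" and i: "i < dim_of M"
  shows "((\<lambda>t. snd c (\<gamma> t) i) has_real_derivative velocity M I \<gamma> c i) (at 0 within {t \<in> I. \<gamma> t \<in> fst c})"
proof -
  define A where "A = {t \<in> I. \<gamma> t \<in> fst c}"
  have cA: "c \<in> atlas_of M" "\<gamma> 0 \<in> fst c"
    using c by (auto simp: charts_at_def)
  note w = curve_at_within[OF \<gamma> openin_chart[OF cA(1)] cA(2)]
  have A0: "0 \<in> A"
    using w(2) cA(2) by (simp add: A_def)
  \<comment> \<open>\<open>z\<close> identifies the real line with \<open>Euclidean_space 1\<close>,
    on which \<open>smooth_curve\<close> phrases smoothness.\<close>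
  define z where "z t = (\<lambda>i::nat. if i = 0 then t else (0::real))" for t
  have zE: "z t \<in> topspace (Euclidean_space 1)" for t
    by (auto simp: z_def topspace_Euclidean_space)
  have zz: "z t 0 = t" for t
    by (simp add: z_def)
  define S where "S = {x \<in> topspace (Euclidean_space 1). x 0 \<in> I \<and> \<gamma> (x 0) \<in> fst c}"
  have "smooth_on 1 S (\<lambda>x. snd c (\<gamma> (x 0)) i)"
    using \<gamma> cA(1) i by (simp add: smooth_curve_def S_def)
  moreover have z0: "z 0 \<in> S"
    using w(2) cA(2) zE[of 0] by (simp add: zz S_def)
  ultimately have "\<exists>U F. z 0 \<in> U \<and> smooth_open 1 U F \<and> (\<forall>y\<in>S \<inter> U. F y = snd c (\<gamma> (y 0)) i)"
    unfolding smooth_on_def by (elim conjE) (drule(1) bspec)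
  then obtain U F where U: "z 0 \<in> U" "smooth_open 1 U F" "\<forall>y\<in>S \<inter> U. F y = snd c (\<gamma> (y 0)) i"
    by (elim exE conjE)
  have zu: "(z 0)(0 := t) = z t" for t
    by (auto simp: z_def)
  have op: "open {t. z t \<in> U}"
    using open_line[OF smooth_open_openin[OF U(2)] U(1), of 0] by (simp add: zu)
  have "has_partial F 0 (partial 0 F (z 0)) (z 0)"
    by (rule smooth_open_has_partial[OF U(2,1)]) simp
  then have "((\<lambda>t. F (z t)) has_real_derivative partial 0 F (z 0)) (at 0)"
    unfolding zu by (simp add: z_def)
  \<comment> \<open>The extension \<open>F\<close> is differentiable on both sides of 0 but agrees
    with the chart component only for parameters in \<open>A\<close> that \<open>z\<close> sends
    into \<open>U\<close>. The second condition is open and does not affect the filter.\<close>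
  then have "((\<lambda>t. F (z t)) has_real_derivative partial 0 F (z 0)) (at 0 within A \<inter> {t. z t \<in> U})"
    by (rule has_field_derivative_at_within)
  then have "((\<lambda>t. snd c (\<gamma> t) i) has_real_derivative partial 0 F (z 0)) (at 0 within A \<inter> {t. z t \<in> U})"
  proof (rule has_field_derivative_transform_within[where d = 1])
    show "F (z t) = snd c (\<gamma> t) i" if "t \<in> A \<inter> {t. z t \<in> U}" for t
      using that bspec[OF U(3), of "z t"] zE[of t] by (simp add: A_def S_def zz)
  qed (use A0 U(1) in auto)
  moreover have "at 0 within A \<inter> {t. z t \<in> U} = at 0 within A"
    using op U(1) by (intro at_within_nhd[of _ "{t. z t \<in> U}"]) auto
  ultimately have "((\<lambda>t. snd c (\<gamma> t) i) has_vector_derivative partial 0 F (z 0)) (at 0 within A)"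
    by (simp add: has_real_derivative_iff_has_vector_derivative)
  then have "((\<lambda>t. snd c (\<gamma> t) i) has_vector_derivative vector_derivative (\<lambda>t. snd c (\<gamma> t) i) (at 0 within A)) (at 0 within A)"
    using vector_derivative_works differentiableI_vector by blast
  then show ?thesis
    using c i by (simp add: velocity_def A_def has_real_derivative_iff_has_vector_derivative)
qed

lemma velocity_eqI:
  assumes \<gamma>: "smooth_curve M I \<gamma>" and c: "c \<in> charts_at M (\<gamma> 0)" and i: "i < dim_of M"
    and d: "((\<lambda>t. snd c (\<gamma> t) i) has_real_derivative v) (at 0 within I)"
  shows "velocity M I \<gamma> c i = v"
proof -
  have cA: "c \<in> atlas_of M" "\<gamma> 0 \<in> fst c"
    using c by (auto simp: charts_at_def)
  note w = curve_at_within[OF \<gamma> openin_chart[OF cA(1)] cA(2)]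
  show ?thesis
    using velocity_component[OF \<gamma> c i] d w(3) unfolding w(1)
    by (intro has_field_derivative_unique) auto
qed

lemma velocity_tangent:
  assumes \<gamma>: "smooth_curve M I \<gamma>"
  shows "velocity M I \<gamma> \<in> tangent_space M (\<gamma> 0)"
proof (rule tangent_spaceI)
  show "velocity M I \<gamma> c i = 0" if "c \<notin> charts_at M (\<gamma> 0) \<or> dim_of M \<le> i" for c i
    using that by (auto simp: velocity_def)
  fix c d i assume c: "c \<in> charts_at M (\<gamma> 0)" and d: "d \<in> charts_at M (\<gamma> 0)" and i: "i < dim_of M"
  have at: "c \<in> atlas_of M" "\<gamma> 0 \<in> fst c" "d \<in> atlas_of M" "\<gamma> 0 \<in> fst d"
    using c d by (auto simp: charts_at_def)
  have op: "openin (top_of M) (fst c \<inter> fst d)"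
    by (intro openin_Int openin_chart at)
  note wc = curve_at_within[OF \<gamma> openin_chart[OF at(1)] at(2)]
  note wcd = curve_at_within[OF \<gamma> op, unfolded Int_iff, OF conjI[OF at(2,4)]]
  have "((\<lambda>t. snd d (\<gamma> t) i) has_real_derivative
      (\<Sum>j<dim_of M. jacobian c d (\<gamma> 0) i j * velocity M I \<gamma> c j)) (at 0 within {t \<in> I. \<gamma> t \<in> fst c \<and> \<gamma> t \<in> fst d})"
  proof (rule velocity_transform[where \<gamma> = \<gamma> and ?t0.0 = 0, OF c d _ _ _ i])
    show "((\<lambda>t. snd c (\<gamma> t) j) has_real_derivative velocity M I \<gamma> c j)
        (at 0 within {t \<in> I. \<gamma> t \<in> fst c \<and> \<gamma> t \<in> fst d})" if "j < dim_of M" for j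
      using velocity_component[OF \<gamma> c that] unfolding wc(1) wcd(1) .
  qed (use wc(2) at in auto)
  then show "velocity M I \<gamma> d i = (\<Sum>j<dim_of M. jacobian c d (\<gamma> 0) i j * velocity M I \<gamma> c j)"
    unfolding wcd(1) by (rule velocity_eqI[OF \<gamma> d i])
qed

end

section \<open>The Moebius band\<close>

lemma second_countable_euclidean: "second_countable (euclidean :: 'a::second_countable_topology topology)"
proof -
  obtain B :: "'a set set" where B: "countable B" "topological_basis B"
    using ex_countable_basis by auto
  then have "\<forall>U x. open U \<and> x \<in> U \<longrightarrow> (\<exists>V\<in>B. x \<in> V \<and> V \<subseteq> U)"
    by (meson topological_basisE)
  moreover have "\<forall>V\<in>B. open V"
    using B(2) topological_basis_open by auto
  ultimately show ?thesis
    using B(1) unfolding second_countable_def by (intro exI[of _ B]) simp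
qed

text \<open>The coordinates 2 and 3 form a vector of signed length \<open>y\<close> at angle
  \<open>x / 2\<close>. A full turn of \<open>x\<close> rotates its direction by \<open>pi\<close>,
  so the point stays the same when \<open>y\<close> changes its sign.\<close>

definition moebius_pt :: "real \<Rightarrow> real \<Rightarrow> nat \<Rightarrow> real"
  where "moebius_pt x y = (\<lambda>i. if i = 0 then cos x else if i = 1 then sin x
    else if i = 2 then y * cos (x / 2) else if i = 3 then y * sin (x / 2) else 0)"

definition moebius_set :: "(nat \<Rightarrow> real) set"
  where "moebius_set = {moebius_pt x y |x y. True}"

text \<open>All real centres are allowed, so that every point lies in the strip centred at its own
  angle.\<close>

definition moebius_strip :: "real \<Rightarrow> (nat \<Rightarrow> real) set"
  where "moebius_strip a = {moebius_pt x y |x y. \<bar>x - a\<bar> < pi}"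

text \<open>Rotating by \<open>cis (- a)\<close> first moves the branch cut of \<open>Arg\<close>
  opposite to the centre \<open>a\<close>, that is, outside the strip.\<close>

definition angle :: "real \<Rightarrow> (nat \<Rightarrow> real) \<Rightarrow> real"
  where "angle a p = a + Arg ((of_real (p 0) + \<i> * of_real (p 1)) * cis (- a))"

text \<open>The coordinates 2 and 3 are projected to the unit vector at half the angle. The sign of
  the result depends on the representative that \<open>angle a\<close> selects.\<close>

definition height :: "real \<Rightarrow> (nat \<Rightarrow> real) \<Rightarrow> real"
  where "height a p = p 2 * cos (angle a p / 2) + p 3 * sin (angle a p / 2)"

definition moebius_chart :: "real \<Rightarrow> (nat \<Rightarrow> real) chart"
  where "moebius_chart a =
    (moebius_strip a, \<lambda>p i. if i = 0 then angle a p else if i = 1 then height a p else 0)"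

text \<open>The action on \<open>y\<close> of the \<open>k\<close>-th power of the
  identification.\<close>

definition flip_sign :: "int \<Rightarrow> real"
  where "flip_sign k = (if even k then 1 else - 1)"

lemma moebius_in_set: "moebius_pt x y \<in> moebius_set"
  by (auto simp: moebius_set_def)

lemma moebius_strip_subset: "moebius_strip a \<subseteq> moebius_set"
  by (auto simp: moebius_strip_def moebius_set_def)

lemma moebius_in_stripI: "\<bar>x - a\<bar> < pi \<Longrightarrow> moebius_pt x y \<in> moebius_strip a"
  by (auto simp: moebius_strip_def)

lemma moebius_point: "of_real (moebius_pt x y 0) + \<i> * of_real (moebius_pt x y 1) = cis x"
  by (simp add: moebius_pt_def complex_eq_iff)

lemma angle_moebius: "\<bar>x - a\<bar> < pi \<Longrightarrow> angle a (moebius_pt x y) = x"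
  unfolding angle_def moebius_point cis_mult by (subst Arg_cis) (auto simp: abs_less_iff)

lemma height_moebius:
  assumes "\<bar>x - a\<bar> < pi"
  shows "height a (moebius_pt x y) = y"
proof -
  have "y * cos (x / 2) * cos (x / 2) + y * sin (x / 2) * sin (x / 2) =
      y * ((cos (x / 2))\<^sup>2 + (sin (x / 2))\<^sup>2)"
    by (simp only: distrib_left power2_eq_square mult.assoc)
  then show ?thesis
    unfolding height_def angle_moebius[OF assms] by (simp add: moebius_pt_def mult.assoc)
qed

lemma moebius_angle_height: "p \<in> moebius_strip a \<Longrightarrow> moebius_pt (angle a p) (height a p) = p"
  by (auto simp: moebius_strip_def angle_moebius height_moebius)

lemma angle_bound: "p \<in> moebius_strip a \<Longrightarrow> \<bar>angle a p - a\<bar> < pi"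
  by (auto simp: moebius_strip_def angle_moebius)

text \<open>The half-angle moves by \<open>pi * k\<close>, so its sine and cosine both acquire the
  factor \<open>flip_sign k\<close>, which cancels against the one at \<open>y\<close>.\<close>

lemma moebius_periodic: "moebius_pt (x + 2 * pi * of_int k) (flip_sign k * y) = moebius_pt x y"
proof -
  have half: "(x + 2 * pi * of_int k) / 2 = x / 2 + pi * of_int k"
    by simp
  have full: "cos (x + 2 * pi * of_int k) = cos x" "sin (x + 2 * pi * of_int k) = sin x"
    unfolding cos_add sin_add by simp_all
  have halves: "cos ((x + 2 * pi * of_int k) / 2) = flip_sign k * cos (x / 2)"
    "sin ((x + 2 * pi * of_int k) / 2) = flip_sign k * sin (x / 2)"
    unfolding half cos_add sin_add by (simp_all add: flip_sign_def)
  have flip: "flip_sign k * y * (flip_sign k * z) = y * z" for z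
    by (simp add: flip_sign_def)
  show ?thesis
    unfolding moebius_pt_def full halves flip ..
qed

text \<open>The first two coordinates determine \<open>x\<close> up to multiples of
  \<open>2 * pi\<close>, and by \<open>moebius_periodic\<close> every shift by such a multiple
  belongs to a representative of the same point.\<close>

lemma moebius_strip_iff:
  "moebius_pt x y \<in> moebius_strip a \<longleftrightarrow> (\<exists>k::int. \<bar>x + 2 * pi * of_int k - a\<bar> < pi)"
proof
  assume "moebius_pt x y \<in> moebius_strip a"
  then obtain x' y' where x': "moebius_pt x y = moebius_pt x' y'" "\<bar>x' - a\<bar> < pi"
    by (auto simp: moebius_strip_def)
  then have "moebius_pt x' y' 0 = moebius_pt x y 0" "moebius_pt x' y' 1 = moebius_pt x y 1"
    by simp_all
  then have "sin x' = sin x \<and> cos x' = cos x"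
    by (simp add: moebius_pt_def)
  then show "\<exists>k::int. \<bar>x + 2 * pi * of_int k - a\<bar> < pi"
    using x'(2) unfolding sin_cos_eq_iff by auto
next
  assume "\<exists>k::int. \<bar>x + 2 * pi * of_int k - a\<bar> < pi"
  then obtain k :: int where "\<bar>x + 2 * pi * of_int k - a\<bar> < pi"
    by auto
  then show "moebius_pt x y \<in> moebius_strip a"
    using moebius_in_stripI moebius_periodic by metis
qed

text \<open>A description without representatives: the strip is the preimage of the slit plane under
  a continuous map. This gives both its openness and the continuity of \<open>Arg\<close> on
  it.\<close>

lemma moebius_strip_eq:
  "moebius_strip a = {p \<in> moebius_set. (of_real (p 0) + \<i> * of_real (p 1)) * cis (- a) \<notin> \<real>\<^sub>\<le>\<^sub>0}"
proof -
  have "moebius_pt x y \<in> moebius_strip a \<longleftrightarrow> cis (x - a) \<notin> \<real>\<^sub>\<le>\<^sub>0" for x y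
  proof
    assume "moebius_pt x y \<in> moebius_strip a"
    then obtain k :: int where k: "\<bar>x + 2 * pi * of_int k - a\<bar> < pi"
      by (auto simp: moebius_strip_iff)
    define t where "t = x + 2 * pi * of_int k - a"
    have "x - a = t + 2 * pi * of_int (- k)"
      by (simp add: t_def)
    then have "cis (x - a) = cis t * cis (2 * pi * of_int (- k))"
      by (simp only: cis_mult)
    also have "cis (2 * pi * of_int (- k)) = 1"
      by (rule complex_eqI) (simp_all del: of_int_minus)
    finally have "cis (x - a) = cis t"
      by simp
    moreover have "Arg (cis t) \<noteq> pi"
      using k by (subst Arg_cis) (auto simp: t_def abs_less_iff)
    then have "\<not> (cos t < 0 \<and> sin t = 0)"
      by (simp add: Arg_eq_pi)
    \<comment> \<open>\<open>Arg_eq_pi\<close> excludes the negative real axis; the slit also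
      contains 0, which \<open>cis t\<close> never meets.\<close>
    moreover have "\<not> (cos t = 0 \<and> sin t = 0)"
      by (metis sin_cos_squared_add power_zero_numeral add_0 zero_neq_one)
    ultimately show "cis (x - a) \<notin> \<real>\<^sub>\<le>\<^sub>0"
      by (auto simp: complex_nonpos_Reals_iff)
  next
    assume c: "cis (x - a) \<notin> \<real>\<^sub>\<le>\<^sub>0"
    define t where "t = Arg (cis (x - a))"
    have "cis t = cis (x - a)"
      unfolding t_def by (simp add: cis_Arg)
    then have "sin t = sin (x - a) \<and> cos t = cos (x - a)"
      by (simp add: complex_eq_iff)
    then obtain k :: int where "t = x - a + 2 * pi * of_int k"
      unfolding sin_cos_eq_iff by auto
    moreover have "t \<noteq> pi"
      using c Arg_eq_pi[of "cis (x - a)"] by (auto simp: t_def complex_nonpos_Reals_iff)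
    then have "\<bar>t\<bar> < pi"
      using Arg_bounded[of "cis (x - a)"] by (auto simp: t_def)
    ultimately show "moebius_pt x y \<in> moebius_strip a"
      unfolding moebius_strip_iff by (intro exI[of _ k]) (simp add: algebra_simps)
  qed
  moreover have "(of_real (moebius_pt x y 0) + \<i> * of_real (moebius_pt x y 1)) * cis (- a) = cis (x - a)" for x y
    unfolding moebius_point by (simp add: cis_mult)
  ultimately show ?thesis
    using moebius_strip_subset[of a] by (auto simp: moebius_set_def)
qed

section \<open>Topology and charts of the band\<close>

lemma continuous_on_point: "continuous_on A (\<lambda>p. (of_real (p 0) + \<i> * of_real (p 1)) * cis (- a))"
  by (intro continuous_intros continuous_on_coord)

lemma continuous_on_angle: "continuous_on (moebius_strip a) (angle a)"
  unfolding angle_def by (intro continuous_intros continuous_on_point) (simp add: moebius_strip_eq)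

lemma continuous_on_height: "continuous_on (moebius_strip a) (height a)"
  unfolding height_def by (intro continuous_intros continuous_on_coord continuous_on_angle) simp_all

lemma continuous_on_moebius_pt:
  fixes f :: "'a::t2_space \<Rightarrow> real"
  assumes "continuous_on A f" "continuous_on A g"
  shows "continuous_on A (\<lambda>t. moebius_pt (f t) (g t))"
proof (rule continuous_on_coordinatewise_then_product)
  fix i
  have "continuous_on A (\<lambda>t. cos (f t))" "continuous_on A (\<lambda>t. sin (f t))"
    "continuous_on A (\<lambda>t. g t * cos (f t / 2))" "continuous_on A (\<lambda>t. g t * sin (f t / 2))"
    by (auto intro!: continuous_intros assms)
  then show "continuous_on A (\<lambda>t. moebius_pt (f t) (g t) i)"
    unfolding moebius_pt_def by (cases "i = 0"; cases "i = 1"; cases "i = 2"; cases "i = 3") simp_all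
qed

abbreviation moebius_top :: "(nat \<Rightarrow> real) topology"
  where "moebius_top \<equiv> top_of_set moebius_set"

lemma openin_moebius_strip: "openin moebius_top (moebius_strip a)"
proof -
  have "continuous_on moebius_set (\<lambda>p. (of_real (p 0) + \<i> * of_real (p 1)) * cis (- a))"
    by (rule continuous_on_point)
  then have "openin moebius_top (moebius_set \<inter>
      (\<lambda>p. (of_real (p 0) + \<i> * of_real (p 1)) * cis (- a)) -` (- \<real>\<^sub>\<le>\<^sub>0))"
    by (rule continuous_openin_preimage_gen) (simp add: open_Compl)
  then show ?thesis
    unfolding moebius_strip_eq by (simp add: vimage_def Int_def)
qed

lemma snd_moebius_chart:
  assumes "\<bar>x 0 - a\<bar> < pi" "x \<in> topspace (Euclidean_space 2)"
  shows "snd (moebius_chart a) (moebius_pt (x 0) (x 1)) = x"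
proof
  show "snd (moebius_chart a) (moebius_pt (x 0) (x 1)) i = x i" for i
    using assms(2) by (cases "i = 0"; cases "i = 1")
      (simp_all add: moebius_chart_def angle_moebius[OF assms(1)] height_moebius[OF assms(1)]
        topspace_Euclidean_space del: One_nat_def)
qed

lemma moebius_chart_image:
  "chart_image (moebius_chart a) = {x \<in> topspace (Euclidean_space 2). x 0 \<in> {a - pi <..< a + pi}}"
proof (intro equalityI subsetI)
  fix x assume "x \<in> chart_image (moebius_chart a)"
  then show "x \<in> {x \<in> topspace (Euclidean_space 2). x 0 \<in> {a - pi <..< a + pi}}"
    using angle_bound by (fastforce simp: chart_image_def moebius_chart_def topspace_Euclidean_space)
next
  fix x assume x: "x \<in> {x \<in> topspace (Euclidean_space 2). x 0 \<in> {a - pi <..< a + pi}}"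
  then have a: "\<bar>x 0 - a\<bar> < pi"
    by auto
  have "x = snd (moebius_chart a) (moebius_pt (x 0) (x 1))"
    using snd_moebius_chart[of x a, OF a] x by simp
  moreover have "moebius_pt (x 0) (x 1) \<in> fst (moebius_chart a)"
    using moebius_in_stripI[OF a] by (simp add: moebius_chart_def)
  ultimately show "x \<in> chart_image (moebius_chart a)"
    unfolding chart_image_def by (rule image_eqI)
qed

lemma openin_moebius_chart_image: "openin (Euclidean_space 2) (chart_image (moebius_chart a))"
  unfolding moebius_chart_image
  by (intro openin_Euclidean_level continuous_on_coord) auto

lemma is_chart_moebius_chart: "is_chart 2 moebius_top (moebius_chart a)"
proof -
  have sub: "chart_image (moebius_chart a) \<subseteq> topspace (Euclidean_space 2)"
    by (auto simp: moebius_chart_image)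
  have "continuous_on (moebius_strip a) (snd (moebius_chart a))"
  proof (rule continuous_on_coordinatewise_then_product)
    show "continuous_on (moebius_strip a) (\<lambda>p. snd (moebius_chart a) p i)" for i
      by (cases "i = 0"; cases "i = 1")
        (simp_all add: moebius_chart_def continuous_on_angle continuous_on_height)
  qed
  moreover have "continuous_on (chart_image (moebius_chart a)) (\<lambda>x. moebius_pt (x 0) (x 1))"
    by (intro continuous_on_moebius_pt continuous_on_coord)
  moreover have "moebius_pt (x 0) (x 1) \<in> moebius_strip a"
    "snd (moebius_chart a) (moebius_pt (x 0) (x 1)) = x" if "x \<in> chart_image (moebius_chart a)" for x
  proof -
    have a: "\<bar>x 0 - a\<bar> < pi" and x: "x \<in> topspace (Euclidean_space 2)"
      using that by (auto simp: moebius_chart_image)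
    show "moebius_pt (x 0) (x 1) \<in> moebius_strip a"
      by (rule moebius_in_stripI[OF a])
    show "snd (moebius_chart a) (moebius_pt (x 0) (x 1)) = x"
      by (rule snd_moebius_chart[of x a, OF a x])
  qed
  moreover have "moebius_pt (snd (moebius_chart a) p 0) (snd (moebius_chart a) p 1) = p"
    if "p \<in> moebius_strip a" for p
    using moebius_angle_height[OF that] by (simp add: moebius_chart_def)
  ultimately have "homeomorphic_maps (top_of_set (moebius_strip a)) (top_of_set (chart_image (moebius_chart a)))
      (snd (moebius_chart a)) (\<lambda>x. moebius_pt (x 0) (x 1))"
    unfolding homeomorphic_maps_def
    by (auto simp: chart_image_def moebius_chart_def)
  then have "homeomorphic_map (subtopology moebius_top (moebius_strip a))
      (subtopology (Euclidean_space 2) (chart_image (moebius_chart a))) (snd (moebius_chart a))"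
    using moebius_strip_subset[of a]
    by (auto simp: subtopology_Euclidean_space[OF sub] subtopology_subtopology Int_absorb1
        intro: homeomorphic_maps_imp_map)
  then show ?thesis
    using openin_moebius_strip openin_moebius_chart_image by (simp add: is_chart_def moebius_chart_def)
qed

lemma moebius_chart_inv:
  assumes "x \<in> chart_image (moebius_chart a)"
  shows "chart_inv (moebius_chart a) x = moebius_pt (x 0) (x 1)"
proof -
  have a: "\<bar>x 0 - a\<bar> < pi" and x: "x \<in> topspace (Euclidean_space 2)"
    using assms by (auto simp: moebius_chart_image)
  have "snd (moebius_chart a) (moebius_pt (x 0) (x 1)) = x"
    by (rule snd_moebius_chart[of x a, OF a x])
  moreover have "moebius_pt (x 0) (x 1) \<in> fst (moebius_chart a)"
    using moebius_in_stripI[OF a] by (simp add: moebius_chart_def)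
  ultimately show ?thesis
    using chart_inv_left[OF is_chart_moebius_chart] by metis
qed

text \<open>The point also has the representative
  \<open>(x 0 + 2 * pi * k, flip_sign k * x 1)\<close>, which lies in the window of
  \<open>b\<close>; its entries are therefore the coordinates in chart \<open>b\<close>.\<close>

lemma moebius_transition:
  assumes "x \<in> chart_image (moebius_chart a)" "\<bar>x 0 + 2 * pi * of_int k - b\<bar> < pi"
  shows "transition (moebius_chart a) (moebius_chart b) 0 x = x 0 + 2 * pi * of_int k"
    and "transition (moebius_chart a) (moebius_chart b) 1 x = flip_sign k * x 1"
  using angle_moebius[OF assms(2), of "flip_sign k * x 1"] height_moebius[OF assms(2), of "flip_sign k * x 1"]
  unfolding moebius_periodic
  by (simp_all add: transition_def moebius_chart_inv[OF assms(1)]) (simp_all add: moebius_chart_def)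

lemma fst_moebius_chart: "fst (moebius_chart a) = moebius_strip a"
  by (simp add: moebius_chart_def)

lemma moebius_overlap_iff:
  "x \<in> overlap (moebius_chart a) (moebius_chart b) \<longleftrightarrow>
    x \<in> chart_image (moebius_chart a) \<and> (\<exists>k::int. \<bar>x 0 + 2 * pi * of_int k - b\<bar> < pi)"
  using moebius_chart_inv[of x a]
  by (auto simp: overlap_iff[OF is_chart_moebius_chart] fst_moebius_chart moebius_strip_iff)

text \<open>On this set one fixed \<open>k\<close> moves the angle into the window of
  \<open>b\<close>, so the transition is given by a single affine formula there.\<close>

lemma openin_moebius_shift:
  "openin (Euclidean_space 2) {x \<in> chart_image (moebius_chart a). x 0 \<in> {b - pi - 2 * pi * of_int k <..< b + pi - 2 * pi * of_int k}}"
  by (intro openin_Euclidean_level[OF openin_moebius_chart_image] continuous_on_coord) auto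

text \<open>The overlap of two strips can fall into two pieces with different \<open>k\<close>, so
  the affine formulas are used locally and glued.\<close>

lemma compatible_moebius: "compatible 2 (moebius_chart a) (moebius_chart b)"
proof -
  have "smooth_on 2 (overlap (moebius_chart a) (moebius_chart b)) (transition (moebius_chart a) (moebius_chart b) i)"
    if "i < 2" for i a b
  proof -
    have op: "openin (Euclidean_space 2) (overlap (moebius_chart a) (moebius_chart b))"
      using openin_moebius_strip
      by (intro openin_overlap[OF is_chart_moebius_chart _ openin_moebius_chart_image]) (simp add: fst_moebius_chart)
    have "smooth_open 2 (overlap (moebius_chart a) (moebius_chart b)) (transition (moebius_chart a) (moebius_chart b) i)"
    proof (rule smooth_open_local[OF op])
      fix x assume x: "x \<in> overlap (moebius_chart a) (moebius_chart b)"
      then obtain k :: int where k: "\<bar>x 0 + 2 * pi * of_int k - b\<bar> < pi"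
        by (auto simp: moebius_overlap_iff)
      define U where "U = {x \<in> chart_image (moebius_chart a). x 0 \<in> {b - pi - 2 * pi * of_int k <..< b + pi - 2 * pi * of_int k}}"
      have U: "openin (Euclidean_space 2) U"
        unfolding U_def by (rule openin_moebius_shift)
      have near: "\<bar>y 0 + 2 * pi * of_int k - b\<bar> < pi" "y \<in> chart_image (moebius_chart a)" if "y \<in> U" for y
        using that by (auto simp: U_def)
      have "x \<in> U"
        using x k by (auto simp: U_def moebius_overlap_iff abs_less_iff)
      moreover have "U \<subseteq> overlap (moebius_chart a) (moebius_chart b)"
        using near by (intro subsetI moebius_overlap_iff[THEN iffD2] conjI exI[of _ k]) simp_all
      moreover have "smooth_open 2 U (transition (moebius_chart a) (moebius_chart b) i)"
      proof (cases "i = 0")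
        case True
        have "smooth_open 2 U (\<lambda>x. x 0 + 2 * pi * of_int k)"
          by (intro smooth_open_add smooth_open_coord smooth_open_const U)
        then show ?thesis
          unfolding True by (rule smooth_open_cong) (simp add: moebius_transition(1)[OF near(2,1)])
      next
        case False
        then have i: "i = 1"
          using \<open>i < 2\<close> by simp
        have "smooth_open 2 U (\<lambda>x. flip_sign k * x 1)"
          by (intro smooth_open_mult smooth_open_coord smooth_open_const U)
        then show ?thesis
          unfolding i by (rule smooth_open_cong) (rule moebius_transition(2)[OF near(2,1), symmetric])
      qed
      ultimately show "\<exists>U. x \<in> U \<and> U \<subseteq> overlap (moebius_chart a) (moebius_chart b) \<and>
          smooth_open 2 U (transition (moebius_chart a) (moebius_chart b) i)"
        by auto
    qed
    then show ?thesis
      by (simp add: smooth_on_open_iff[OF op])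
  qed
  then show ?thesis
    by (simp add: compatible_def)
qed

definition moebius_manifold :: "(nat \<Rightarrow> real) manifold"
  where "moebius_manifold = generated_manifold 2 moebius_top (range moebius_chart)"

lemma moebius_in_strip_self: "moebius_pt x y \<in> moebius_strip x"
  by (rule moebius_in_stripI) simp

lemma moebius_manifold_simps [simp]:
  "dim_of moebius_manifold = 2" "top_of moebius_manifold = moebius_top"
  by (simp_all add: moebius_manifold_def generated_manifold_def)

lemma moebius_cover: "topspace moebius_top \<subseteq> (\<Union>d\<in>range moebius_chart. fst d)"
  using moebius_in_strip_self by (auto simp: moebius_set_def fst_moebius_chart)

interpretation moebius: manifold_without_boundary moebius_manifold
proof
  have B: "is_chart 2 moebius_top d \<and> openin (Euclidean_space 2) (chart_image d)" if "d \<in> range moebius_chart" for d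
    using that is_chart_moebius_chart openin_moebius_chart_image by (elim imageE) simp
  show "smooth_manifold moebius_manifold"
    unfolding moebius_manifold_def
  proof (rule smooth_manifold_generated[OF _ _ moebius_cover B])
    show "Hausdorff_space moebius_top"
      by (simp add: Hausdorff_space_subtopology)
    show "second_countable moebius_top"
      by (simp add: second_countable_subtopology second_countable_euclidean)
    show "compatible 2 d e" if "d \<in> range moebius_chart" "e \<in> range moebius_chart" for d e
      using that compatible_moebius by (elim imageE) simp
  qed
  show "openin (Euclidean_space (dim_of moebius_manifold)) (chart_image c)" if "c \<in> atlas_of moebius_manifold" for c
    using generated_manifold_open_image[OF moebius_cover B, of c] that
    unfolding moebius_manifold_def[symmetric] by simp
qed

lemma moebius_chart_in_atlas: "moebius_chart a \<in> atlas_of moebius_manifold"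
  using is_chart_moebius_chart compatible_moebius
  by (auto simp: moebius_manifold_def generated_manifold_def)

lemma moebius_charts_at: "p \<in> moebius_strip a \<Longrightarrow> moebius_chart a \<in> charts_at moebius_manifold p"
  using moebius_chart_in_atlas by (simp add: charts_at_def fst_moebius_chart)

section \<open>The metric\<close>

lemma sum_lessThan_2: "(\<Sum>j<2. f j) = f 0 + f (1 :: nat)" for f :: "nat \<Rightarrow> real"
  by (simp add: numeral_2_eq_2)

lemma moebius_chart_change:
  assumes p: "p \<in> moebius_strip a" and k: "\<bar>angle a p + 2 * pi * of_int k - b\<bar> < pi"
  shows "p \<in> moebius_strip b" "height b p = flip_sign k * height a p"
    "jacobian (moebius_chart a) (moebius_chart b) p 0 0 = 1"
    "jacobian (moebius_chart a) (moebius_chart b) p 0 1 = 0"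
    "jacobian (moebius_chart a) (moebius_chart b) p 1 0 = 0"
    "jacobian (moebius_chart a) (moebius_chart b) p 1 1 = flip_sign k"
proof -
  define x where "x = snd (moebius_chart a) p"
  have x: "x 0 = angle a p" "x 1 = height a p"
    by (simp_all add: x_def moebius_chart_def)
  have p_eq: "p = moebius_pt (angle a p + 2 * pi * of_int k) (flip_sign k * height a p)"
    unfolding moebius_periodic by (rule moebius_angle_height[OF p, symmetric])
  show pb: "p \<in> moebius_strip b"
    by (subst p_eq) (rule moebius_in_stripI[OF k])
  show "height b p = flip_sign k * height a p"
    by (subst p_eq) (rule height_moebius[OF k])
  define U where "U = {x \<in> chart_image (moebius_chart a). x 0 \<in> {b - pi - 2 * pi * of_int k <..< b + pi - 2 * pi * of_int k}}"
  have U: "openin (Euclidean_space 2) U"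
    unfolding U_def by (rule openin_moebius_shift)
  have near: "y \<in> chart_image (moebius_chart a)" "\<bar>y 0 + 2 * pi * of_int k - b\<bar> < pi" if "y \<in> U" for y
    using that by (auto simp: U_def)
  have xU: "x \<in> U"
    using p k chart_in_image[of p "moebius_chart a"] by (auto simp: U_def x x_def fst_moebius_chart abs_less_iff)
      (auto simp: moebius_chart_def)
  have jac: "jacobian (moebius_chart a) (moebius_chart b) p i j = D"
    \<comment> \<open>Partial derivatives at \<open>x\<close> depend only on values in the
      neighbourhood \<open>U\<close>, where \<open>k\<close> is constant; so the affine formula
      \<open>f\<close> may replace the transition.\<close>
    if "has_partial f j D x" "j < 2" "\<And>y. y \<in> U \<Longrightarrow> f y = transition (moebius_chart a) (moebius_chart b) i y"
    for f i j D
  proof -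
    have "has_partial (transition (moebius_chart a) (moebius_chart b) i) j D x"
      using has_partial_cong[OF U xU that(2), of f] that(1,3) by simp
    then show ?thesis
      using moebius.jacobian_eq_partial[OF moebius_charts_at[OF p] moebius_charts_at[OF pb], of j i] that(2) partialI
      by (simp add: x_def)
  qed
  have tr: "y 0 + 2 * pi * of_int k = transition (moebius_chart a) (moebius_chart b) 0 y"
    "flip_sign k * y 1 = transition (moebius_chart a) (moebius_chart b) 1 y" if "y \<in> U" for y
    using moebius_transition[OF near[OF that]] by simp_all
  show "jacobian (moebius_chart a) (moebius_chart b) p 0 0 = 1"
    by (rule jac[where f = "\<lambda>y. y 0 + 2 * pi * of_int k", OF _ _ tr(1)]) (auto intro!: derivative_eq_intros)
  show "jacobian (moebius_chart a) (moebius_chart b) p 0 1 = 0"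
    by (rule jac[where f = "\<lambda>y. y 0 + 2 * pi * of_int k", OF _ _ tr(1)]) (auto intro!: derivative_eq_intros)
  show "jacobian (moebius_chart a) (moebius_chart b) p 1 0 = 0"
    by (rule jac[where f = "\<lambda>y. flip_sign k * y 1", OF _ _ tr(2)]) (auto intro!: derivative_eq_intros)
  show "jacobian (moebius_chart a) (moebius_chart b) p 1 1 = flip_sign k"
    by (rule jac[where f = "\<lambda>y. flip_sign k * y 1", OF _ _ tr(2)]) (auto intro!: derivative_eq_intros)
qed

lemma moebius_chart_change_exists:
  assumes "p \<in> moebius_strip a" "p \<in> moebius_strip b"
  obtains k :: int where "\<bar>angle a p + 2 * pi * of_int k - b\<bar> < pi"
  using assms(2) moebius_strip_iff[of "angle a p" "height a p" b]
  unfolding moebius_angle_height[OF assms(1)] by (auto intro: that)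

lemma moebius_tangent_change:
  assumes v: "v \<in> tangent_space moebius_manifold p" and p: "p \<in> moebius_strip a"
    and k: "\<bar>angle a p + 2 * pi * of_int k - b\<bar> < pi"
  shows "v (moebius_chart b) 0 = v (moebius_chart a) 0"
    "v (moebius_chart b) 1 = flip_sign k * v (moebius_chart a) 1"
proof -
  note c = moebius_chart_change[OF p k]
  have "v (moebius_chart b) i = (\<Sum>j<2. jacobian (moebius_chart a) (moebius_chart b) p i j * v (moebius_chart a) j)"
    if "i < 2" for i
    using moebius.tangent_transform[OF v moebius_charts_at[OF p] moebius_charts_at[OF c(1)], of i] that by simp
  from this[of 0] this[of 1] show "v (moebius_chart b) 0 = v (moebius_chart a) 0"
    "v (moebius_chart b) 1 = flip_sign k * v (moebius_chart a) 1"
    unfolding sum_lessThan_2 c by simp_all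
qed

text \<open>This is \<open>y^2\<close>. Written in ambient coordinates it is continuous on the whole
  band without reference to a chart, unlike \<open>y\<close>.\<close>

definition width :: "(nat \<Rightarrow> real) \<Rightarrow> real"
  where "width p = (p 2)\<^sup>2 + (p 3)\<^sup>2"

lemma width_moebius: "width (moebius_pt x y) = y\<^sup>2"
proof -
  have "width (moebius_pt x y) = y\<^sup>2 * ((cos (x / 2))\<^sup>2 + (sin (x / 2))\<^sup>2)"
    by (simp add: width_def moebius_pt_def power_mult_distrib distrib_left del: sin_cos_squared_add sin_cos_squared_add2)
  then show ?thesis
    by simp
qed

lemma width_eq: "p \<in> moebius_strip a \<Longrightarrow> width p = (height a p)\<^sup>2"
  using width_moebius[of "angle a p" "height a p"] by (simp add: moebius_angle_height)

lemma continuous_on_width: "continuous_on A width"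
  unfolding width_def by (intro continuous_intros continuous_on_coord)

text \<open>A choice without any continuity; \<open>moebius_metric_eq\<close> and
  \<open>moebius_fields_eq\<close> remove the dependence on it.\<close>

definition moebius_index :: "(nat \<Rightarrow> real) \<Rightarrow> real"
  where "moebius_index p = (SOME a. p \<in> moebius_strip a)"

lemma moebius_index: "p \<in> moebius_set \<Longrightarrow> p \<in> moebius_strip (moebius_index p)"
  unfolding moebius_index_def by (rule someI_ex) (use moebius_in_strip_self in \<open>auto simp: moebius_set_def\<close>)

definition moebius_metric :: "(nat \<Rightarrow> real) metric"
  where "moebius_metric p u v = (let c = moebius_chart (moebius_index p) in
    u c 0 * v c 0 + (1 - width p) * (u c 1 * v c 1))"

text \<open>A change of strips multiplies the second components of both \<open>u\<close> and
  \<open>v\<close> by \<open>flip_sign k\<close>, which cancels in their product; the chosen strip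
  may thus be replaced by any other one.\<close>

lemma moebius_metric_eq:
  assumes p: "p \<in> moebius_strip a"
    and uv: "u \<in> tangent_space moebius_manifold p" "v \<in> tangent_space moebius_manifold p"
  shows "moebius_metric p u v = u (moebius_chart a) 0 * v (moebius_chart a) 0 +
    (1 - width p) * (u (moebius_chart a) 1 * v (moebius_chart a) 1)"
proof -
  have "p \<in> moebius_strip (moebius_index p)"
    using p moebius_strip_subset by (intro moebius_index) auto
  then obtain k :: int where k: "\<bar>angle a p + 2 * pi * of_int k - moebius_index p\<bar> < pi"
    using moebius_chart_change_exists[OF p] by auto
  have "flip_sign k * s * (flip_sign k * t) = s * t" for s t
    by (simp add: flip_sign_def)
  then show ?thesis
    unfolding moebius_metric_def Let_def moebius_tangent_change[OF uv(1) p k] moebius_tangent_change[OF uv(2) p k]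
    by simp
qed

definition moebius_vec :: "real \<Rightarrow> (nat \<Rightarrow> real) \<Rightarrow> real \<Rightarrow> real \<Rightarrow> (nat \<Rightarrow> real) tvec"
  where "moebius_vec a p s t = moebius.tvec_of (moebius_chart a) p (\<lambda>j. if j = 0 then s else t)"

lemma moebius_vec:
  assumes "p \<in> moebius_strip a"
  shows "moebius_vec a p s t \<in> tangent_space moebius_manifold p"
    "moebius_vec a p s t (moebius_chart a) 0 = s" "moebius_vec a p s t (moebius_chart a) 1 = t"
  using moebius.tvec_of_tangent[OF moebius_charts_at[OF assms]]
    moebius.tvec_of_self[OF moebius_charts_at[OF assms]]
  by (simp_all add: moebius_vec_def)

lemma moebius_tangent_eqI:
  assumes "p \<in> moebius_strip a" "v \<in> tangent_space moebius_manifold p" "w \<in> tangent_space moebius_manifold p"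
    "v (moebius_chart a) 0 = w (moebius_chart a) 0" "v (moebius_chart a) 1 = w (moebius_chart a) 1"
  shows "v = w"
proof (rule moebius.tangent_eqI[OF assms(2,3) moebius_charts_at[OF assms(1)]])
  show "v (moebius_chart a) i = w (moebius_chart a) i" if "i < dim_of moebius_manifold" for i
    using that assms(4,5) by (cases "i = 0"; cases "i = 1") auto
qed

text \<open>The form is diagonal in strip coordinates with entries \<open>1\<close> and
  \<open>1 - width p\<close>; pairing \<open>w\<close> with the two coordinate vectors isolates its
  components.\<close>

lemma moebius_Rad_iff:
  assumes p: "p \<in> moebius_strip a"
  shows "w \<in> Rad moebius_manifold moebius_metric p \<longleftrightarrow> w \<in> tangent_space moebius_manifold p \<and>
    w (moebius_chart a) 0 = 0 \<and> (1 - width p) * w (moebius_chart a) 1 = 0"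
proof
  assume w: "w \<in> Rad moebius_manifold moebius_metric p"
  have wt: "w \<in> tangent_space moebius_manifold p"
    using w by (simp add: Rad_def)
  have z: "moebius_metric p w v = 0" if "v \<in> tangent_space moebius_manifold p" for v
    using w that by (simp add: Rad_def)
  from z[OF moebius_vec(1)[OF p, of 1 0]] z[OF moebius_vec(1)[OF p, of 0 1]]
  show "w \<in> tangent_space moebius_manifold p \<and>
    w (moebius_chart a) 0 = 0 \<and> (1 - width p) * w (moebius_chart a) 1 = 0"
    using wt moebius_metric_eq[OF p wt moebius_vec(1)[OF p]] moebius_vec(2,3)[OF p] by simp
next
  assume "w \<in> tangent_space moebius_manifold p \<and>
    w (moebius_chart a) 0 = 0 \<and> (1 - width p) * w (moebius_chart a) 1 = 0"
  then show "w \<in> Rad moebius_manifold moebius_metric p"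
    using moebius_metric_eq[OF p] by (auto simp: Rad_def)
qed

lemma moebius_degenerate_iff:
  assumes "p \<in> moebius_set"
  shows "degenerate_at moebius_manifold moebius_metric p \<longleftrightarrow> width p = 1"
proof
  let ?a = "moebius_index p"
  have p: "p \<in> moebius_strip ?a"
    by (rule moebius_index[OF assms])
  have t0: "tzero \<in> Rad moebius_manifold moebius_metric p"
    unfolding moebius_Rad_iff[OF p] using moebius.tzero_tangent by (simp add: tzero_def)
  show "width p = 1" if "degenerate_at moebius_manifold moebius_metric p"
  proof (rule ccontr)
    assume "width p \<noteq> 1"
    then have "w = tzero" if "w \<in> Rad moebius_manifold moebius_metric p" for w
      using that unfolding moebius_Rad_iff[OF p]
      by (intro moebius_tangent_eqI[OF p] moebius.tzero_tangent) (auto simp: tzero_def)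
    then show False
      using \<open>degenerate_at moebius_manifold moebius_metric p\<close> t0 by (auto simp: degenerate_at_def)
  qed
  show "degenerate_at moebius_manifold moebius_metric p" if "width p = 1"
  proof -
    have "moebius_vec ?a p 0 1 \<in> Rad moebius_manifold moebius_metric p"
      unfolding moebius_Rad_iff[OF p] using moebius_vec[OF p] that by simp
    moreover have "moebius_vec ?a p 0 1 \<noteq> tzero"
      using moebius_vec(3)[OF p, of 0 1] by (auto simp: tzero_def)
    ultimately show ?thesis
      by (auto simp: degenerate_at_def)
  qed
qed

lemma moebius_degeneracy_set:
  "degeneracy_set moebius_manifold moebius_metric = {p \<in> moebius_set. width p = 1}"
  using moebius_degenerate_iff by (auto simp: degeneracy_set_def)

text \<open>This is the pullback of the diagonal form along the transition to a strip chart. It is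
  the one formula for the metric in an arbitrary chart, and both its smoothness and its determinant
  are read off from it.\<close>

lemma moebius_metric_comp:
  assumes c: "c \<in> atlas_of moebius_manifold" and x: "x \<in> overlap c (moebius_chart a)" and ij: "i < 2" "j < 2"
  shows "metric_comp moebius_manifold moebius_metric c i j x =
    partial i (transition c (moebius_chart a) 0) x * partial j (transition c (moebius_chart a) 0) x +
    (1 - transition c (moebius_chart a) 1 x * transition c (moebius_chart a) 1 x) *
      (partial i (transition c (moebius_chart a) 1) x * partial j (transition c (moebius_chart a) 1) x)"
proof -
  let ?p = "chart_inv c x" and ?d = "moebius_chart a"
  have p: "?p \<in> fst c" "?p \<in> moebius_strip a"
    using overlap_inv[OF x moebius.chart[OF c]] by (auto simp: fst_moebius_chart)
  have cp: "c \<in> charts_at moebius_manifold ?p"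
    using c p by (simp add: charts_at_def)
  note dp = moebius_charts_at[OF p(2)]
  have xx: "snd c ?p = x"
    using x overlap_iff[OF moebius.chart[OF c], of x ?d] by (intro chart_inv_right) simp
  have tan: "coord_vec moebius_manifold c ?p l \<in> tangent_space moebius_manifold ?p" if "l < 2" for l
    using moebius.coord_vec_tangent[OF cp] that by simp
  have co: "coord_vec moebius_manifold c ?p l ?d m = partial l (transition c ?d m) x" if "l < 2" "m < 2" for l m
    using moebius.coord_vec_component[OF dp, of m c l] moebius.jacobian_eq_partial[OF cp dp, of l m] that xx by simp
  have "width ?p = transition c ?d 1 x * transition c ?d 1 x"
    using width_eq[OF p(2)] by (simp add: transition_def moebius_chart_def power2_eq_square)
  then show ?thesis
    unfolding metric_comp_def Let_def moebius_metric_eq[OF p(2) tan[OF ij(1)] tan[OF ij(2)]]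
    using co ij by simp
qed

lemma moebius_metric_smooth: "smooth_symmetric_02_tensor moebius_manifold moebius_metric"
  unfolding smooth_symmetric_02_tensor_def
proof (intro conjI ballI allI impI)
  fix p u v assume "p \<in> points moebius_manifold" "u \<in> tangent_space moebius_manifold p" "v \<in> tangent_space moebius_manifold p"
  show "moebius_metric p u v = moebius_metric p v u"
    by (simp add: moebius_metric_def mult.commute)
  show "moebius_metric p (tadd (tscale s u) (tscale t v)) w = s * moebius_metric p u w + t * moebius_metric p v w"
    for s t w
    unfolding moebius_metric_def Let_def tadd_def tscale_def by (simp add: algebra_simps)
next
  fix c i j assume c: "c \<in> atlas_of moebius_manifold" and ij: "i < dim_of moebius_manifold" "j < dim_of moebius_manifold"
  have "smooth_open (dim_of moebius_manifold) (chart_image c) (metric_comp moebius_manifold moebius_metric c i j)"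
  proof (rule moebius.smooth_on_chart_imageI[OF c])
    fix p assume "p \<in> fst c"
    then have "p \<in> moebius_set"
      using openin_subset[OF moebius.openin_chart[OF c]] by auto
    then have p: "p \<in> moebius_strip (moebius_index p)"
      by (rule moebius_index)
    let ?d = "moebius_chart (moebius_index p)"
    have tr: "smooth_open 2 (overlap c ?d) (transition c ?d l)" if "l < 2" for l
      using moebius.transition_smooth[OF c moebius_chart_in_atlas] that by simp
    have pa: "smooth_open 2 (overlap c ?d) (partial m (transition c ?d l))" if "l < 2" "m < 2" for l m
      by (rule smooth_open_partial[OF tr[OF that(1)] that(2)])
    have "smooth_open 2 (overlap c ?d) (\<lambda>x. partial i (transition c ?d 0) x * partial j (transition c ?d 0) x +
        (1 - transition c ?d 1 x * transition c ?d 1 x) * (partial i (transition c ?d 1) x * partial j (transition c ?d 1) x))"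
      using ij by (intro smooth_open_add smooth_open_mult smooth_open_diff smooth_open_const tr pa
          smooth_open_openin[OF tr[of 0]]) auto
    then show "\<exists>d g. d \<in> charts_at moebius_manifold p \<and> smooth_open (dim_of moebius_manifold) (overlap c d) g \<and>
        (\<forall>x\<in>overlap c d. g x = metric_comp moebius_manifold moebius_metric c i j x)"
      using moebius_charts_at[OF p] moebius_metric_comp[OF c] ij
      by (intro exI[of _ ?d] exI[of _ "\<lambda>x. partial i (transition c ?d 0) x * partial j (transition c ?d 0) x +
        (1 - transition c ?d 1 x * transition c ?d 1 x) * (partial i (transition c ?d 1) x * partial j (transition c ?d 1) x)"]) auto
  qed
  then show "smooth_on (dim_of moebius_manifold) (chart_image c) (metric_comp moebius_manifold moebius_metric c i j)"
    by (simp add: smooth_on_open_iff[OF smooth_open_openin])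
qed

section \<open>The determinant of the metric\<close>

lemma det_mat_2: "Determinant.det (Matrix.mat 2 2 f) = f (0, 0) * f (1, 1) - f (0, 1) * f (1, 0)"
  for f :: "nat \<times> nat \<Rightarrow> real"
proof -
  have "Determinant.det (Matrix.mat 2 2 f) =
      (\<Sum>j<2. Matrix.mat 2 2 f $$ (0, j) * cofactor (Matrix.mat 2 2 f) 0 j)"
    by (rule laplace_expansion_row[where n = 2]) auto
  then show ?thesis
    by (simp add: sum_lessThan_2 cofactor_def mat_delete_def det_single)
qed

text \<open>The Gram determinant of the vectors \<open>(a, b)\<close> and \<open>(c, d)\<close> for
  the diagonal form with entries \<open>1\<close> and \<open>w\<close>: the square of their
  determinant times \<open>w\<close>.\<close>

lemma gram_det_2:
  fixes a b c d w :: real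
  shows "(a * a + w * (b * b)) * (c * c + w * (d * d)) - (a * c + w * (b * d)) * (c * a + w * (d * b)) =
    (a * d - c * b) * (a * d - c * b) * w"
  by (simp add: algebra_simps)

text \<open>Let \<open>D\<close> be the Jacobian determinant of the transition to a strip chart and
  \<open>Y = T 1\<close> its second component. The metric determinant is
  \<open>D^2 * (1 - Y^2)\<close>. Where \<open>Y^2 = 1\<close>, its differential is
  \<open>- 2 * D^2 * Y * dY\<close>, and none of the factors \<open>D\<close>, \<open>Y\<close>,
  \<open>dY\<close> vanishes.\<close>

lemma moebius_metric_det_differential:
  assumes q: "q \<in> degeneracy_set moebius_manifold moebius_metric" and c: "c \<in> charts_at moebius_manifold q"
  shows "\<exists>i<2. partial_within (chart_image c) i (metric_det moebius_manifold moebius_metric c) (snd c q) \<noteq> 0"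
proof -
  define d where "d = moebius_chart (moebius_index q)"
  define x where "x = snd c q"
  define T where "T l = transition c d l" for l
  define D where "D y = partial 0 (T 0) y * partial 1 (T 1) y - partial 1 (T 0) y * partial 0 (T 1) y" for y
  have qs: "q \<in> moebius_set" "width q = 1"
    using q by (simp_all add: moebius_degeneracy_set)
  have qd: "q \<in> moebius_strip (moebius_index q)"
    by (rule moebius_index[OF qs(1)])
  have d: "d \<in> charts_at moebius_manifold q"
    unfolding d_def by (rule moebius_charts_at[OF qd])
  have at: "c \<in> atlas_of moebius_manifold" "q \<in> fst c" "d \<in> atlas_of moebius_manifold" "q \<in> fst d"
    using c d by (simp_all add: charts_at_def)
  have x: "x \<in> overlap c d" "x \<in> chart_image c"
    using at by (simp_all add: x_def overlap_def chart_image_def)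
  have T: "smooth_open 2 (overlap c d) (T l)" if "l < 2" for l
    using moebius.transition_smooth[OF at(1,3)] that by (simp add: T_def)
  have PT: "smooth_open 2 (overlap c d) (partial m (T l))" if "l < 2" "m < 2" for l m
    by (rule smooth_open_partial[OF T[OF that(1)] that(2)])
  have op: "openin (Euclidean_space 2) (overlap c d)"
    by (rule smooth_open_openin[OF T[of 0]]) simp
  have D: "smooth_open 2 (overlap c d) D"
    unfolding D_def by (intro smooth_open_diff smooth_open_mult PT) simp_all
  have det: "metric_det moebius_manifold moebius_metric c y = D y * D y * (1 - T 1 y * T 1 y)"
    if "y \<in> overlap c d" for y
  proof -
    have comp: "metric_comp moebius_manifold moebius_metric c i j y =
        partial i (T 0) y * partial j (T 0) y + (1 - T 1 y * T 1 y) * (partial i (T 1) y * partial j (T 1) y)"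
      if "i < 2" "j < 2" for i j
      unfolding T_def d_def by (rule moebius_metric_comp[OF at(1) \<open>y \<in> overlap c d\<close>[unfolded d_def] that])
    have two: "0 < (2::nat)" and two': "1 < (2::nat)"
      by simp_all
    have "metric_det moebius_manifold moebius_metric c y =
        metric_comp moebius_manifold moebius_metric c 0 0 y * metric_comp moebius_manifold moebius_metric c 1 1 y -
        metric_comp moebius_manifold moebius_metric c 0 1 y * metric_comp moebius_manifold moebius_metric c 1 0 y"
      by (simp add: metric_det_def det_mat_2)
    also have "\<dots> = D y * D y * (1 - T 1 y * T 1 y)"
      unfolding comp[OF two two] comp[OF two two'] comp[OF two' two] comp[OF two' two'] D_def by (rule gram_det_2)
    finally show ?thesis .
  qed
  have "transition c d 1 x = height (moebius_index q) q"
    using chart_inv_left[OF moebius.chart[OF at(1)] at(2)]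
    by (simp add: transition_def x_def) (simp add: d_def moebius_chart_def)
  then have Y: "T 1 x * T 1 x = 1"
    using width_eq[OF qd] qs(2) by (simp add: T_def power2_eq_square)
  have jac: "jacobian c d q l m = partial m (T l) x" if "m < 2" for l m
    using moebius.jacobian_eq_partial[OF c d] that by (simp add: T_def x_def)
  \<comment> \<open>The Jacobian matrices of the two opposite transitions are inverse to each
    other.\<close>
  have inv: "jacobian d c q i 0 * partial m (T 0) x + jacobian d c q i 1 * partial m (T 1) x = (if i = m then 1 else 0)"
    if "i < 2" "m < 2" for i m
    using moebius.jacobian_comp[OF c d c, of i m] moebius.jacobian_self[OF c, of i m] that
    by (simp add: sum_lessThan_2 jac)
  have D0: "D x \<noteq> 0"
  proof
    assume "D x = 0"
    \<comment> \<open>Multiplicativity of the determinant, written out for two-by-two matrices: the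
      two determinants have product 1, so \<open>D x\<close> cannot be 0.\<close>
    then have "(jacobian d c q 0 0 * jacobian d c q 1 1 - jacobian d c q 0 1 * jacobian d c q 1 0) * D x = 0"
      by simp
    also have "(jacobian d c q 0 0 * jacobian d c q 1 1 - jacobian d c q 0 1 * jacobian d c q 1 0) * D x =
      (jacobian d c q 0 0 * partial 0 (T 0) x + jacobian d c q 0 1 * partial 0 (T 1) x) *
      (jacobian d c q 1 0 * partial 1 (T 0) x + jacobian d c q 1 1 * partial 1 (T 1) x) -
      (jacobian d c q 0 0 * partial 1 (T 0) x + jacobian d c q 0 1 * partial 1 (T 1) x) *
      (jacobian d c q 1 0 * partial 0 (T 0) x + jacobian d c q 1 1 * partial 0 (T 1) x)"
      by (simp only: D_def algebra_simps)
    also have "\<dots> = 1"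
      using inv[of 0 0] inv[of 1 1] inv[of 0 1] by simp
    finally show False
      by simp
  qed
  \<comment> \<open>If both derivatives of \<open>T 1\<close> vanished, a row of the Jacobian and
    with it \<open>D x\<close> would vanish.\<close>
  obtain i where i: "i < 2" "partial i (T 1) x \<noteq> 0"
  proof (cases "partial 0 (T 1) x = 0")
    case True
    then have "partial 1 (T 1) x \<noteq> 0"
      using D0 by (auto simp: D_def)
    then show ?thesis
      using that[of 1] by simp
  next
    case False
    then show ?thesis
      using that[of 0] by simp
  qed
  define E where "E y = D y * D y" for y
  have "smooth_open 2 (overlap c d) E"
    unfolding E_def by (intro smooth_open_mult D)
  then have "has_partial E i (partial i E x) x"
    by (rule smooth_open_has_partial[OF _ x(1) i(1)])
  moreover have "has_partial (T 1) i (partial i (T 1) x) x"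
    by (rule smooth_open_has_partial[OF T x(1) i(1)]) simp
  ultimately have "has_partial (\<lambda>y. E y * (1 - T 1 y * T 1 y)) i
      (partial i E x * (1 - T 1 x * T 1 x) + E x * (- (2 * T 1 x * partial i (T 1) x))) x"
    by (auto intro!: derivative_eq_intros simp: algebra_simps)
  \<comment> \<open>At \<open>x\<close> the derivative of \<open>E\<close> has the coefficient
    \<open>1 - T 1 x * T 1 x = 0\<close>.\<close>
  then have "has_partial (\<lambda>y. E y * (1 - T 1 y * T 1 y)) i (E x * (- (2 * T 1 x * partial i (T 1) x))) x"
    by (simp add: Y[simplified])
  then have "has_partial (metric_det moebius_manifold moebius_metric c) i (E x * (- (2 * T 1 x * partial i (T 1) x))) x"
    by (rule has_partial_cong[OF op x(1) i(1), THEN iffD2, rotated]) (simp add: det E_def)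
  then have "partial i (metric_det moebius_manifold moebius_metric c) x = E x * (- (2 * T 1 x * partial i (T 1) x))"
    by (rule partialI)
  moreover have "T 1 x \<noteq> 0"
    using Y by auto
  ultimately have "partial i (metric_det moebius_manifold moebius_metric c) x \<noteq> 0"
    using D0 i(2) by (simp add: E_def)
  moreover have "partial_within (chart_image c) i (metric_det moebius_manifold moebius_metric c) x =
      partial i (metric_det moebius_manifold moebius_metric c) x"
    using moebius.openin_image[OF at(1)] by (intro partial_within_eq_partial[OF _ x(2) i(1)]) simp
  ultimately show ?thesis
    using i(1) unfolding x_def by (intro exI[of _ i]) simp
qed

section \<open>Connected components of the regular set\<close>

lemma connected_components_of_two:
  assumes "connectedin X A" "connectedin X B" "openin X A" "openin X B" "A \<noteq> {}" "B \<noteq> {}"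
    "A \<inter> B = {}" "topspace X = A \<union> B"
  shows "connected_components_of X = {A, B}"
proof -
  have *: "connected_component_of_set X x = A"
    if AB: "connectedin X A" "openin X A" "openin X B" "A \<inter> B = {}" "topspace X = A \<union> B" "x \<in> A" for A B x
  proof
    show "A \<subseteq> connected_component_of_set X x"
      by (rule connected_component_of_maximal[OF AB(1,6)])
    let ?C = "connected_component_of_set X x"
    have C: "connectedin X ?C"
      by (rule connectedin_connected_component_of)
    have sub: "?C \<subseteq> A \<union> B"
      using connectedin_subset_topspace[OF C] AB(5) by simp
    have "x \<in> ?C"
      using AB(5,6) by (simp add: connected_component_of_refl)
    \<comment> \<open>A connected set covered by two disjoint open sets cannot meet both of
      them.\<close>
    moreover have "\<not> (A \<inter> ?C \<noteq> {} \<and> B \<inter> ?C \<noteq> {})"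
      using C AB(2,3,4) sub unfolding connectedin by (metis Int_empty_left)
    ultimately show "?C \<subseteq> A"
      using sub AB(6) by blast
  qed
  have 1: "connected_component_of_set X x = A" if "x \<in> A" for x
    using assms that by (intro *[of A B]) auto
  have 2: "connected_component_of_set X x = B" if "x \<in> B" for x
    using assms that by (intro *[of B A]) auto
  have "connected_components_of X = connected_component_of_set X ` (A \<union> B)"
    by (simp add: connected_components_of_def assms(8))
  also have "\<dots> = connected_component_of_set X ` A \<union> connected_component_of_set X ` B"
    by (rule image_Un)
  also have "connected_component_of_set X ` A = {A}"
    using 1 assms(5) by auto
  also have "connected_component_of_set X ` B = {B}"
    using 2 assms(6) by auto
  finally show ?thesis
    by auto
qed

definition moebius_inner :: "(nat \<Rightarrow> real) set"
  where "moebius_inner = {p \<in> moebius_set. width p < 1}"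

definition moebius_outer :: "(nat \<Rightarrow> real) set"
  where "moebius_outer = {p \<in> moebius_set. width p > 1}"

text \<open>The image of a product of connected sets: this form is what yields connectedness of the
  inner part.\<close>

lemma moebius_inner_eq: "moebius_inner = (\<lambda>z. moebius_pt (fst z) (snd z)) ` (UNIV \<times> {- 1 <..< 1})"
proof (intro equalityI subsetI)
  fix p assume "p \<in> moebius_inner"
  then obtain x y where "p = moebius_pt x y" "y\<^sup>2 < 1"
    by (auto simp: moebius_inner_def moebius_set_def width_moebius)
  then show "p \<in> (\<lambda>z. moebius_pt (fst z) (snd z)) ` (UNIV \<times> {- 1 <..< 1})"
    by (intro image_eqI[of _ _ "(x, y)"]) (auto simp: abs_square_less_1 abs_less_iff)
next
  fix p assume "p \<in> (\<lambda>z. moebius_pt (fst z) (snd z)) ` (UNIV \<times> {- 1 <..< 1})"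
  then show "p \<in> moebius_inner"
    by (auto simp: moebius_inner_def moebius_in_set width_moebius abs_square_less_1)
qed

text \<open>Going once around the core circle exchanges \<open>y > 1\<close> and \<open>y < -1\<close>; this is why the outer part is
  connected.\<close>

lemma moebius_outer_eq: "moebius_outer = (\<lambda>z. moebius_pt (fst z) (snd z)) ` (UNIV \<times> {1 <..})"
proof (intro equalityI subsetI)
  fix p assume "p \<in> moebius_outer"
  then obtain x y where p: "p = moebius_pt x y" "1 < y\<^sup>2"
    by (auto simp: moebius_outer_def moebius_set_def width_moebius)
  have neg: "p = moebius_pt (x + 2 * pi) (- y)"
    using moebius_periodic[of x 1 y] p(1) by (simp add: flip_sign_def)
  have "1 < \<bar>y\<bar>"
    using p(2) abs_square_le_1[of y] by linarith
  then consider "1 < y" | "1 < - y"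
    by linarith
  then show "p \<in> (\<lambda>z. moebius_pt (fst z) (snd z)) ` (UNIV \<times> {1 <..})"
  proof cases
    case 1
    then show ?thesis
      using p(1) by (intro image_eqI[of _ _ "(x, y)"]) auto
  next
    case 2
    then show ?thesis
      using neg by (intro image_eqI[of _ _ "(x + 2 * pi, - y)"]) auto
  qed
next
  fix p assume "p \<in> (\<lambda>z. moebius_pt (fst z) (snd z)) ` (UNIV \<times> {1 <..})"
  then show "p \<in> moebius_outer"
    by (auto simp: moebius_outer_def moebius_in_set width_moebius one_less_power)
qed

lemma connected_moebius_image:
  assumes "connected S"
  shows "connected ((\<lambda>z. moebius_pt (fst z) (snd z)) ` (UNIV \<times> S))"
  using assms by (intro connected_continuous_image continuous_on_moebius_pt continuous_intros connected_Times) auto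

text \<open>The continuous function \<open>width\<close> avoids the value 1 here, which splits the
  regular set into two open parts; each is connected as the image of a product of intervals.\<close>

lemma moebius_regular_components:
  "regular_components moebius_manifold moebius_metric = {moebius_inner, moebius_outer}"
proof -
  define N where "N = {p \<in> moebius_set. width p \<noteq> 1}"
  have sub: "subtopology (top_of moebius_manifold) (points moebius_manifold - degeneracy_set moebius_manifold moebius_metric) = top_of_set N"
  proof -
    have "points moebius_manifold - degeneracy_set moebius_manifold moebius_metric = N"
      by (auto simp: moebius_degeneracy_set N_def)
    moreover have "moebius_set \<inter> N = N"
      by (auto simp: N_def)
    ultimately show ?thesis
      by (simp add: subtopology_subtopology)
  qed
  have inner: "moebius_inner = N \<inter> width -` {..<1}" and outer: "moebius_outer = N \<inter> width -` {1<..}"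
    by (auto simp: moebius_inner_def moebius_outer_def N_def)
  have "connected_components_of (top_of_set N) = {moebius_inner, moebius_outer}"
  proof (rule connected_components_of_two)
    show "openin (top_of_set N) moebius_inner" "openin (top_of_set N) moebius_outer"
      unfolding inner outer by (auto intro!: continuous_openin_preimage_gen continuous_on_width)
    show "connectedin (top_of_set N) moebius_inner" "connectedin (top_of_set N) moebius_outer"
      unfolding connectedin_subtopology
      using connected_moebius_image[of "{- 1 <..< 1}"] connected_moebius_image[of "{1 <..}"]
      by (simp_all add: moebius_inner_eq[symmetric] moebius_outer_eq[symmetric]) (simp_all add: inner outer)
    show "moebius_inner \<noteq> {}" "moebius_outer \<noteq> {}"
      by (auto simp: moebius_inner_eq moebius_outer_eq intro: gt_ex)
    show "moebius_inner \<inter> moebius_outer = {}" "topspace (top_of_set N) = moebius_inner \<union> moebius_outer"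
      by (auto simp: moebius_inner_def moebius_outer_def N_def)
  qed
  then show ?thesis
    unfolding regular_components_def sub .
qed

section \<open>Signature on the two components\<close>

lemma moebius_riemannian:
  assumes "p \<in> moebius_inner"
  shows "riemannian_at moebius_manifold moebius_metric p"
  unfolding riemannian_at_def
proof (intro ballI impI)
  have w: "width p < 1" and p: "p \<in> moebius_strip (moebius_index p)"
    using assms moebius_index by (auto simp: moebius_inner_def)
  fix v assume v: "v \<in> tangent_space moebius_manifold p" "v \<noteq> tzero"
  let ?c = "moebius_chart (moebius_index p)"
  have "v ?c 0 \<noteq> 0 \<or> v ?c 1 \<noteq> 0"
    using moebius_tangent_eqI[OF p v(1) moebius.tzero_tangent] v(2) by (auto simp: tzero_def)
  then have "v ?c 0 * v ?c 0 + (1 - width p) * (v ?c 1 * v ?c 1) > 0"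
  proof
    assume "v ?c 0 \<noteq> 0"
    then have "0 < v ?c 0 * v ?c 0"
      by (metis not_real_square_gt_zero)
    moreover have "0 \<le> (1 - width p) * (v ?c 1 * v ?c 1)"
      using w by simp
    ultimately show ?thesis
      by (rule add_pos_nonneg)
  next
    assume "v ?c 1 \<noteq> 0"
    then have "0 < v ?c 1 * v ?c 1"
      by (metis not_real_square_gt_zero)
    then have "0 < (1 - width p) * (v ?c 1 * v ?c 1)"
      using w by (intro mult_pos_pos[of "1 - width p"]) simp_all
    moreover have "0 \<le> v ?c 0 * v ?c 0"
      by simp
    ultimately show ?thesis
      by (rule add_nonneg_pos[rotated])
  qed
  then show "moebius_metric p v v > 0"
    by (simp add: moebius_metric_def Let_def)
qed

lemma moebius_lorentzian:
  assumes "p \<in> moebius_outer"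
  shows "lorentzian_at moebius_manifold moebius_metric p"
proof -
  have w: "width p > 1" and p: "p \<in> moebius_strip (moebius_index p)"
    using assms moebius_index by (auto simp: moebius_outer_def)
  \<comment> \<open>The field \<open>d/dy\<close> has square \<open>1 - width p\<close>, which is
    negative here; dividing it by \<open>sqrt (width p - 1)\<close> normalises the square to
    \<open>- 1\<close>.\<close>
  define e where "e i = (if i = 0 then moebius_vec (moebius_index p) p 0 (1 / sqrt (width p - 1))
    else moebius_vec (moebius_index p) p 1 0)" for i :: nat
  have "1 / sqrt (width p - 1) * (1 / sqrt (width p - 1)) = 1 / (width p - 1)"
    using w by simp
  then have n: "(1 - width p) * (1 / sqrt (width p - 1) * (1 / sqrt (width p - 1))) = - 1"
    using w by (simp add: field_simps)
  have "e i \<in> tangent_space moebius_manifold p" for i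
    using moebius_vec(1)[OF p] by (simp add: e_def)
  moreover have "moebius_metric p (e i) (e j) = (if i = j then if i = 0 then - 1 else 1 else 0)"
    if "i < 2" "j < 2" for i j
    using that n moebius_metric_eq[OF p moebius_vec(1)[OF p] moebius_vec(1)[OF p]]
    by (cases "i = 0"; cases "j = 0") (simp_all add: e_def moebius_vec(2,3)[OF p, simplified] less_2_cases_iff)
  ultimately show ?thesis
    unfolding lorentzian_at_def by (intro exI[of _ e]) simp
qed

text \<open>\<open>lorentzian_region\<close> selects components by \<open>lorentzian_at\<close>, so
  the Riemannian component has to be excluded explicitly.\<close>

lemma moebius_not_lorentzian:
  assumes "p \<in> moebius_inner"
  shows "\<not> lorentzian_at moebius_manifold moebius_metric p"
proof
  assume "lorentzian_at moebius_manifold moebius_metric p"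
  then obtain e :: "nat \<Rightarrow> (nat \<Rightarrow> real) tvec" where "\<forall>i<2. e i \<in> tangent_space moebius_manifold p"
    "\<forall>i<2. \<forall>j<2. moebius_metric p (e i) (e j) = (if i = j then if i = 0 then - 1 else 1 else 0)"
    unfolding lorentzian_at_def by auto
  then have e: "e 0 \<in> tangent_space moebius_manifold p" "moebius_metric p (e 0) (e 0) = - 1"
    by simp_all
  have "e 0 \<noteq> tzero"
    using e(2) by (auto simp: moebius_metric_def Let_def tzero_def)
  then show False
    using moebius_riemannian[OF assms] e by (auto simp: riemannian_at_def)
qed

lemma moebius_lorentzian_region: "lorentzian_region moebius_manifold moebius_metric = moebius_outer"
proof -
  have "moebius_pt 0 0 \<in> moebius_inner"
    by (simp add: moebius_inner_def moebius_in_set width_moebius)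
  then have "\<not> (\<forall>p\<in>moebius_inner. lorentzian_at moebius_manifold moebius_metric p)"
    using moebius_not_lorentzian by auto
  then have "{C \<in> {moebius_inner, moebius_outer}. \<forall>p\<in>C. lorentzian_at moebius_manifold moebius_metric p} = {moebius_outer}"
    using moebius_lorentzian by auto
  then show ?thesis
    by (simp add: lorentzian_region_def moebius_regular_components)
qed

text \<open>The fibre curve \<open>moebius_pt x (t * y)\<close> passes through \<open>q\<close> at
  \<open>t = 1\<close>, and its width is \<open>t^2\<close> because \<open>y^2 = 1\<close>. Values
  of \<open>t\<close> slightly below 1 give inner points, values slightly above 1 give outer
  points.\<close>

lemma moebius_closure:
  assumes q: "q \<in> degeneracy_set moebius_manifold moebius_metric"
  shows "q \<in> moebius_top closure_of moebius_inner" "q \<in> moebius_top closure_of moebius_outer"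
proof -
  obtain x y where q_eq: "q = moebius_pt x y" and y: "y\<^sup>2 = 1"
    using q by (auto simp: moebius_degeneracy_set moebius_set_def width_moebius)
  have near: "\<exists>\<epsilon>>0. \<forall>t. \<bar>t - 1\<bar> < \<epsilon> \<longrightarrow> moebius_pt x (t * y) \<in> T" if T: "q \<in> T" "openin moebius_top T" for T
  proof -
    obtain O' where O': "open O'" "T = moebius_set \<inter> O'"
      using T(2) by (auto simp: openin_open)
    have "continuous_on UNIV (\<lambda>t. moebius_pt x (t * y))"
      by (intro continuous_on_moebius_pt continuous_intros)
    then have "open ((\<lambda>t. moebius_pt x (t * y)) -` O')"
      using O'(1) by (intro open_vimage)
    moreover have "1 \<in> (\<lambda>t. moebius_pt x (t * y)) -` O'"
      using T(1) O'(2) q_eq by simp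
    ultimately obtain \<epsilon> where "\<epsilon> > 0" "\<forall>t. dist t 1 < \<epsilon> \<longrightarrow> t \<in> (\<lambda>t. moebius_pt x (t * y)) -` O'"
      unfolding open_dist by metis
    then show ?thesis
      using O'(2) moebius_in_set by (intro exI[of _ \<epsilon>]) (auto simp: dist_real_def)
  qed
  have q_top: "q \<in> topspace moebius_top"
    using q_eq moebius_in_set by simp
  have "\<exists>p\<in>moebius_inner. p \<in> T" if T: "q \<in> T" "openin moebius_top T" for T
  proof -
    obtain \<epsilon> where e: "\<epsilon> > 0" "\<forall>t. \<bar>t - 1\<bar> < \<epsilon> \<longrightarrow> moebius_pt x (t * y) \<in> T"
      using near[OF T] by auto
    \<comment> \<open>The minimum with 1 keeps \<open>t\<close> positive, so that
      \<open>t < 1\<close> implies \<open>t^2 < 1\<close> even when \<open>\<epsilon>\<close> is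
      large.\<close>
    define t where "t = 1 - min \<epsilon> 1 / 2"
    have t: "0 < t" "t < 1" "\<bar>t - 1\<bar> < \<epsilon>"
      using e(1) by (auto simp: t_def)
    then have "moebius_pt x (t * y) \<in> moebius_inner"
      using y by (simp add: moebius_inner_def moebius_in_set width_moebius power_mult_distrib abs_square_less_1)
    then show ?thesis
      using e(2) t(3) by auto
  qed
  then show "q \<in> moebius_top closure_of moebius_inner"
    using q_top by (auto simp: in_closure_of)
  have "\<exists>p\<in>moebius_outer. p \<in> T" if T: "q \<in> T" "openin moebius_top T" for T
  proof -
    obtain \<epsilon> where e: "\<epsilon> > 0" "\<forall>t. \<bar>t - 1\<bar> < \<epsilon> \<longrightarrow> moebius_pt x (t * y) \<in> T"
      using near[OF T] by auto
    define t where "t = 1 + \<epsilon> / 2"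
    have t: "1 < t" "\<bar>t - 1\<bar> < \<epsilon>"
      using e(1) by (auto simp: t_def)
    then have "moebius_pt x (t * y) \<in> moebius_outer"
      using y by (simp add: moebius_outer_def moebius_in_set width_moebius power_mult_distrib one_less_power)
    then show ?thesis
      using e(2) t(2) by auto
  qed
  then show "q \<in> moebius_top closure_of moebius_outer"
    using q_top by (auto simp: in_closure_of)
qed

lemma moebius_signature_changing: "transverse_signature_changing moebius_manifold moebius_metric"
  unfolding transverse_signature_changing_def
proof (intro conjI)
  have ne: "moebius_inner \<noteq> moebius_outer"
  proof
    assume eq: "moebius_inner = moebius_outer"
    have "moebius_pt 0 0 \<in> moebius_inner"
      by (simp add: moebius_inner_def moebius_in_set width_moebius)
    then have "moebius_pt 0 0 \<in> moebius_outer"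
      unfolding eq .
    then show False
      by (simp add: moebius_outer_def width_moebius)
  qed
  show "smooth_manifold moebius_manifold"
    by (rule moebius.smooth_manifold)
  show "2 \<le> dim_of moebius_manifold"
    by simp
  show "smooth_symmetric_02_tensor moebius_manifold moebius_metric"
    by (rule moebius_metric_smooth)
  have "moebius_pt 0 1 \<in> degeneracy_set moebius_manifold moebius_metric"
    by (simp add: moebius_degeneracy_set moebius_in_set width_moebius)
  then show "degeneracy_set moebius_manifold moebius_metric \<noteq> {}"
    by auto
  show "\<forall>q\<in>degeneracy_set moebius_manifold moebius_metric. \<forall>c\<in>charts_at moebius_manifold q. \<exists>i<dim_of moebius_manifold.
      partial_within (chart_image c) i (metric_det moebius_manifold moebius_metric c) (snd c q) \<noteq> 0"
    using moebius_metric_det_differential by simp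
  have "regular_components moebius_manifold moebius_metric - {moebius_inner} = {moebius_outer}"
    using ne by (auto simp: moebius_regular_components)
  then show "\<exists>R\<in>regular_components moebius_manifold moebius_metric.
       (\<forall>p\<in>R. riemannian_at moebius_manifold moebius_metric p) \<and>
       (\<forall>C\<in>regular_components moebius_manifold moebius_metric - {R}. \<forall>p\<in>C. lorentzian_at moebius_manifold moebius_metric p) \<and>
       (\<forall>q\<in>degeneracy_set moebius_manifold moebius_metric.
          q \<in> top_of moebius_manifold closure_of R \<and>
          q \<in> top_of moebius_manifold closure_of (\<Union>(regular_components moebius_manifold moebius_metric - {R})))"
    using moebius_riemannian moebius_lorentzian moebius_closure
    by (intro bexI[of _ moebius_inner]) (simp_all add: moebius_regular_components)
qed

section \<open>Transversality and orientations\<close>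

lemma moebius_horizontal_curve: "smooth_curve moebius_manifold UNIV (\<lambda>t. moebius_pt (x + s * t) y)"
  unfolding smooth_curve_def
proof (intro conjI ballI allI impI)
  let ?\<gamma> = "\<lambda>t. moebius_pt (x + s * t) y"
  have "continuous_on UNIV ?\<gamma>"
    by (intro continuous_on_moebius_pt continuous_intros)
  then show "continuous_map (top_of_set UNIV) (top_of moebius_manifold) ?\<gamma>"
    using moebius_in_set by (auto simp: continuous_map_in_subtopology)
  fix c i assume c: "c \<in> atlas_of moebius_manifold" and i: "i < dim_of moebius_manifold"
  define S where "S = {z \<in> topspace (Euclidean_space 1). z 0 \<in> UNIV \<and> ?\<gamma> (z 0) \<in> fst c}"
  have cont: "continuous_on (topspace (Euclidean_space 1)) (\<lambda>z. ?\<gamma> (z 0))"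
    by (intro continuous_on_moebius_pt continuous_intros continuous_on_coord)
  obtain O' where O': "open O'" "fst c = moebius_set \<inter> O'"
    using moebius.openin_chart[OF c] by (auto simp: openin_open)
  have "openin (top_of_set (topspace (Euclidean_space 1)))
      (topspace (Euclidean_space 1) \<inter> (\<lambda>z. ?\<gamma> (z 0)) -` O')"
    by (rule continuous_openin_preimage_gen[OF cont O'(1)])
  moreover have "topspace (Euclidean_space 1) \<inter> (\<lambda>z. ?\<gamma> (z 0)) -` O' = S"
    using moebius_in_set by (auto simp: S_def O'(2))
  ultimately have S: "openin (Euclidean_space 1) S"
    using Euclidean_space_eq_top_of_set[of 1] by simp
  have "smooth_open 1 S (\<lambda>z. snd c (?\<gamma> (z 0)) i)"
  proof (rule smooth_open_local[OF S])
    fix z assume z: "z \<in> S"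
    \<comment> \<open>The curve may run around the whole band and leave any single strip; the chart
      is therefore centred at the angle of the parameter under consideration.\<close>
    define a where "a = x + s * z 0"
    let ?d = "moebius_chart a"
    \<comment> \<open>The coordinate expression of the curve in \<open>?d\<close>, an affine line.
      Composing it with the transition from \<open>?d\<close> to \<open>c\<close> gives the
      expression in the arbitrary chart \<open>c\<close>.\<close>
    define h where "h u = (\<lambda>j::nat. if j = 0 then x + s * u 0 else if j = 1 then y else (0::real))" for u :: "nat \<Rightarrow> real"
    define U where "U = {u \<in> S. x + s * u 0 \<in> {a - pi <..< a + pi}}"
    have U: "openin (Euclidean_space 1) U"
      unfolding U_def by (intro openin_Euclidean_level[OF S] continuous_intros continuous_on_coord)
    have h: "h u \<in> chart_image ?d" "chart_inv ?d (h u) = ?\<gamma> (u 0)" if "u \<in> U" for u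
    proof -
      show "h u \<in> chart_image ?d"
        using that by (auto simp: U_def moebius_chart_image h_def topspace_Euclidean_space)
      then show "chart_inv ?d (h u) = ?\<gamma> (u 0)"
        by (simp add: moebius_chart_inv h_def)
    qed
    have tr: "smooth_open 2 (overlap ?d c) (transition ?d c i)"
      using moebius.transition_smooth[OF moebius_chart_in_atlas c i] by simp
    have "smooth_open 1 U (\<lambda>u. transition ?d c i (h u))"
    proof (rule smooth_open_compose[OF U _ _ tr])
      fix j :: nat assume "j < 2"
      show "smooth_open 1 U (\<lambda>u. h u j)"
      proof (cases "j = 0")
        case True
        have "smooth_open 1 U (\<lambda>u. x + s * u 0)"
          by (intro smooth_open_add smooth_open_mult smooth_open_const smooth_open_coord U)
        then show ?thesis
          by (simp add: True h_def)
      next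
        case False
        then have "j = 1"
          using \<open>j < 2\<close> by simp
        then show ?thesis
          using smooth_open_const[OF U, of y] by (simp add: h_def)
      qed
    next
      show "h u \<in> overlap ?d c" if "u \<in> U" for u
        using h[OF that] that by (simp add: overlap_iff[OF is_chart_moebius_chart] U_def S_def)
    qed
    then have "smooth_open 1 U (\<lambda>u. snd c (?\<gamma> (u 0)) i)"
      by (rule smooth_open_cong) (simp add: transition_def h)
    moreover have "z \<in> U" "U \<subseteq> S"
      using z by (auto simp: U_def a_def)
    ultimately show "\<exists>U. z \<in> U \<and> U \<subseteq> S \<and> smooth_open 1 U (\<lambda>u. snd c (?\<gamma> (u 0)) i)"
      by auto
  qed
  then show "smooth_on 1 {z \<in> topspace (Euclidean_space 1). z 0 \<in> UNIV \<and> ?\<gamma> (z 0) \<in> fst c} (\<lambda>z. snd c (?\<gamma> (z 0)) i)"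
    unfolding S_def[symmetric] smooth_on_open_iff[OF S] .
qed (auto simp: is_interval_def)

text \<open>The curve of constant height with angular speed \<open>s\<close> stays in the degeneracy
  set, as its width is constant, and has this vector as its velocity.\<close>

lemma moebius_horizontal_tangent:
  assumes q: "q \<in> degeneracy_set moebius_manifold moebius_metric" and a: "q \<in> moebius_strip a"
  shows "moebius_vec a q s 0 \<in> tangent_to moebius_manifold (degeneracy_set moebius_manifold moebius_metric) q"
proof -
  define \<gamma> where "\<gamma> t = moebius_pt (angle a q + s * t) (height a q)" for t
  have sm: "smooth_curve moebius_manifold UNIV \<gamma>"
    unfolding \<gamma>_def by (rule moebius_horizontal_curve)
  have \<gamma>0: "\<gamma> 0 = q"
    using moebius_angle_height[OF a] by (simp add: \<gamma>_def)
  have "width q = 1"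
    using q by (simp add: moebius_degeneracy_set)
  then have \<gamma>H: "\<gamma> ` UNIV \<subseteq> degeneracy_set moebius_manifold moebius_metric"
    using width_eq[OF a] by (auto simp: moebius_degeneracy_set \<gamma>_def moebius_in_set width_moebius)
  have at: "moebius_chart a \<in> charts_at moebius_manifold (\<gamma> 0)"
    unfolding \<gamma>0 by (rule moebius_charts_at[OF a])
  \<comment> \<open>The times at which the angle has not left the window of \<open>a\<close>; for
    these \<open>angle a\<close> along the curve is the affine function.\<close>
  define T where "T = {t. angle a q + s * t \<in> {a - pi <..< a + pi}}"
  have "open T"
    unfolding T_def by (intro open_Collect_conj open_Collect_less continuous_intros
        | simp only: greaterThanLessThan_iff)+
  have "0 \<in> T"
    using angle_bound[OF a] by (auto simp: T_def abs_less_iff)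
  have T: "angle a (\<gamma> t) = angle a q + s * t" "height a (\<gamma> t) = height a q" if "t \<in> T" for t
    using that by (auto simp: T_def \<gamma>_def intro!: angle_moebius height_moebius)
  have "velocity moebius_manifold UNIV \<gamma> (moebius_chart a) 0 = s"
  proof (rule moebius.velocity_eqI[OF sm at])
    have "((\<lambda>t. angle a q + s * t) has_real_derivative s) (at 0)"
      by (auto intro!: derivative_eq_intros)
    then have "((\<lambda>t. angle a (\<gamma> t)) has_real_derivative s) (at 0)"
      by (rule has_field_derivative_transform_within_open[OF _ \<open>open T\<close> \<open>0 \<in> T\<close>]) (simp add: T)
    then show "((\<lambda>t. snd (moebius_chart a) (\<gamma> t) 0) has_real_derivative s) (at 0)"
      by (simp add: moebius_chart_def)
  qed simp
  moreover have "velocity moebius_manifold UNIV \<gamma> (moebius_chart a) 1 = 0"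
  proof (rule moebius.velocity_eqI[OF sm at])
    have "((\<lambda>t. height a q) has_real_derivative 0) (at 0)"
      by simp
    then have "((\<lambda>t. height a (\<gamma> t)) has_real_derivative 0) (at 0)"
      by (rule has_field_derivative_transform_within_open[OF _ \<open>open T\<close> \<open>0 \<in> T\<close>]) (simp add: T)
    then show "((\<lambda>t. snd (moebius_chart a) (\<gamma> t) 1) has_real_derivative 0) (at 0)"
      by (simp add: moebius_chart_def)
  qed simp
  moreover have "velocity moebius_manifold UNIV \<gamma> \<in> tangent_space moebius_manifold q"
    using moebius.velocity_tangent[OF sm] by (simp add: \<gamma>0)
  ultimately have "moebius_vec a q s 0 = velocity moebius_manifold UNIV \<gamma>"
    using moebius_vec[OF a] by (intro moebius_tangent_eqI[OF a]) simp_all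
  then show ?thesis
    using sm \<gamma>H \<gamma>0 unfolding tangent_to_def by (intro CollectI exI[of _ UNIV] exI[of _ \<gamma>]) simp
qed

text \<open>Along a curve in the degeneracy set the square of the height is constantly 1.
  Differentiating gives \<open>2 * height a q * v = 0\<close>, and \<open>height a q\<close> is
  nonzero. The derivative is within the parameter domain, so endpoints are covered.\<close>

lemma moebius_tangent_to_horizontal:
  assumes h: "h \<in> tangent_to moebius_manifold (degeneracy_set moebius_manifold moebius_metric) q"
    and a: "q \<in> moebius_strip a"
  shows "h \<in> tangent_space moebius_manifold q" "h (moebius_chart a) 1 = 0"
proof -
  obtain I \<gamma> where h_eq: "h = velocity moebius_manifold I \<gamma>" and sm: "smooth_curve moebius_manifold I \<gamma>"
    and \<gamma>H: "\<gamma> ` I \<subseteq> degeneracy_set moebius_manifold moebius_metric" and \<gamma>0: "\<gamma> 0 = q"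
    using h unfolding tangent_to_def by auto
  show "h \<in> tangent_space moebius_manifold q"
    using moebius.velocity_tangent[OF sm] by (simp add: h_eq \<gamma>0)
  have at: "moebius_chart a \<in> charts_at moebius_manifold (\<gamma> 0)"
    unfolding \<gamma>0 by (rule moebius_charts_at[OF a])
  define A where "A = {t \<in> I. \<gamma> t \<in> moebius_strip a}"
  have op: "openin (top_of moebius_manifold) (moebius_strip a)"
    by (simp add: openin_moebius_strip)
  note w = moebius.curve_at_within[OF sm op, unfolded \<gamma>0, OF a]
  have sq: "height a (\<gamma> t) * height a (\<gamma> t) = 1" if "t \<in> A" for t
    using that \<gamma>H width_eq[of "\<gamma> t" a] by (auto simp: A_def moebius_degeneracy_set power2_eq_square)
  have A0: "0 \<in> A"
    using w(2) a \<gamma>0 by (simp add: A_def)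
  define v where "v = h (moebius_chart a) 1"
  have "((\<lambda>t. height a (\<gamma> t)) has_real_derivative v) (at 0 within A)"
    using moebius.velocity_component[OF sm at, of 1]
    by (simp add: v_def h_eq A_def fst_moebius_chart) (simp add: moebius_chart_def)
  from DERIV_mult[OF this this]
  have "((\<lambda>t. height a (\<gamma> t) * height a (\<gamma> t)) has_real_derivative 2 * height a q * v) (at 0 within A)"
    by (simp add: \<gamma>0 algebra_simps)
  moreover have "((\<lambda>t. height a (\<gamma> t) * height a (\<gamma> t)) has_real_derivative 0) (at 0 within A)"
  proof (rule has_field_derivative_transform_within[where d = 1 and f = "\<lambda>_. 1"])
    show "1 = height a (\<gamma> t) * height a (\<gamma> t)" if "t \<in> A" for t
      using sq[OF that] by simp
  qed (use A0 in auto)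
  moreover have "at 0 within A \<noteq> bot"
    using w(1,3) by (simp add: A_def)
  ultimately have "2 * height a q * v = 0"
    by (intro has_field_derivative_unique)
  moreover have "height a q \<noteq> 0"
    using sq[OF A0] \<gamma>0 by auto
  ultimately show "h (moebius_chart a) 1 = 0"
    by (simp add: v_def)
qed

text \<open>In strip coordinates the radical is the second axis and the tangent space of the
  degeneracy set is the first axis.\<close>

lemma moebius_transverse_radical: "transverse_radical moebius_manifold moebius_metric"
  unfolding transverse_radical_def
proof (intro ballI conjI)
  let ?H = "degeneracy_set moebius_manifold moebius_metric"
  fix q assume q: "q \<in> ?H"
  then have w: "width q = 1" and qs: "q \<in> moebius_set"
    by (simp_all add: moebius_degeneracy_set)
  define a where "a = moebius_index q"
  have a: "q \<in> moebius_strip a"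
    unfolding a_def by (rule moebius_index[OF qs])
  note rad = moebius_Rad_iff[OF a]
  note tan = moebius_tangent_to_horizontal[OF _ a]
  have "tzero = moebius_vec a q 0 0"
    using moebius_vec[OF a] by (intro moebius_tangent_eqI[OF a] moebius.tzero_tangent) (simp_all add: tzero_def)
  then have "tzero \<in> tangent_to moebius_manifold ?H q"
    using moebius_horizontal_tangent[OF q a, of 0] by simp
  moreover have "tzero \<in> Rad moebius_manifold moebius_metric q"
    unfolding rad using moebius.tzero_tangent by (simp add: tzero_def)
  moreover have "v = tzero" if "v \<in> Rad moebius_manifold moebius_metric q" "v \<in> tangent_to moebius_manifold ?H q" for v
    using that(1) tan(2)[OF that(2)] unfolding rad
    by (intro moebius_tangent_eqI[OF a] moebius.tzero_tangent) (simp_all add: tzero_def)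
  ultimately show "Rad moebius_manifold moebius_metric q \<inter> tangent_to moebius_manifold ?H q = {tzero}"
    by auto
  show "{tadd r h |r h. r \<in> Rad moebius_manifold moebius_metric q \<and> h \<in> tangent_to moebius_manifold ?H q} =
      tangent_space moebius_manifold q"
  proof (intro equalityI subsetI)
    fix v assume "v \<in> {tadd r h |r h. r \<in> Rad moebius_manifold moebius_metric q \<and> h \<in> tangent_to moebius_manifold ?H q}"
    then obtain r h where "v = tadd r h" "r \<in> Rad moebius_manifold moebius_metric q" "h \<in> tangent_to moebius_manifold ?H q"
      by auto
    then show "v \<in> tangent_space moebius_manifold q"
      using tan(1) rad by (simp add: moebius.tadd_tangent)
  next
    fix v assume v: "v \<in> tangent_space moebius_manifold q"
    define r where "r = moebius_vec a q 0 (v (moebius_chart a) 1)"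
    define h where "h = moebius_vec a q (v (moebius_chart a) 0) 0"
    have "r \<in> Rad moebius_manifold moebius_metric q"
      unfolding rad r_def using moebius_vec[OF a] w by simp
    moreover have "h \<in> tangent_to moebius_manifold ?H q"
      unfolding h_def by (rule moebius_horizontal_tangent[OF q a])
    moreover have "v = tadd r h"
      unfolding r_def h_def
      by (intro moebius_tangent_eqI[OF a v] moebius.tadd_tangent moebius_vec(1)[OF a])
        (simp_all add: tadd_def moebius_vec(2,3)[OF a, simplified])
    ultimately show "v \<in> {tadd r h |r h. r \<in> Rad moebius_manifold moebius_metric q \<and> h \<in> tangent_to moebius_manifold ?H q}"
      by auto
  qed
qed

section \<open>Invariant fields on the Lorentzian part\<close>

lemma moebius_vec_change:
  assumes p: "p \<in> moebius_strip a" and k: "\<bar>angle a p + 2 * pi * of_int k - b\<bar> < pi"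
  shows "moebius_vec a p s t = moebius_vec b p s (flip_sign k * t)"
proof -
  note b = moebius_chart_change(1)[OF p k]
  show ?thesis
    using moebius_tangent_change[OF moebius_vec(1)[OF p] p k] moebius_vec(2,3)[OF p]
    by (intro moebius_tangent_eqI[OF b] moebius_vec(1) p b) (simp_all add: moebius_vec(2,3)[OF b, simplified])
qed

text \<open>The horizontal field \<open>\<partial>/\<partial>x\<close> and the Euler field \<open>y \<partial>/\<partial>y\<close> do not depend on the chart,
  because the sign change of \<open>y\<close> cancels in the latter.\<close>

definition moebius_horizontal :: "(nat \<Rightarrow> real) \<Rightarrow> (nat \<Rightarrow> real) tvec"
  where "moebius_horizontal p = moebius_vec (moebius_index p) p 1 0"

definition moebius_euler :: "(nat \<Rightarrow> real) \<Rightarrow> (nat \<Rightarrow> real) tvec"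
  where "moebius_euler p = moebius_vec (moebius_index p) p 0 (height (moebius_index p) p)"

lemma moebius_fields_eq:
  assumes a: "p \<in> moebius_strip a"
  shows "moebius_horizontal p = moebius_vec a p 1 0" "moebius_euler p = moebius_vec a p 0 (height a p)"
proof -
  have i: "p \<in> moebius_strip (moebius_index p)"
    using a moebius_strip_subset by (intro moebius_index) auto
  obtain k :: int where k: "\<bar>angle (moebius_index p) p + 2 * pi * of_int k - a\<bar> < pi"
    using moebius_chart_change_exists[OF i a] by auto
  show "moebius_horizontal p = moebius_vec a p 1 0"
    using moebius_vec_change[OF i k, of 1 0] by (simp add: moebius_horizontal_def)
  show "moebius_euler p = moebius_vec a p 0 (height a p)"
    unfolding moebius_euler_def moebius_vec_change[OF i k] moebius_chart_change(2)[OF i k] ..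
qed

lemma moebius_outer_subset: "moebius_outer \<subseteq> moebius_set"
  by (auto simp: moebius_outer_def)

text \<open>Continuity is invisible in a definition through \<open>moebius_index\<close>; on a fixed
  strip, however, the components are \<open>f a\<close> and \<open>g a\<close>. These may depend on
  the strip, as \<open>height a\<close> does.\<close>

lemma moebius_continuous_fieldI:
  assumes "S \<subseteq> moebius_set"
    and W: "\<And>p a. p \<in> S \<Longrightarrow> p \<in> moebius_strip a \<Longrightarrow> W p = moebius_vec a p (f a p) (g a p)"
    and fg: "\<And>a. continuous_on (moebius_strip a) (f a)" "\<And>a. continuous_on (moebius_strip a) (g a)"
  shows "continuous_vector_field_on moebius_manifold S W"
proof (rule moebius.continuous_vector_field_onI)
  fix p assume p: "p \<in> S"
  define a where "a = moebius_index p"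
  have a: "p \<in> moebius_strip a"
    unfolding a_def using p assms(1) by (intro moebius_index) auto
  show "W p \<in> tangent_space moebius_manifold p"
    using W[OF p a] moebius_vec(1)[OF a] by simp
  have c: "continuous_on (S \<inter> moebius_strip a) (\<lambda>p. W p (moebius_chart a) j)" if "j < 2" for j
  proof (cases "j = 0")
    case True
    have "continuous_on (S \<inter> moebius_strip a) (f a)"
      by (rule continuous_on_subset[OF fg(1)]) simp
    then show ?thesis
      by (rule continuous_on_eq) (simp add: W[of _ a] moebius_vec True)
  next
    case False
    then have j: "j = 1"
      using that by simp
    have "continuous_on (S \<inter> moebius_strip a) (g a)"
      by (rule continuous_on_subset[OF fg(2)]) simp
    then show ?thesis
      by (rule continuous_on_eq) (simp add: W[of _ a] moebius_vec(3)[simplified] j)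
  qed
  have "moebius_set \<inter> (S \<inter> moebius_strip a) = S \<inter> moebius_strip a"
    using assms(1) by auto
  then show "\<exists>d\<in>charts_at moebius_manifold p. \<forall>j<dim_of moebius_manifold.
      continuous_map (subtopology (top_of moebius_manifold) (S \<inter> fst d)) euclideanreal (\<lambda>p. W p d j)"
    using c by (intro bexI[OF _ moebius_charts_at[OF a]]) (simp add: subtopology_subtopology fst_moebius_chart)
qed (use assms(1) in simp)

lemma moebius_pseudo_time_orientable: "pseudo_time_orientable moebius_manifold moebius_metric"
  unfolding pseudo_time_orientable_def moebius_lorentzian_region
proof (intro exI[of _ moebius_euler] conjI ballI)
  show "continuous_vector_field_on moebius_manifold moebius_outer moebius_euler"
    by (rule moebius_continuous_fieldI[OF moebius_outer_subset, where f = "\<lambda>_ _. 0" and g = height])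
      (simp_all add: moebius_fields_eq continuous_on_height)
  fix p assume "p \<in> moebius_outer"
  then have w: "1 < width p" and a: "p \<in> moebius_strip (moebius_index p)"
    using moebius_index by (auto simp: moebius_outer_def)
  have "moebius_metric p (moebius_euler p) (moebius_euler p) = (1 - width p) * width p"
    unfolding moebius_euler_def moebius_metric_eq[OF a moebius_vec(1)[OF a] moebius_vec(1)[OF a]] moebius_vec(2,3)[OF a]
    using width_eq[OF a] by (simp add: power2_eq_square)
  then show "moebius_metric p (moebius_euler p) (moebius_euler p) < 0"
    using w by (simp add: mult_neg_pos)
qed

lemma moebius_pseudo_space_orientable: "pseudo_space_orientable moebius_manifold moebius_metric"
  unfolding pseudo_space_orientable_def moebius_lorentzian_region
proof (intro exI[of _ "\<lambda>_. moebius_horizontal"] conjI ballI allI impI)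
  show "continuous_vector_field_on moebius_manifold moebius_outer moebius_horizontal"
    by (rule moebius_continuous_fieldI[OF moebius_outer_subset, where f = "\<lambda>_ _. 1" and g = "\<lambda>_ _. 0"])
      (simp_all add: moebius_fields_eq)
  fix p i j assume p: "p \<in> moebius_outer"
    and ij: "i < dim_of moebius_manifold - 1" "j < dim_of moebius_manifold - 1"
  have a: "p \<in> moebius_strip (moebius_index p)"
    using p moebius_outer_subset by (intro moebius_index) auto
  \<comment> \<open>In dimension two a frame of \<open>n - 1\<close> fields is a single field: both
    indices are 0, so only the diagonal case occurs.\<close>
  show "moebius_metric p (moebius_horizontal p) (moebius_horizontal p) = (if i = j then 1 else 0)"
    unfolding moebius_horizontal_def moebius_metric_eq[OF a moebius_vec(1)[OF a] moebius_vec(1)[OF a]] moebius_vec(2,3)[OF a]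
    using ij by simp
qed

section \<open>Non-orientability\<close>

lemma moebius_coord_vec:
  assumes "p \<in> moebius_strip a"
  shows "coord_vec moebius_manifold (moebius_chart a) p 0 = moebius_vec a p 1 0"
    "coord_vec moebius_manifold (moebius_chart a) p 1 = moebius_vec a p 0 1"
proof -
  note at = moebius_charts_at[OF assms]
  have c: "coord_vec moebius_manifold (moebius_chart a) p j (moebius_chart a) i = (if i = j then 1 else 0)"
    if "i < 2" "j < 2" for i j
    using moebius.coord_vec_component[OF at] moebius.jacobian_self[OF at] that by simp
  show "coord_vec moebius_manifold (moebius_chart a) p 0 = moebius_vec a p 1 0"
    using c[of 0 0] c[of 1 0] moebius_vec[OF assms]
    by (intro moebius_tangent_eqI[OF assms] moebius.coord_vec_tangent[OF at]) simp_all
  show "coord_vec moebius_manifold (moebius_chart a) p 1 = moebius_vec a p 0 1"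
    using c[of 0 1] c[of 1 1] moebius_vec[OF assms]
    by (intro moebius_tangent_eqI[OF assms] moebius.coord_vec_tangent[OF at]) simp_all
qed

lemma moebius_vec_lin:
  assumes a: "p \<in> moebius_strip a" and v: "v \<in> tangent_space moebius_manifold p"
  shows "v = tadd (tscale (v (moebius_chart a) 0) (moebius_vec a p 1 0)) (tscale (v (moebius_chart a) 1) (moebius_vec a p 0 1))"
  by (intro moebius_tangent_eqI[OF a v] moebius.tadd_tangent moebius.tscale_tangent moebius_vec(1)[OF a])
    (simp_all add: tadd_def tscale_def moebius_vec(2,3)[OF a, simplified])

text \<open>Evaluating a nowhere vanishing top form on the coordinate frame along the core circle
  gives a continuous function \<open>vol\<close> of the angle without zeros. After a full turn the
  base point is the same but \<open>d/dy\<close> is reversed, so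
  \<open>vol (2 * pi) = - vol 0\<close>, against the intermediate value theorem.\<close>

lemma moebius_not_orientable: "\<not> orientable moebius_manifold"
proof
  assume "orientable moebius_manifold"
  then obtain \<omega> where \<omega>: "smooth_top_form moebius_manifold \<omega>"
    and nz: "\<And>p. p \<in> moebius_set \<Longrightarrow> \<exists>vs. length vs = 2 \<and> set vs \<subseteq> tangent_space moebius_manifold p \<and> \<omega> p vs \<noteq> 0"
    unfolding orientable_def by auto
  have lin: "\<omega> p (vs[i := tadd (tscale s u) (tscale t w)]) = s * \<omega> p (vs[i := u]) + t * \<omega> p (vs[i := w])"
    if "p \<in> moebius_set" "length vs = 2" "set vs \<subseteq> tangent_space moebius_manifold p" "i < 2"
      "u \<in> tangent_space moebius_manifold p" "w \<in> tangent_space moebius_manifold p" for p vs i s t u w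
    using \<omega> that unfolding smooth_top_form_def by simp
  have lin0: "\<omega> p [tadd (tscale s u) (tscale t w), v] = s * \<omega> p [u, v] + t * \<omega> p [w, v]"
    and lin1: "\<omega> p [v, tadd (tscale s u) (tscale t w)] = s * \<omega> p [v, u] + t * \<omega> p [v, w]"
    if "p \<in> moebius_set" "u \<in> tangent_space moebius_manifold p" "w \<in> tangent_space moebius_manifold p"
      "v \<in> tangent_space moebius_manifold p" for p u v w s t
    \<comment> \<open>The list \<open>[v, v]\<close> only provides a frame of length two: one entry
      is overwritten by the update and the other remains as the fixed argument.\<close>
    using lin[of p "[v, v]" 0 u w s t] lin[of p "[v, v]" 1 u w s t] that by simp_all
  have alt: "\<omega> p [v, v] = 0" if "p \<in> moebius_set" "v \<in> tangent_space moebius_manifold p" for p v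
  proof -
    have "\<forall>i<2. \<forall>j<2. i \<noteq> j \<and> [v, v] ! i = [v, v] ! j \<longrightarrow> \<omega> p [v, v] = 0"
      using \<omega> that unfolding smooth_top_form_def by simp
    from this[rule_format, of 0 1] show ?thesis
      by simp
  qed
  \<comment> \<open>The argument is the real angle, not the point on the circle: the frame is taken
    from the strip centred at \<open>x\<close>, so two angles of the same point may give opposite
    values.\<close>
  define vol where "vol x = \<omega> (moebius_pt x 0) [moebius_vec x (moebius_pt x 0) 1 0, moebius_vec x (moebius_pt x 0) 0 1]" for x
  have vol_nz: "vol x \<noteq> 0" for x
  proof
    let ?p = "moebius_pt x 0"
    let ?e = "moebius_vec x ?p 1 0" and ?f = "moebius_vec x ?p 0 1"
    assume z: "vol x = 0"
    have s: "?p \<in> moebius_strip x" and M: "?p \<in> moebius_set"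
      by (rule moebius_in_strip_self moebius_in_set)+
    note t = moebius_vec(1)[OF s]
    have ef: "\<omega> ?p [?e, ?f] = 0"
      using z by (simp add: vol_def)
    \<comment> \<open>Expanding the form on the repeated argument \<open>?e + ?f\<close> turns the
      alternating property into antisymmetry on the basis.\<close>
    have "\<omega> ?p [tadd (tscale 1 ?e) (tscale 1 ?f), tadd (tscale 1 ?e) (tscale 1 ?f)] = 0"
      by (intro alt M moebius.tadd_tangent moebius.tscale_tangent t)
    then have fe: "\<omega> ?p [?f, ?e] = 0"
      using lin0[OF M t t] lin1[OF M t t t] alt[OF M t] ef
      by (simp add: moebius.tadd_tangent moebius.tscale_tangent t)
    obtain vs where vs: "length vs = 2" "set vs \<subseteq> tangent_space moebius_manifold ?p" "\<omega> ?p vs \<noteq> 0"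
      using nz[OF M] by auto
    then obtain u w where uw: "vs = [u, w]"
      by (auto simp: numeral_2_eq_2 length_Suc_conv)
    have u: "u \<in> tangent_space moebius_manifold ?p" and w: "w \<in> tangent_space moebius_manifold ?p"
      using vs(2) uw by auto
    \<comment> \<open>All values on pairs of basis vectors vanish; expanding first \<open>w\<close>
      and then \<open>u\<close> in the basis makes every value of the form at \<open>?p\<close>
      vanish.\<close>
    have "\<omega> ?p [?e, w] = 0" "\<omega> ?p [?f, w] = 0"
      using lin1[OF M t t t, of 1 0 "w (moebius_chart x) 0" 1 0 "w (moebius_chart x) 1" 0 1]
        lin1[OF M t t t, of 0 1 "w (moebius_chart x) 0" 1 0 "w (moebius_chart x) 1" 0 1]
        alt[OF M t] ef fe moebius_vec_lin[OF s w] by (metis add_0 mult_zero_right)+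
    then have "\<omega> ?p [u, w] = 0"
      using lin0[OF M t t w, of "u (moebius_chart x) 0" 1 0 "u (moebius_chart x) 1" 0 1]
        moebius_vec_lin[OF s u] by (metis add_0 mult_zero_right)
    then show False
      using vs(3) uw by simp
  qed
  have vol_cont: "isCont vol a" for a
  proof -
    \<comment> \<open>\<open>F\<close> is the coefficient of the form in the chart \<open>a\<close>,
      which is smooth by assumption; near \<open>a\<close> the function \<open>vol\<close> is its
      restriction to the axis of height 0.\<close>
    define F where "F z = (let p = chart_inv (moebius_chart a) z in \<omega> p (map (coord_vec moebius_manifold (moebius_chart a) p) [0..<2]))" for z
    define l where "l x = (\<lambda>i::nat. if i = 0 then x else (0::real))" for x
    define I where "I = {a - pi <..< a + pi}"
    have "smooth_on 2 (chart_image (moebius_chart a)) F"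
      using \<omega> moebius_chart_in_atlas[of a] unfolding smooth_top_form_def F_def[abs_def] by simp
    then have "continuous_on (chart_image (moebius_chart a)) F"
      using smooth_on_open_iff[OF openin_moebius_chart_image] smooth_open_continuous_on by simp
    moreover have "l x \<in> chart_image (moebius_chart a)" if "x \<in> I" for x
      using that by (auto simp: I_def l_def moebius_chart_image topspace_Euclidean_space)
    moreover have "continuous_on I l"
    proof (rule continuous_on_coordinatewise_then_product)
      show "continuous_on I (\<lambda>x. l x i)" for i
        by (cases "i = 0") (simp_all add: l_def)
    qed
    ultimately have "continuous_on I (\<lambda>x. F (l x))"
      by (intro continuous_on_compose2[of "chart_image (moebius_chart a)" F I l]) auto
    moreover have "F (l x) = vol x" if "x \<in> I" for x
    proof -
      have x: "\<bar>x - a\<bar> < pi"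
        using that by (auto simp: I_def)
      have inv: "chart_inv (moebius_chart a) (l x) = moebius_pt x 0"
        using moebius_chart_inv[of "l x" a] x by (simp add: moebius_chart_image l_def topspace_Euclidean_space abs_less_iff)
      \<comment> \<open>The angle \<open>x\<close> itself lies in the window of \<open>a\<close>, so
        the integer is 0 and the frames of the two strips agree without a sign.\<close>
      have k: "\<bar>angle x (moebius_pt x 0) + 2 * pi * of_int 0 - a\<bar> < pi"
        using x angle_moebius[of x x 0] by simp
      have "moebius_vec x (moebius_pt x 0) s t = moebius_vec a (moebius_pt x 0) s t" for s t
        using moebius_vec_change[OF moebius_in_strip_self k] by (simp add: flip_sign_def)
      then show ?thesis
        using moebius_coord_vec[OF moebius_in_stripI[OF x, of 0]]
        by (simp add: F_def inv vol_def Let_def numeral_2_eq_2)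
    qed
    ultimately have "continuous_on I vol"
      by (rule continuous_on_eq)
    then show ?thesis
      by (rule continuous_on_interior) (simp add: I_def)
  qed
  have flip: "vol (2 * pi) = - vol 0"
  proof -
    let ?p = "moebius_pt 0 0"
    have p: "moebius_pt (2 * pi) 0 = ?p"
      using moebius_periodic[of 0 1 0] by simp
    have s: "?p \<in> moebius_strip 0" and M: "?p \<in> moebius_set"
      by (rule moebius_in_strip_self moebius_in_set)+
    note t = moebius_vec(1)[OF s]
    \<comment> \<open>One turn carries the angle 0 to the centre \<open>2 * pi\<close>; the integer
      1 is odd, so the second frame vector is reversed.\<close>
    have k: "\<bar>angle 0 ?p + 2 * pi * of_int 1 - 2 * pi\<bar> < pi"
      using angle_moebius[of 0 0 0] by simp
    have "moebius_vec (2 * pi) ?p 1 0 = moebius_vec 0 ?p 1 0"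
      "moebius_vec (2 * pi) ?p 0 1 = moebius_vec 0 ?p 0 (- 1)"
      using moebius_vec_change[OF s k, of 1 0] moebius_vec_change[OF s k, of 0 "- 1"] by (simp_all add: flip_sign_def)
    moreover have "moebius_vec 0 ?p 0 (- 1) = tadd (tscale 0 (moebius_vec 0 ?p 1 0)) (tscale (- 1) (moebius_vec 0 ?p 0 1))"
      using moebius_vec_lin[OF s t, of 0 "- 1"] moebius_vec(2,3)[OF s] by simp
    ultimately show ?thesis
      using lin1[OF M t t t, of 1 0 0 1 0 "- 1" 0 1] by (simp add: vol_def p)
  qed
  have "\<exists>x. vol x = 0"
  proof (cases "vol 0 \<le> 0")
    case True
    then show ?thesis
      using IVT[of vol 0 0 "2 * pi"] flip vol_cont by auto
  next
    case False
    then show ?thesis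
      using IVT2[of vol "2 * pi" 0 0] flip vol_cont by auto
  qed
  then show False
    using vol_nz by auto
qed

theorem proposition1p10:
  shows "\<exists>(M :: (nat \<Rightarrow> real) manifold) g.
    transverse_signature_changing M g \<and> transverse_radical M g \<and>
    pseudo_time_orientable M g \<and> pseudo_space_orientable M g \<and>
    \<not> orientable M"
  using moebius_signature_changing moebius_transverse_radical moebius_pseudo_time_orientable
    moebius_pseudo_space_orientable moebius_not_orientable by blast

end
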